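(* Let $\dot x=F(x)=Ax+X(x)$ be an analytic system near $0\in\mathbb C^n$ (not necessarily in normal form), where $X$ has only terms of degree at least two and $A$ is in lower-triangular Jordan form with diagonal $\lambda=\mu+i\nu$, $\mu,\nu\in\mathbb R^n$. Let $l\ge2$ be such that $$0=\mu_1=\dots=\mu_l<\mu_{l+1}\le\dots\le\mu_n,$$ and assume that at least one of $\lambda_1,\dots,\lambda_l$ is nonzero. If the system admits $l-1$ independent formal first integrals, then there exists a convergent normalizing transformation.
   Context: The matrix $A$ has diagonal entries $\lambda_1,\dots,\lambda_n$, subdiagonal entries $\sigma_2,\dots,\sigma_n\in\mathbb C$ with $\sigma_i=0$ whenever $\lambda_i\ne\lambda_{i-1}$, and all other entries zero. A formal first integral is a formal power series $\psi\in\mathbb C[[x_1,\dots,x_n]]$ with $D\psi(x)F(x)=0$; formal first integrals are independent if their Jacobian matrix has full rank over the fraction field $\mathbb C((x_1,\dots,x_n))$. Let $\mathbf N_i=\{Q\in\mathbb Z^n: q_i\ge -1,\ q_j\ge 0 \text{ for } j\ne i\}$, $\mathbf N=\bigcup_i\mathbf N_i$, $\langle Q,\lambda\rangle=\sum q_i\lambda_i$, and let $\odot$ be the componentwise product. Every formal power series vector field is written uniquely as $\sum_{Q\in\mathbf N}(x\odot F_Q)x^Q$, $F_Q\in\mathbb C^n$ (the $i$-th entry of $F_Q$ being $0$ unless $Q\in\mathbf N_i$); it is in Poincaré-Dulac normal form if $F_Q=0$ whenever $\langle Q,\lambda\rangle\ne0$. A transformation is a formal substitution $x=H(y)=y+h(y)$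 with $h$ having only terms of degree at least two; the transformed field $\widetilde F$ is defined by $DH(y)\widetilde F(y)=F(H(y))$. It is normalizing if $\widetilde F$ is in normal form, and convergent if $H$ converges near $0$. *)

theory Defs
  imports "HOL-Analysis.Analysis" "HOL-Computational_Algebra.Fraction_Field"
begin

section \<open>Multivariate formal power series\<close>

text \<open>
  The index type \<open>'n\<close> plays the role of $\{1,\dots,n\}$; multi-indices are vectors in
  \<^typ>\<open>nat ^ 'n\<close>, and a formal power series is its family of coefficients.
\<close>

typedef ('a, 'n) mfps = "UNIV :: (nat ^ 'n \<Rightarrow> 'a) set"
  morphisms mfps_coeff Abs_mfps
  by simp

lemma mfps_coeff_Abs [simp]: "mfps_coeff (Abs_mfps f) \<alpha> = f \<alpha>"
  by (simp add: Abs_mfps_inverse)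

lemma mfps_eq_iff: "f = g \<longleftrightarrow> (\<forall>\<alpha>. mfps_coeff f \<alpha> = mfps_coeff g \<alpha>)"
  by (simp add: mfps_coeff_inject [symmetric] fun_eq_iff)

lemma mfps_eqI: "(\<And>\<alpha>. mfps_coeff f \<alpha> = mfps_coeff g \<alpha>) \<Longrightarrow> f = g"
  by (simp add: mfps_eq_iff)

definition splits :: "nat ^ 'n \<Rightarrow> ((nat ^ 'n) \<times> (nat ^ 'n)) set" where
  "splits \<gamma> = {(\<alpha>, \<beta>). \<alpha> + \<beta> = \<gamma>}"

lemma finite_bounded_vec: "finite {\<alpha> :: nat ^ 'n. \<forall>i. \<alpha> $ i \<le> b i}"
proof -
  have "finite (vec_lambda ` (\<Pi>\<^sub>E i\<in>(UNIV :: 'n set). {..b i}) :: (nat ^ 'n) set)"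
    by (intro finite_imageI finite_PiE) auto
  moreover have "{\<alpha> :: nat ^ 'n. \<forall>i. \<alpha> $ i \<le> b i} \<subseteq> vec_lambda ` (\<Pi>\<^sub>E i\<in>UNIV. {..b i})"
  proof
    fix \<alpha> :: "nat ^ 'n" assume "\<alpha> \<in> {\<alpha>. \<forall>i. \<alpha> $ i \<le> b i}"
    then have "vec_nth \<alpha> \<in> (\<Pi>\<^sub>E i\<in>UNIV. {..b i})" by auto
    then show "\<alpha> \<in> vec_lambda ` (\<Pi>\<^sub>E i\<in>UNIV. {..b i})"
      by (metis image_eqI vec_nth_inverse)
  qed
  ultimately show ?thesis by (rule finite_subset [rotated])
qed

lemma finite_splits [simp]: "finite (splits \<gamma>)"
proof (rule finite_subset)
  let ?S = "{\<alpha>. \<forall>i. \<alpha> $ i \<le> \<gamma> $ i}"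
  show "splits \<gamma> \<subseteq> ?S \<times> ?S" by (auto simp: splits_def)
  show "finite (?S \<times> ?S)" by (intro finite_cartesian_product finite_bounded_vec)
qed

instantiation mfps :: (zero, finite) zero
begin
definition "0 = Abs_mfps (\<lambda>_. 0)"
instance ..
end

instantiation mfps :: (zero_neq_one, finite) one
begin
definition "1 = Abs_mfps (\<lambda>\<alpha>. if \<alpha> = 0 then 1 else 0)"
instance ..
end

instantiation mfps :: (plus, finite) plus
begin
definition "f + g = Abs_mfps (\<lambda>\<alpha>. mfps_coeff f \<alpha> + mfps_coeff g \<alpha>)"
instance ..
end

instantiation mfps :: (minus, finite) minus
begin
definition "f - g = Abs_mfps (\<lambda>\<alpha>. mfps_coeff f \<alpha> - mfps_coeff g \<alpha>)"
instance ..
end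

instantiation mfps :: (uminus, finite) uminus
begin
definition "- f = Abs_mfps (\<lambda>\<alpha>. - mfps_coeff f \<alpha>)"
instance ..
end

instantiation mfps :: (comm_semiring_0, finite) times
begin
definition
  "f * g = Abs_mfps (\<lambda>\<gamma>. \<Sum>(\<alpha>, \<beta>)\<in>splits \<gamma>. mfps_coeff f \<alpha> * mfps_coeff g \<beta>)"
instance ..
end

lemma mfps_coeff_0 [simp]: "mfps_coeff 0 \<alpha> = 0"
  by (simp add: zero_mfps_def)

lemma mfps_coeff_1: "mfps_coeff 1 \<alpha> = (if \<alpha> = 0 then 1 else 0)"
  by (simp add: one_mfps_def)

lemma mfps_coeff_add [simp]: "mfps_coeff (f + g) \<alpha> = mfps_coeff f \<alpha> + mfps_coeff g \<alpha>"
  by (simp add: plus_mfps_def)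

lemma mfps_coeff_diff [simp]: "mfps_coeff (f - g) \<alpha> = mfps_coeff f \<alpha> - mfps_coeff g \<alpha>"
  by (simp add: minus_mfps_def)

lemma mfps_coeff_uminus [simp]: "mfps_coeff (- f) \<alpha> = - mfps_coeff f \<alpha>"
  by (simp add: uminus_mfps_def)

lemma mfps_coeff_mult:
  "mfps_coeff (f * g) \<gamma> = (\<Sum>(\<alpha>, \<beta>)\<in>splits \<gamma>. mfps_coeff f \<alpha> * mfps_coeff g \<beta>)"
  by (simp add: times_mfps_def)

instance mfps :: (comm_ring_1, finite) comm_ring_1
proof
  fix f g h :: "('a, 'b) mfps"
  show "f + g + h = f + (g + h)" "f + g = g + f" "0 + f = f" "- f + f = 0" "f - g = f + - g"
    by (auto intro!: mfps_eqI simp: algebra_simps)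
  show "f * g = g * f"
  proof (rule mfps_eqI)
    fix \<gamma>
    show "mfps_coeff (f * g) \<gamma> = mfps_coeff (g * f) \<gamma>"
      unfolding mfps_coeff_mult
      by (rule sum.reindex_bij_witness [where i = prod.swap and j = prod.swap])
        (auto simp: splits_def ac_simps)
  qed
  show "(f + g) * h = f * h + g * h"
    by (rule mfps_eqI)
      (simp add: mfps_coeff_mult case_prod_unfold distrib_right sum.distrib)
  show "1 * f = f"
  proof (rule mfps_eqI)
    fix \<gamma>
    have "mfps_coeff (1 * f) \<gamma> =
        (\<Sum>p\<in>{(0, \<gamma>)}. mfps_coeff (1 :: ('a, 'b) mfps) (fst p) * mfps_coeff f (snd p))"
      unfolding mfps_coeff_mult case_prod_unfold
      by (rule sum.mono_neutral_right, simp) (auto simp: splits_def mfps_coeff_1)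
    then show "mfps_coeff (1 * f) \<gamma> = mfps_coeff f \<gamma>" by (simp add: mfps_coeff_1)
  qed
  have "mfps_coeff 0 0 \<noteq> mfps_coeff (1 :: ('a, 'b) mfps) 0"
    by (simp add: mfps_coeff_1)
  then show "0 \<noteq> (1 :: ('a, 'b) mfps)" by metis
  show "f * g * h = f * (g * h)"
  proof (rule mfps_eqI)
    fix \<gamma>
    have "mfps_coeff (f * g * h) \<gamma> =
        (\<Sum>(p, q)\<in>(SIGMA p:splits \<gamma>. splits (fst p)).
          mfps_coeff f (fst q) * mfps_coeff g (snd q) * mfps_coeff h (snd p))"
      by (simp add: mfps_coeff_mult case_prod_unfold sum_distrib_right sum.Sigma)
    also have "\<dots> = (\<Sum>(p, q)\<in>(SIGMA p:splits \<gamma>. splits (snd p)).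
          mfps_coeff f (fst p) * (mfps_coeff g (fst q) * mfps_coeff h (snd q)))"
      by (rule sum.reindex_bij_witness
          [where i = "\<lambda>(p, q). ((fst p + fst q, snd q), (fst p, fst q))"
             and j = "\<lambda>(p, q). ((fst q, snd q + snd p), (snd q, snd p))"])
        (auto simp: splits_def ac_simps)
    also have "\<dots> = mfps_coeff (f * (g * h)) \<gamma>"
      by (simp add: mfps_coeff_mult case_prod_unfold sum_distrib_left sum.Sigma)
    finally show "mfps_coeff (f * g * h) \<gamma> = mfps_coeff (f * (g * h)) \<gamma>" .
  qed
qed

text \<open>
  Absence of zero divisors: minimising the coordinates of the exponents one after the other
  isolates a pair of exponents whose sum is attained by no other pair.
\<close>

lemma unique_extremal_sum:
  fixes S T :: "(nat ^ 'n) set"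
  assumes "S \<noteq> {}" "T \<noteq> {}"
  shows "\<exists>\<alpha>\<in>S. \<exists>\<beta>\<in>T. \<forall>\<alpha>'\<in>S. \<forall>\<beta>'\<in>T. \<alpha>' + \<beta>' = \<alpha> + \<beta> \<longrightarrow> \<alpha>' = \<alpha> \<and> \<beta>' = \<beta>"
proof -
  have "\<exists>S' T'. S' \<subseteq> S \<and> T' \<subseteq> T \<and> S' \<noteq> {} \<and> T' \<noteq> {} \<and>
      (\<forall>\<alpha>\<in>S'. \<forall>\<alpha>'\<in>S'. \<forall>i\<in>I. \<alpha> $ i = \<alpha>' $ i) \<and>
      (\<forall>\<beta>\<in>T'. \<forall>\<beta>'\<in>T'. \<forall>i\<in>I. \<beta> $ i = \<beta>' $ i) \<and>
      (\<forall>\<alpha>\<in>S'. \<forall>\<beta>\<in>T'. \<forall>\<alpha>'\<in>S. \<forall>\<beta>'\<in>T. \<alpha>' + \<beta>' = \<alpha> + \<beta> \<longrightarrow> \<alpha>' \<in> S' \<and> \<beta>' \<in> T')"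
    (is "?P I") if "finite I" for I :: "'n set"
    using that
  proof (induction I rule: finite_induct)
    case empty
    show ?case using assms by (intro exI [of _ S] exI [of _ T]) auto
  next
    case (insert i I)
    from insert.IH obtain S' T' where *: "S' \<subseteq> S" "T' \<subseteq> T" "S' \<noteq> {}" "T' \<noteq> {}"
      "\<forall>\<alpha>\<in>S'. \<forall>\<alpha>'\<in>S'. \<forall>i\<in>I. \<alpha> $ i = \<alpha>' $ i"
      "\<forall>\<beta>\<in>T'. \<forall>\<beta>'\<in>T'. \<forall>i\<in>I. \<beta> $ i = \<beta>' $ i"
      "\<forall>\<alpha>\<in>S'. \<forall>\<beta>\<in>T'. \<forall>\<alpha>'\<in>S. \<forall>\<beta>'\<in>T. \<alpha>' + \<beta>' = \<alpha> + \<beta> \<longrightarrow> \<alpha>' \<in> S' \<and> \<beta>' \<in> T'"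
      by (elim exE conjE) (rule that)
    obtain a where a: "a \<in> S'" "\<And>\<alpha>. \<alpha> \<in> S' \<Longrightarrow> a $ i \<le> \<alpha> $ i"
      using *(3) arg_min_nat_lemma [of "\<lambda>\<alpha>. \<alpha> \<in> S'" _ "\<lambda>\<alpha>. \<alpha> $ i"]
      by (metis ex_in_conv)
    obtain b where b: "b \<in> T'" "\<And>\<beta>. \<beta> \<in> T' \<Longrightarrow> b $ i \<le> \<beta> $ i"
      using *(4) arg_min_nat_lemma [of "\<lambda>\<beta>. \<beta> \<in> T'" _ "\<lambda>\<beta>. \<beta> $ i"]
      by (metis ex_in_conv)
    have closed: "(\<alpha>' \<in> S' \<and> \<alpha>' $ i = a $ i) \<and> (\<beta>' \<in> T' \<and> \<beta>' $ i = b $ i)"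
      if h: "\<alpha> \<in> S'" "\<alpha> $ i = a $ i" "\<beta> \<in> T'" "\<beta> $ i = b $ i"
        "\<alpha>' \<in> S" "\<beta>' \<in> T" "\<alpha>' + \<beta>' = \<alpha> + \<beta>" for \<alpha> \<beta> \<alpha>' \<beta>'
    proof -
      have in': "\<alpha>' \<in> S'" "\<beta>' \<in> T'" using *(7) h by blast+
      have "\<alpha>' $ i + \<beta>' $ i = a $ i + b $ i"
        using h(2,4,7) by (metis vector_add_component)
      with a(2) [OF in'(1)] b(2) [OF in'(2)] have "\<alpha>' $ i = a $ i" "\<beta>' $ i = b $ i"
        by linarith+
      with in' show ?thesis by blast
    qed
    let ?S = "{\<alpha>\<in>S'. \<alpha> $ i = a $ i}" and ?T = "{\<beta>\<in>T'. \<beta> $ i = b $ i}"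
    have eqS: "\<alpha> $ j = \<alpha>' $ j" if "\<alpha> \<in> ?S" "\<alpha>' \<in> ?S" "j \<in> insert i I" for \<alpha> \<alpha>' j
    proof (cases "j = i")
      case True
      with that show ?thesis by simp
    next
      case False
      with that have "\<alpha> \<in> S'" "\<alpha>' \<in> S'" "j \<in> I" by auto
      then show ?thesis using *(5) by blast
    qed
    have eqT: "\<beta> $ j = \<beta>' $ j" if "\<beta> \<in> ?T" "\<beta>' \<in> ?T" "j \<in> insert i I" for \<beta> \<beta>' j
    proof (cases "j = i")
      case True
      with that show ?thesis by simp
    next
      case False
      with that have "\<beta> \<in> T'" "\<beta>' \<in> T'" "j \<in> I" by auto
      then show ?thesis using *(6) by blast
    qed
    have "?S \<subseteq> S" "?T \<subseteq> T" "?S \<noteq> {}" "?T \<noteq> {}" using *(1,2) a(1) b(1) by blast+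
    moreover have "\<forall>\<alpha>\<in>?S. \<forall>\<alpha>'\<in>?S. \<forall>j\<in>insert i I. \<alpha> $ j = \<alpha>' $ j"
      using eqS by blast
    moreover have "\<forall>\<beta>\<in>?T. \<forall>\<beta>'\<in>?T. \<forall>j\<in>insert i I. \<beta> $ j = \<beta>' $ j"
      using eqT by blast
    moreover have "\<forall>\<alpha>\<in>?S. \<forall>\<beta>\<in>?T. \<forall>\<alpha>'\<in>S. \<forall>\<beta>'\<in>T. \<alpha>' + \<beta>' = \<alpha> + \<beta> \<longrightarrow> \<alpha>' \<in> ?S \<and> \<beta>' \<in> ?T"
      using closed by blast
    ultimately show ?case by (intro exI [of _ ?S] exI [of _ ?T] conjI)
  qed
  from this [OF finite_class.finite_UNIV] obtain S' T' where *: "S' \<subseteq> S" "T' \<subseteq> T" "S' \<noteq> {}" "T' \<noteq> {}"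
      "\<forall>\<alpha>\<in>S'. \<forall>\<alpha>'\<in>S'. \<forall>i\<in>UNIV. \<alpha> $ i = \<alpha>' $ i"
      "\<forall>\<beta>\<in>T'. \<forall>\<beta>'\<in>T'. \<forall>i\<in>UNIV. \<beta> $ i = \<beta>' $ i"
      "\<forall>\<alpha>\<in>S'. \<forall>\<beta>\<in>T'. \<forall>\<alpha>'\<in>S. \<forall>\<beta>'\<in>T. \<alpha>' + \<beta>' = \<alpha> + \<beta> \<longrightarrow> \<alpha>' \<in> S' \<and> \<beta>' \<in> T'"
    by (elim exE conjE) (rule that)
  from *(3,4) obtain \<alpha> \<beta> where ab: "\<alpha> \<in> S'" "\<beta> \<in> T'" by blast
  have "\<alpha>' = \<alpha> \<and> \<beta>' = \<beta>" if "\<alpha>' \<in> S" "\<beta>' \<in> T" "\<alpha>' + \<beta>' = \<alpha> + \<beta>" for \<alpha>' \<beta>'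
  proof -
    from that have "\<alpha>' \<in> S'" "\<beta>' \<in> T'" using *(7) ab by blast+
    then have "\<alpha>' $ i = \<alpha> $ i" "\<beta>' $ i = \<beta> $ i" for i using *(5,6) ab by blast+
    then show ?thesis unfolding vec_eq_iff by blast
  qed
  moreover have "\<alpha> \<in> S" "\<beta> \<in> T" using *(1,2) ab by blast+
  ultimately show ?thesis by blast
qed

instance mfps :: (idom, finite) idom
proof
  fix f g :: "('a, 'b) mfps"
  assume "f \<noteq> 0" "g \<noteq> 0"
  then have "{\<alpha>. mfps_coeff f \<alpha> \<noteq> 0} \<noteq> {}" "{\<beta>. mfps_coeff g \<beta> \<noteq> 0} \<noteq> {}"
    by (auto simp: mfps_eq_iff)
  from unique_extremal_sum [OF this] obtain \<alpha> \<beta>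
    where ab: "mfps_coeff f \<alpha> \<noteq> 0" "mfps_coeff g \<beta> \<noteq> 0"
      and uniq: "\<And>\<alpha>' \<beta>'. mfps_coeff f \<alpha>' \<noteq> 0 \<Longrightarrow> mfps_coeff g \<beta>' \<noteq> 0 \<Longrightarrow>
        \<alpha>' + \<beta>' = \<alpha> + \<beta> \<Longrightarrow> \<alpha>' = \<alpha> \<and> \<beta>' = \<beta>"
    by auto
  have "mfps_coeff (f * g) (\<alpha> + \<beta>) =
      (\<Sum>p\<in>{(\<alpha>, \<beta>)}. mfps_coeff f (fst p) * mfps_coeff g (snd p))"
    unfolding mfps_coeff_mult case_prod_unfold
  proof (rule sum.mono_neutral_right)
    show "\<forall>p\<in>splits (\<alpha> + \<beta>) - {(\<alpha>, \<beta>)}. mfps_coeff f (fst p) * mfps_coeff g (snd p) = 0"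
    proof
      fix p assume "p \<in> splits (\<alpha> + \<beta>) - {(\<alpha>, \<beta>)}"
      then have "fst p + snd p = \<alpha> + \<beta>" "\<not> (fst p = \<alpha> \<and> snd p = \<beta>)"
        by (auto simp: splits_def)
      with uniq [of "fst p" "snd p"] show "mfps_coeff f (fst p) * mfps_coeff g (snd p) = 0"
        by auto
    qed
  qed (simp, simp add: splits_def)
  with ab have "mfps_coeff (f * g) (\<alpha> + \<beta>) \<noteq> 0" by simp
  then show "f * g \<noteq> 0" by auto
qed

section \<open>Substitution, derivatives, convergence\<close>

definition mdeg :: "nat ^ 'n \<Rightarrow> nat" where
  "mdeg \<alpha> = (\<Sum>i\<in>UNIV. \<alpha> $ i)"

definition mfps_const :: "'a::zero \<Rightarrow> ('a, 'n::finite) mfps" where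
  "mfps_const c = Abs_mfps (\<lambda>\<alpha>. if \<alpha> = 0 then c else 0)"

definition mfps_var :: "'n \<Rightarrow> ('a::zero_neq_one, 'n::finite) mfps" where
  "mfps_var i = Abs_mfps (\<lambda>\<alpha>. if \<alpha> = axis i 1 then 1 else 0)"

definition order_at_least :: "nat \<Rightarrow> ('a::zero, 'n::finite) mfps \<Rightarrow> bool" where
  "order_at_least k f \<longleftrightarrow> (\<forall>\<alpha>. mdeg \<alpha> < k \<longrightarrow> mfps_coeff f \<alpha> = 0)"

definition mfps_deriv :: "'n \<Rightarrow> ('a::comm_semiring_1, 'n::finite) mfps \<Rightarrow> ('a, 'n) mfps" where
  "mfps_deriv i f = Abs_mfps (\<lambda>\<alpha>. of_nat (\<alpha> $ i + 1) * mfps_coeff f (\<alpha> + axis i 1))"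

text \<open>
  Substitution $f(H(y))$, meaningful when every component of \<open>H\<close> has zero constant term:
  then $H^\alpha$ has no terms of degree below $|\alpha|$, so truncating the sum over \<open>\<alpha>\<close>
  at $|\gamma|$ does not change the coefficient of $y^\gamma$.
\<close>

definition mfps_compose ::
  "('a::comm_ring_1, 'n::finite) mfps \<Rightarrow> ('a, 'm::finite) mfps ^ 'n \<Rightarrow> ('a, 'm) mfps" where
  "mfps_compose f H = Abs_mfps (\<lambda>\<gamma>.
     \<Sum>\<alpha> | mdeg \<alpha> \<le> mdeg \<gamma>. mfps_coeff f \<alpha> * mfps_coeff (\<Prod>i\<in>UNIV. (H $ i) ^ (\<alpha> $ i)) \<gamma>)"

lemma finite_mdeg_le [simp]: "finite {\<alpha> :: nat ^ 'n. mdeg \<alpha> \<le> k}"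
proof (rule finite_subset)
  have "\<alpha> $ i \<le> mdeg \<alpha>" for \<alpha> :: "nat ^ 'n" and i
    unfolding mdeg_def by (rule member_le_sum) auto
  then show "{\<alpha> :: nat ^ 'n. mdeg \<alpha> \<le> k} \<subseteq> {\<alpha>. \<forall>i. \<alpha> $ i \<le> k}"
    by (auto intro: order_trans)
qed (rule finite_bounded_vec)

definition mfps_term :: "(complex, 'n::finite) mfps \<Rightarrow> complex ^ 'n \<Rightarrow> nat ^ 'n \<Rightarrow> complex" where
  "mfps_term f x \<alpha> = mfps_coeff f \<alpha> * (\<Prod>i\<in>UNIV. (x $ i) ^ (\<alpha> $ i))"

definition convergent_mfps :: "(complex, 'n::finite) mfps \<Rightarrow> bool" where
  "convergent_mfps f \<longleftrightarrow> (\<forall>\<^sub>F x in nhds 0. mfps_term f x summable_on UNIV)"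

definition has_power_series_at_0 ::
  "(complex ^ 'n \<Rightarrow> complex ^ 'm) \<Rightarrow> (complex, 'n::finite) mfps ^ 'm::finite \<Rightarrow> bool" where
  "has_power_series_at_0 F P \<longleftrightarrow>
     (\<forall>\<^sub>F x in nhds 0. \<forall>i. (mfps_term (P $ i) x has_sum F x $ i) UNIV)"

section \<open>Formal vector fields, first integrals and normal forms\<close>

type_synonym 'n fvec = "(complex, 'n) mfps ^ 'n"

definition linear_field :: "complex ^ 'n ^ 'n \<Rightarrow> 'n::finite fvec" where
  "linear_field A = (\<chi> i. \<Sum>j\<in>UNIV. mfps_const (A $ i $ j) * mfps_var j)"

definition jacobian :: "(complex, 'n::finite) mfps ^ 'm \<Rightarrow> (complex, 'n) mfps ^ 'n ^ 'm" where
  "jacobian \<psi> = (\<chi> k j. mfps_deriv j (\<psi> $ k))"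

definition first_integral :: "'n::finite fvec \<Rightarrow> (complex, 'n) mfps \<Rightarrow> bool" where
  "first_integral F \<psi> \<longleftrightarrow> (\<Sum>j\<in>UNIV. mfps_deriv j \<psi> * F $ j) = 0"

definition independent_mfps :: "(complex, 'n::finite) mfps ^ 'm \<Rightarrow> bool" where
  "independent_mfps \<psi> \<longleftrightarrow>
     rank (map_matrix (\<lambda>f. Fract f 1) (jacobian \<psi>)) = min CARD('m) CARD('n)"

definition exponents_at :: "'n \<Rightarrow> (int ^ 'n) set" where
  "exponents_at i = {Q. Q $ i \<ge> -1 \<and> (\<forall>j. j \<noteq> i \<longrightarrow> Q $ j \<ge> 0)}"

definition exponents :: "(int ^ 'n) set" where
  "exponents = (\<Union>i. exponents_at i)"

definition pairing :: "int ^ 'n \<Rightarrow> complex ^ 'n \<Rightarrow> complex" where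
  "pairing Q lam = (\<Sum>i\<in>UNIV. of_int (Q $ i) * lam $ i)"

text \<open>
  The coefficient vector $F_Q$ in $F = \sum_Q (x \odot F_Q) x^Q$: the \<open>i\<close>-th component of
  this sum is $\sum_Q (F_Q)_i\, x^{Q + e_i}$, so $(F_Q)_i$ is the coefficient of
  $x^{Q + e_i}$ in $F_i$.
\<close>

definition vf_coeff :: "'n::finite fvec \<Rightarrow> int ^ 'n \<Rightarrow> complex ^ 'n" where
  "vf_coeff F Q = (\<chi> i. if Q \<in> exponents_at i
     then mfps_coeff (F $ i) (\<chi> j. nat (Q $ j + axis i 1 $ j)) else 0)"

definition poincare_dulac :: "complex ^ 'n \<Rightarrow> 'n::finite fvec \<Rightarrow> bool" where
  "poincare_dulac lam F \<longleftrightarrow> (\<forall>Q\<in>exponents. pairing Q lam \<noteq> 0 \<longrightarrow> vf_coeff F Q = 0)"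

definition transformation :: "'n::finite fvec \<Rightarrow> bool" where
  "transformation H \<longleftrightarrow> (\<exists>h. H = (\<chi> i. mfps_var i) + h \<and> (\<forall>i. order_at_least 2 (h $ i)))"

definition transforms_to :: "'n::finite fvec \<Rightarrow> 'n fvec \<Rightarrow> 'n fvec \<Rightarrow> bool" where
  "transforms_to F H G \<longleftrightarrow> jacobian H *v G = (\<chi> i. mfps_compose (F $ i) H)"

text \<open>
  For a transformation \<open>H\<close> the matrix $DH$ is invertible over the ring of formal power series,
  so the transformed field is unique and the existential quantifier refers to that field.
\<close>

definition normalizing :: "complex ^ 'n \<Rightarrow> 'n::finite fvec \<Rightarrow> 'n fvec \<Rightarrow> bool" where
  "normalizing lam F H \<longleftrightarrow> transformation H \<and> (\<exists>G. transforms_to F H G \<and> poincare_dulac lam G)"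

definition convergent_fvec :: "'n::finite fvec \<Rightarrow> bool" where
  "convergent_fvec H \<longleftrightarrow> (\<forall>i. convergent_mfps (H $ i))"

section \<open>Lower-triangular Jordan matrices\<close>

text \<open>The one-based position of an index, so that \<open>position\<close> maps \<open>'n\<close> onto $\{1,\dots,n\}$.\<close>

definition position :: "'n::{finite, linorder} \<Rightarrow> nat" where
  "position i = card {j. j \<le> i}"

text \<open>The entry \<open>\<sigma>\<close> at the first position does not occur in the matrix.\<close>

definition jordan_matrix ::
  "complex ^ 'n::{finite, linorder} \<Rightarrow> complex ^ 'n::{finite, linorder} \<Rightarrow>
     complex ^ 'n::{finite, linorder} ^ 'n::{finite, linorder}"
  where "jordan_matrix lam \<sigma> = (\<chi> i j.
     if i = j then lam $ i else if position i = position j + 1 then \<sigma> $ i else 0)"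

definition jordan_data ::
  "complex ^ 'n::{finite, linorder} \<Rightarrow> complex ^ 'n::{finite, linorder} \<Rightarrow> bool" where
  "jordan_data lam \<sigma> \<longleftrightarrow>
     (\<forall>i j. position i = position j + 1 \<and> lam $ i \<noteq> lam $ j \<longrightarrow> \<sigma> $ i = 0)"

end

theory Submission
  imports Defs
begin

text \<open>
  Write the field as $\lambda\odot x + Nx + X$ with $N$ the off-diagonal part of $A$, and let
  \<open>S\<close> be the set of the $l$ indices whose eigenvalue has real part zero.  There is a formal
  transformation $y + h$ to a normal form $\lambda\odot y + Ny + g$ in which \<open>h\<close> contains only
  nonresonant terms (\<open>homological_equation\<close>).  The claim is that this particular transformation
  converges.  Convergence of normalizing transformations can fail for two reasons: small divisors
  $\langle\alpha,\lambda\rangle-\lambda_i$, and the term $Dh\,(Ny+g)$, in which differentiation multiplies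
  coefficients by exponents.  The first integrals remove both.

  Pulled back to the normal form, the first integrals contain only monomials with
  $\langle\alpha,\lambda\rangle = 0$ (\<open>first_integral_resonant\<close>).  Taking real parts, such monomials involve only
  the variables in \<open>S\<close>.  So the $l-1$ independent differentials live in an $l$-dimensional
  space and annihilate a single direction there (\<open>central_direction\<close>).  This has two consequences.

  One is that every diagonal field with the same resonances is proportional to $\lambda\odot y$ on \<open>S\<close>.
  Applied to the image of $\lambda$ under a functional that is linear over the rationals, this shows that
  the eigenvalues in \<open>S\<close> are integer multiples of one number
  (\<open>central_eigenvalues_commensurable\<close>).  The real parts control the exponents outside \<open>S\<close>, so there
  are no small divisors: up to a constant, a nonzero divisor dominates $1$, every exponent outside
  \<open>S\<close>, and the partial sum of $\langle\alpha,\lambda\rangle$ over \<open>S\<close> (\<open>divisor_bound\<close>).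

  The other is that the normal form itself is proportional to $\lambda\odot y$ on \<open>S\<close>.  Hence the
  components of $Ny+g$ in \<open>S\<close> act on \<open>h\<close> through $\sum_{j\in S}\lambda_j y_j\partial_j$, which multiplies
  coefficients precisely by that partial sum, and the remaining components by exponents outside
  \<open>S\<close>.  The derivative in $Dh\,(Ny+g)$ is therefore absorbed by the divisor (\<open>pnorm_lie\<close>).

  What is left is an inequality for weighted sums of absolute values of coefficients, in which
  the nilpotent part is made small by the choice of the weights.  For small radii it bounds all
  truncations uniformly (\<open>radial_size_le_1\<close>).
\<close>

text \<open>
  Exponents of degree one are written \<open>axis i 1\<close>; rewriting \<open>1\<close> to \<open>Suc 0\<close> would hide them from
  the rules below.
\<close>

declare One_nat_def [simp del]

section \<open>Exponents and coefficients of products\<close>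

lemma mdeg_add [simp]: "mdeg (\<alpha> + \<beta>) = mdeg \<alpha> + mdeg \<beta>"
  by (simp add: mdeg_def sum.distrib)

lemma mdeg_zero [simp]: "mdeg 0 = 0"
  by (simp add: mdeg_def)

lemma mdeg_eq_0_iff [simp]: "mdeg \<alpha> = 0 \<longleftrightarrow> \<alpha> = 0"
  by (auto simp: mdeg_def vec_eq_iff)

lemma mdeg_axis [simp]: "mdeg (axis i c) = c"
  by (simp add: mdeg_def axis_def)

lemma exponent_split:
  fixes \<gamma> :: "nat ^ 'n::finite"
  assumes "\<gamma> $ i \<noteq> 0"
  obtains \<alpha> where "\<gamma> = \<alpha> + axis i 1"
proof
  show "\<gamma> = (\<gamma> - axis i 1) + axis i 1"
    using assms by (auto simp: vec_eq_iff axis_def)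
qed

lemma coeff_mult_cong:
  assumes "\<And>\<alpha> \<beta>. \<alpha> + \<beta> = \<gamma> \<Longrightarrow>
    mfps_coeff f \<alpha> * mfps_coeff g \<beta> = mfps_coeff f' \<alpha> * mfps_coeff g' \<beta>"
  shows "mfps_coeff (f * g) \<gamma> = mfps_coeff (f' * g') \<gamma>"
  unfolding mfps_coeff_mult by (rule sum.cong) (use assms in \<open>auto simp: splits_def\<close>)

lemma coeff_mult_eq_0:
  assumes "\<And>\<alpha> \<beta>. \<alpha> + \<beta> = \<gamma> \<Longrightarrow> mfps_coeff f \<alpha> * mfps_coeff g \<beta> = 0"
  shows "mfps_coeff (f * g) \<gamma> = 0"
  unfolding mfps_coeff_mult by (rule sum.neutral) (use assms in \<open>auto simp: splits_def\<close>)

lemma coeff_sum [simp]: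
  fixes f :: "'b \<Rightarrow> ('a::comm_ring_1, 'n::finite) mfps"
  shows "mfps_coeff (\<Sum>x\<in>S. f x) \<gamma> = (\<Sum>x\<in>S. mfps_coeff (f x) \<gamma>)"
  by (induction S rule: infinite_finite_induct) auto

lemma coeff_const_mult [simp]:
  fixes f :: "('a::comm_ring_1, 'n::finite) mfps"
  shows "mfps_coeff (mfps_const c * f) \<gamma> = c * mfps_coeff f \<gamma>"
proof -
  have "mfps_coeff (mfps_const c * f) \<gamma> =
      (\<Sum>p\<in>{(0 :: nat ^ 'n, \<gamma>)}. mfps_coeff (mfps_const c) (fst p) * mfps_coeff f (snd p))"
    unfolding mfps_coeff_mult case_prod_unfold
    by (rule sum.mono_neutral_right, simp) (auto simp: splits_def mfps_const_def)
  then show ?thesis by (simp add: mfps_const_def)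
qed

lemma coeff_var: "mfps_coeff (mfps_var i) \<gamma> = (if \<gamma> = axis i 1 then 1 else 0)"
  by (simp add: mfps_var_def)

lemma coeff_var_mult_Suc [simp]:
  fixes f :: "('a::comm_ring_1, 'n::finite) mfps"
  shows "mfps_coeff (mfps_var i * f) (\<gamma> + axis i 1) = mfps_coeff f \<gamma>"
proof -
  have "mfps_coeff (mfps_var i * f) (\<gamma> + axis i 1) =
      (\<Sum>p\<in>{(axis i 1, \<gamma>)}. mfps_coeff (mfps_var i) (fst p) * mfps_coeff f (snd p))"
    unfolding mfps_coeff_mult case_prod_unfold
    by (rule sum.mono_neutral_right, simp) (auto simp: splits_def coeff_var add.commute)
  then show ?thesis by (simp add: coeff_var)
qed

lemma coeff_var_mult_0:
  fixes f :: "('a::comm_ring_1, 'n::finite) mfps"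
  assumes "\<gamma> $ i = 0"
  shows "mfps_coeff (mfps_var i * f) \<gamma> = 0"
  by (rule coeff_mult_eq_0) (use assms in \<open>auto simp: coeff_var axis_def\<close>)

lemma var_neq_0 [simp]: "(mfps_var i :: ('a::comm_ring_1, 'n::finite) mfps) \<noteq> 0"
proof
  assume "(mfps_var i :: ('a, 'n) mfps) = 0"
  then have "mfps_coeff (mfps_var i :: ('a, 'n) mfps) (axis i 1) = 0" by simp
  then show False by (simp add: coeff_var)
qed

section \<open>Order of vanishing\<close>

lemma order_0 [simp]: "order_at_least 0 f"
  by (simp add: order_at_least_def)

lemma order_zero [simp]: "order_at_least k 0"
  by (simp add: order_at_least_def)

lemma order_mono: "order_at_least k f \<Longrightarrow> j \<le> k \<Longrightarrow> order_at_least j f"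
  by (auto simp: order_at_least_def)

lemma order_add: "order_at_least k f \<Longrightarrow> order_at_least k g \<Longrightarrow> order_at_least k (f + g)"
  for f g :: "('a::comm_ring_1, 'n::finite) mfps"
  by (auto simp: order_at_least_def)

lemma order_diff: "order_at_least k f \<Longrightarrow> order_at_least k g \<Longrightarrow> order_at_least k (f - g)"
  for f g :: "('a::comm_ring_1, 'n::finite) mfps"
  by (auto simp: order_at_least_def)

lemma order_sum:
  fixes f :: "'b \<Rightarrow> ('a::comm_ring_1, 'n::finite) mfps"
  shows "(\<And>x. x \<in> S \<Longrightarrow> order_at_least k (f x)) \<Longrightarrow> order_at_least k (\<Sum>x\<in>S. f x)"
  by (auto simp: order_at_least_def)

lemma order_mult:
  fixes f g :: "('a::comm_ring_1, 'n::finite) mfps"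
  assumes "order_at_least a f" "order_at_least b g"
  shows "order_at_least (a + b) (f * g)"
  unfolding order_at_least_def
proof (intro allI impI coeff_mult_eq_0)
  fix \<gamma> \<alpha> \<beta> :: "nat ^ 'n"
  assume "mdeg \<gamma> < a + b" "\<alpha> + \<beta> = \<gamma>"
  then have "mdeg \<alpha> < a \<or> mdeg \<beta> < b" by auto
  then show "mfps_coeff f \<alpha> * mfps_coeff g \<beta> = 0"
    using assms by (auto simp: order_at_least_def)
qed

lemma order_const_mult: "order_at_least k f \<Longrightarrow> order_at_least k (mfps_const c * f)"
  for f :: "('a::comm_ring_1, 'n::finite) mfps"
  by (auto simp: order_at_least_def)

lemma order_var: "order_at_least 1 (mfps_var i :: ('a::comm_ring_1, 'n::finite) mfps)"
  by (auto simp: order_at_least_def coeff_var)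

lemma order_deriv:
  "order_at_least (Suc k) f \<Longrightarrow> order_at_least k (mfps_deriv i f)"
  by (auto simp: order_at_least_def mfps_deriv_def)

lemma order_all_imp_0: "(\<And>k. order_at_least k f) \<Longrightarrow> f = 0"
  by (auto simp: order_at_least_def mfps_eq_iff intro: lessI)

text \<open>
  Closeness of factors is amplified by the order to which the other factors vanish.  Through
  \<open>order_diff_vpow\<close> this yields both the triangularity of the formal recursion and the
  injectivity of substitution.
\<close>

lemma order_diff_mult:
  fixes f f' g g' :: "('a::comm_ring_1, 'n::finite) mfps"
  assumes "order_at_least a f" "order_at_least a f'" "order_at_least b g" "order_at_least b g'"
    and "order_at_least (a + k) (f - f')" "order_at_least (b + k) (g - g')"
  shows "order_at_least (a + b + k) (f * g - f' * g')"
proof -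
  have "f * g - f' * g' = (f - f') * g + f' * (g - g')" by (simp add: algebra_simps)
  moreover have "order_at_least (a + b + k) ((f - f') * g)"
    using order_mult [OF assms(5,3)] by (simp add: ac_simps)
  moreover have "order_at_least (a + b + k) (f' * (g - g'))"
    using order_mult [OF assms(2,6)] by (simp add: ac_simps)
  ultimately show ?thesis by (simp add: order_add)
qed

definition vpow :: "('a::comm_ring_1, 'm::finite) mfps ^ 'n::finite \<Rightarrow> nat ^ 'n \<Rightarrow> ('a, 'm) mfps" where
  "vpow H \<alpha> = (\<Prod>i\<in>UNIV. (H $ i) ^ (\<alpha> $ i))"

lemma vpow_0 [simp]: "vpow H 0 = 1"
  by (simp add: vpow_def)

lemma vpow_add: "vpow H (\<alpha> + \<beta>) = vpow H \<alpha> * vpow H \<beta>"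
  by (simp add: vpow_def power_add prod.distrib)

lemma vpow_axis [simp]: "vpow H (axis i 1) = H $ i"
proof -
  have "vpow H (axis i 1) = (\<Prod>j\<in>UNIV. if j = i then H $ i else 1)"
    unfolding vpow_def by (rule prod.cong) (auto simp: axis_def)
  then show ?thesis by simp
qed

lemma exponent_induct [case_names zero step]:
  fixes \<alpha> :: "nat ^ 'n::finite"
  assumes "P 0" "\<And>\<alpha> i. P \<alpha> \<Longrightarrow> P (\<alpha> + axis i 1)"
  shows "P \<alpha>"
proof (induction "mdeg \<alpha>" arbitrary: \<alpha>)
  case 0
  then show ?case using assms(1) by simp
next
  case (Suc k)
  from Suc.hyps(2) have "\<alpha> \<noteq> 0" by auto
  then obtain i where "\<alpha> $ i \<noteq> 0" by (auto simp: vec_eq_iff)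
  then obtain \<beta> where b: "\<alpha> = \<beta> + axis i 1" by (rule exponent_split)
  with Suc.hyps(2) have "k = mdeg \<beta>" by simp
  from Suc.hyps(1) [OF this] b show ?case using assms(2) by simp
qed

lemma order_vpow:
  assumes "\<And>i. order_at_least 1 (H $ i)"
  shows "order_at_least (mdeg \<alpha>) (vpow H \<alpha>)"
proof (induction \<alpha> rule: exponent_induct)
  case (step \<alpha> i)
  then show ?case using order_mult [OF step assms] by (simp add: vpow_add)
qed simp

lemma order_diff_vpow:
  assumes "\<And>i. order_at_least 1 (H $ i)" "\<And>i. order_at_least 1 (H' $ i)"
    and "\<And>i. order_at_least (1 + k) (H $ i - H' $ i)"
  shows "order_at_least (mdeg \<alpha> + k) (vpow H \<alpha> - vpow H' \<alpha>)"
proof (induction \<alpha> rule: exponent_induct)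
  case (step \<alpha> i)
  have "order_at_least (mdeg \<alpha> + 1 + k) (vpow H \<alpha> * H $ i - vpow H' \<alpha> * H' $ i)"
    by (rule order_diff_mult) (auto simp: order_vpow assms step)
  then show ?case by (simp add: vpow_add)
qed simp

section \<open>Substitution\<close>

lemma coeff_vpow_high:
  assumes "\<And>i. order_at_least 1 (H $ i)" "mdeg \<gamma> < mdeg \<alpha>"
  shows "mfps_coeff (vpow H \<alpha>) \<gamma> = 0"
  using order_vpow [of H \<alpha>] assms by (auto simp: order_at_least_def)

text \<open>
  The degree at which the sum is cut off may be chosen freely above the degree of the coefficient,
  so that coefficients of several degrees can share one cut-off.
\<close>

lemma coeff_compose:
  assumes "\<And>i. order_at_least 1 (H $ i)" "mdeg \<gamma> \<le> N"
  shows "mfps_coeff (mfps_compose f H) \<gamma> =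
    (\<Sum>\<alpha> | mdeg \<alpha> \<le> N. mfps_coeff f \<alpha> * mfps_coeff (vpow H \<alpha>) \<gamma>)"
  unfolding mfps_compose_def mfps_coeff_Abs vpow_def [symmetric]
  by (rule sum.mono_neutral_left) (use assms(2) in \<open>auto simp: coeff_vpow_high assms(1)\<close>)

lemma compose_add: "mfps_compose (f + g) H = mfps_compose f H + mfps_compose g H"
  by (rule mfps_eqI) (simp add: mfps_compose_def distrib_right sum.distrib)

lemma compose_0 [simp]: "mfps_compose 0 H = 0"
  by (rule mfps_eqI) (simp add: mfps_compose_def)

lemma compose_sum: "mfps_compose (\<Sum>x\<in>S. f x) H = (\<Sum>x\<in>S. mfps_compose (f x) H)"
  by (induction S rule: infinite_finite_induct) (auto simp: compose_add)

lemma compose_const_mult: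
  "mfps_compose (mfps_const c * f) H = mfps_const c * mfps_compose f H"
  by (rule mfps_eqI) (simp add: mfps_compose_def sum_distrib_left mult.assoc)

text \<open>
  Expanding both sides in the products $H^{\alpha+\beta}$, they differ by terms with
  $|\alpha+\beta|$ above the degree considered, where $H^{\alpha+\beta}$ has no coefficients.
\<close>

lemma compose_mult:
  fixes f g :: "('a::comm_ring_1, 'n::finite) mfps" and H :: "('a, 'm::finite) mfps ^ 'n"
  assumes H: "\<And>i. order_at_least 1 (H $ i)"
  shows "mfps_compose (f * g) H = mfps_compose f H * mfps_compose g H"
proof (rule mfps_eqI)
  fix \<gamma> :: "nat ^ 'm"
  let ?N = "mdeg \<gamma>"
  let ?D = "{\<alpha> :: nat ^ 'n. mdeg \<alpha> \<le> ?N}"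
  let ?c = "\<lambda>\<alpha> \<beta>. mfps_coeff f \<alpha> * mfps_coeff g \<beta> * mfps_coeff (vpow H (\<alpha> + \<beta>)) \<gamma>"
  have "mfps_coeff (mfps_compose f H * mfps_compose g H) \<gamma> =
      (\<Sum>p\<in>splits \<gamma>. \<Sum>\<alpha>\<in>?D. \<Sum>\<beta>\<in>?D. mfps_coeff f \<alpha> * mfps_coeff g \<beta> *
         (mfps_coeff (vpow H \<alpha>) (fst p) * mfps_coeff (vpow H \<beta>) (snd p)))"
    unfolding mfps_coeff_mult case_prod_unfold
  proof (rule sum.cong [OF refl], goal_cases)
    case (1 p)
    then have "fst p + snd p = \<gamma>" by (auto simp: splits_def)
    then have "mdeg (fst p) \<le> ?N" "mdeg (snd p) \<le> ?N" by (metis le_add1 le_add2 mdeg_add)+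
    then show ?case
      by (simp add: coeff_compose [OF H, where N = ?N] sum_product ac_simps)
  qed
  also have "\<dots> = (\<Sum>\<alpha>\<in>?D. \<Sum>\<beta>\<in>?D. \<Sum>p\<in>splits \<gamma>. mfps_coeff f \<alpha> * mfps_coeff g \<beta> *
         (mfps_coeff (vpow H \<alpha>) (fst p) * mfps_coeff (vpow H \<beta>) (snd p)))"
    by (subst sum.swap, intro sum.cong refl, subst sum.swap, rule refl)
  also have "\<dots> = (\<Sum>\<alpha>\<in>?D. \<Sum>\<beta>\<in>?D. ?c \<alpha> \<beta>)"
    by (simp add: vpow_add mfps_coeff_mult case_prod_unfold sum_distrib_left)
  also have "\<dots> = (\<Sum>p\<in>?D \<times> ?D. ?c (fst p) (snd p))"
    by (simp add: sum.cartesian_product case_prod_unfold)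
  also have "\<dots> = (\<Sum>p\<in>(\<Union>\<delta>\<in>?D. splits \<delta>). ?c (fst p) (snd p))"
  proof (rule sum.mono_neutral_right)
    show "(\<Union>\<delta>\<in>?D. splits \<delta>) \<subseteq> ?D \<times> ?D" by (auto simp: splits_def)
    show "\<forall>p\<in>?D \<times> ?D - (\<Union>\<delta>\<in>?D. splits \<delta>). ?c (fst p) (snd p) = 0"
    proof
      fix p assume "p \<in> ?D \<times> ?D - (\<Union>\<delta>\<in>?D. splits \<delta>)"
      then have "\<not> (\<exists>\<delta>. mdeg \<delta> \<le> ?N \<and> fst p + snd p = \<delta>)"
        by (fastforce simp: splits_def)
      then have "\<not> mdeg (fst p + snd p) \<le> ?N" by blast
      then show "?c (fst p) (snd p) = 0" by (simp add: coeff_vpow_high [OF H])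
    qed
  qed auto
  also have "\<dots> = (\<Sum>\<delta>\<in>?D. \<Sum>p\<in>splits \<delta>. ?c (fst p) (snd p))"
    by (rule sum.UNION_disjoint) (simp_all, auto simp: splits_def)
  also have "\<dots> = (\<Sum>\<delta>\<in>?D. mfps_coeff (f * g) \<delta> * mfps_coeff (vpow H \<delta>) \<gamma>)"
    unfolding mfps_coeff_mult case_prod_unfold sum_distrib_right
    by (intro sum.cong refl) (auto simp: splits_def)
  also have "\<dots> = mfps_coeff (mfps_compose (f * g) H) \<gamma>"
    by (simp add: coeff_compose [OF H, where N = ?N])
  finally show "mfps_coeff (mfps_compose (f * g) H) \<gamma> =
    mfps_coeff (mfps_compose f H * mfps_compose g H) \<gamma>" ..
qed

lemma compose_var:
  fixes H :: "('a::comm_ring_1, 'm::finite) mfps ^ 'n::finite"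
  assumes H: "\<And>i. order_at_least 1 (H $ i)"
  shows "mfps_compose (mfps_var j) H = H $ j"
proof (rule mfps_eqI)
  fix \<gamma> :: "nat ^ 'm"
  have "mfps_coeff (mfps_compose (mfps_var j) H) \<gamma> =
    (\<Sum>\<alpha>\<in>{axis j 1 :: nat ^ 'n}. mfps_coeff (mfps_var j) \<alpha> * mfps_coeff (vpow H \<alpha>) \<gamma>)"
    unfolding coeff_compose [OF H le_add1 [of "mdeg \<gamma>" 1]]
    by (rule sum.mono_neutral_right) (auto simp: coeff_var)
  then show "mfps_coeff (mfps_compose (mfps_var j) H) \<gamma> = mfps_coeff (H $ j) \<gamma>"
    by (simp add: coeff_var)
qed

lemma order_compose:
  fixes H :: "('a::comm_ring_1, 'm::finite) mfps ^ 'n::finite"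
  assumes H: "\<And>i. order_at_least 1 (H $ i)" and f: "order_at_least k f"
  shows "order_at_least k (mfps_compose f H)"
  unfolding order_at_least_def
proof (intro allI impI)
  fix \<gamma> :: "nat ^ 'm" assume "mdeg \<gamma> < k"
  then have "mfps_coeff f \<alpha> * mfps_coeff (vpow H \<alpha>) \<gamma> = 0" for \<alpha> :: "nat ^ 'n"
    using f coeff_vpow_high [OF H, of \<gamma> \<alpha>] by (cases "mdeg \<alpha> < k") (auto simp: order_at_least_def)
  then show "mfps_coeff (mfps_compose f H) \<gamma> = 0"
    by (simp add: coeff_compose [OF H order.refl])
qed

text \<open>
  Without linear terms in the outer series every product has another factor of order one, so a
  coefficient only depends on inner coefficients of strictly smaller degree.
\<close>

lemma coeff_compose_cong:
  fixes H H' :: "('a::comm_ring_1, 'm::finite) mfps ^ 'n::finite"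
  assumes H: "\<And>i. order_at_least 1 (H $ i)" and H': "\<And>i. order_at_least 1 (H' $ i)"
    and f: "order_at_least 2 f" and HH: "\<And>i. order_at_least (mdeg \<gamma>) (H $ i - H' $ i)"
  shows "mfps_coeff (mfps_compose f H) \<gamma> = mfps_coeff (mfps_compose f H') \<gamma>"
  unfolding coeff_compose [OF H order.refl] coeff_compose [OF H' order.refl]
proof (rule sum.cong [OF refl])
  fix \<alpha> :: "nat ^ 'n"
  show "mfps_coeff f \<alpha> * mfps_coeff (vpow H \<alpha>) \<gamma> = mfps_coeff f \<alpha> * mfps_coeff (vpow H' \<alpha>) \<gamma>"
  proof (cases "mdeg \<gamma> = 0 \<or> mdeg \<alpha> < 2")
    case True
    then show ?thesis
      using f coeff_vpow_high [OF H, of \<gamma> \<alpha>] coeff_vpow_high [OF H', of \<gamma> \<alpha>]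
      by (cases "mdeg \<alpha> < 2") (auto simp: order_at_least_def)
  next
    case False
    have "order_at_least (mdeg \<alpha> + (mdeg \<gamma> - 1)) (vpow H \<alpha> - vpow H' \<alpha>)"
    proof (rule order_diff_vpow [OF H H'])
      have "1 + (mdeg \<gamma> - 1) = mdeg \<gamma>" using False by (auto simp flip: mdeg_eq_0_iff)
      then show "order_at_least (1 + (mdeg \<gamma> - 1)) (H $ i - H' $ i)" for i using HH by simp
    qed
    with False show ?thesis by (auto simp: order_at_least_def)
  qed
qed

definition vars :: "('a::comm_ring_1, 'n::finite) mfps ^ 'n" where
  "vars = (\<chi> i. mfps_var i)"

lemma vars_nth [simp]: "vars $ i = mfps_var i"
  by (simp add: vars_def)

lemma coeff_vpow_vars:
  fixes \<alpha> \<gamma> :: "nat ^ 'n::finite"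
  shows "mfps_coeff (vpow vars \<alpha> :: ('a::comm_ring_1, 'n) mfps) \<gamma> = (if \<gamma> = \<alpha> then 1 else 0)"
proof (induction \<alpha> arbitrary: \<gamma> rule: exponent_induct)
  case zero
  show ?case by (simp add: mfps_coeff_1)
next
  case (step \<alpha> i)
  show ?case
  proof (cases "\<gamma> $ i = 0")
    case True
    moreover from True have "\<gamma> \<noteq> \<alpha> + axis i 1" by (auto simp: axis_def)
    ultimately show ?thesis by (simp add: vpow_add mult.commute [of _ "mfps_var i"] coeff_var_mult_0)
  next
    case False
    then obtain \<beta> where "\<gamma> = \<beta> + axis i 1" by (rule exponent_split)
    then show ?thesis using step by (simp add: vpow_add mult.commute [of _ "mfps_var i"])
  qed
qed

lemma compose_vpow_vars:
  fixes H :: "('a::comm_ring_1, 'm::finite) mfps ^ 'n::finite"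
  assumes H: "\<And>i. order_at_least 1 (H $ i)"
  shows "mfps_compose (vpow vars \<alpha>) H = vpow H \<alpha>"
proof (rule mfps_eqI)
  fix \<gamma> :: "nat ^ 'm"
  have "mfps_coeff (mfps_compose (vpow vars \<alpha>) H) \<gamma> =
      (\<Sum>\<beta>\<in>{\<alpha>}. mfps_coeff (vpow vars \<alpha>) \<beta> * mfps_coeff (vpow H \<beta>) \<gamma>)"
    unfolding coeff_compose [OF H le_add1 [of "mdeg \<gamma>" "mdeg \<alpha>"]]
    by (rule sum.mono_neutral_right) (auto simp: coeff_vpow_vars)
  then show "mfps_coeff (mfps_compose (vpow vars \<alpha>) H) \<gamma> = mfps_coeff (vpow H \<alpha>) \<gamma>"
    by (simp add: coeff_vpow_vars)
qed

lemma order_near_vars: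
  fixes H :: "('a::comm_ring_1, 'n::finite) mfps ^ 'n"
  assumes "\<And>i. order_at_least 2 (H $ i - mfps_var i)"
  shows "order_at_least 1 (H $ i)"
proof -
  have "order_at_least 1 (H $ i - mfps_var i)" by (rule order_mono [OF assms]) simp
  from order_add [OF this order_var [of i]] show ?thesis by simp
qed

text \<open>A substitution tangent to the identity preserves the homogeneous part of lowest degree.\<close>

lemma compose_injective:
  fixes f :: "('a::comm_ring_1, 'n::finite) mfps"
  assumes H: "\<And>i. order_at_least 2 (H $ i - mfps_var i)" and "f \<noteq> 0"
  shows "mfps_compose f H \<noteq> 0"
proof
  assume z: "mfps_compose f H = 0"
  have H1: "order_at_least 1 (H $ i)" for i by (rule order_near_vars [OF H])
  have "\<exists>\<alpha>. mfps_coeff f \<alpha> \<noteq> 0" using \<open>f \<noteq> 0\<close> by (auto simp: mfps_eq_iff)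
  then obtain \<alpha> where a: "mfps_coeff f \<alpha> \<noteq> 0" "\<And>\<beta>. mfps_coeff f \<beta> \<noteq> 0 \<Longrightarrow> mdeg \<alpha> \<le> mdeg \<beta>"
    using arg_min_nat_lemma [of "\<lambda>\<alpha>. mfps_coeff f \<alpha> \<noteq> 0" _ mdeg] by metis
  have "mfps_coeff (mfps_compose f H) \<alpha> = (\<Sum>\<beta>\<in>{\<alpha>}. mfps_coeff f \<beta> * mfps_coeff (vpow H \<beta>) \<alpha>)"
    unfolding coeff_compose [OF H1 order.refl]
  proof (rule sum.mono_neutral_right)
    show "\<forall>\<beta>\<in>{\<beta>. mdeg \<beta> \<le> mdeg \<alpha>} - {\<alpha>}. mfps_coeff f \<beta> * mfps_coeff (vpow H \<beta>) \<alpha> = 0"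
    proof
      fix \<beta> assume b: "\<beta> \<in> {\<beta>. mdeg \<beta> \<le> mdeg \<alpha>} - {\<alpha>}"
      show "mfps_coeff f \<beta> * mfps_coeff (vpow H \<beta>) \<alpha> = 0"
      proof (cases "mfps_coeff f \<beta> = 0")
        case False
        with a b have "mdeg \<beta> = mdeg \<alpha>" by (auto intro: antisym)
        moreover have "order_at_least (mdeg \<beta> + 1) (vpow H \<beta> - vpow vars \<beta>)"
          by (rule order_diff_vpow) (use H1 H in \<open>simp_all add: order_var\<close>)
        ultimately have "mfps_coeff (vpow H \<beta>) \<alpha> = mfps_coeff (vpow vars \<beta>) \<alpha>"
          by (auto simp: order_at_least_def)
        with b show ?thesis by (auto simp: coeff_vpow_vars)
      qed simp
    qed
  qed auto
  moreover have "mfps_coeff (vpow H \<alpha>) \<alpha> = 1"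
  proof -
    have "order_at_least (mdeg \<alpha> + 1) (vpow H \<alpha> - vpow vars \<alpha>)"
      by (rule order_diff_vpow) (use H1 H in \<open>simp_all add: order_var\<close>)
    then show ?thesis by (auto simp: order_at_least_def coeff_vpow_vars)
  qed
  ultimately show False using z a by simp
qed

section \<open>Derivatives and the chain rule\<close>

lemma coeff_deriv:
  "mfps_coeff (mfps_deriv i f) \<gamma> = of_nat (\<gamma> $ i + 1) * mfps_coeff f (\<gamma> + axis i 1)"
  by (simp add: mfps_deriv_def)

lemma deriv_add: "mfps_deriv i (f + g) = mfps_deriv i f + mfps_deriv i g"
  for f :: "('a::comm_ring_1, 'n::finite) mfps"
  by (rule mfps_eqI) (simp add: coeff_deriv algebra_simps)

lemma deriv_var: "mfps_deriv j (mfps_var i :: ('a::comm_ring_1, 'n::finite) mfps) = (if i = j then 1 else 0)"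
proof (rule mfps_eqI)
  fix \<gamma> :: "nat ^ 'n"
  have "\<gamma> + axis j 1 = axis i 1 \<longleftrightarrow> i = j \<and> \<gamma> = 0"
  proof
    assume h: "\<gamma> + axis j 1 = axis i 1"
    then have "(\<gamma> + axis j 1) $ j = axis i 1 $ j" by simp
    then have "i = j" by (auto simp: axis_def split: if_splits)
    with h show "i = j \<and> \<gamma> = 0" by simp
  qed auto
  then show "mfps_coeff (mfps_deriv j (mfps_var i :: ('a, 'n) mfps)) \<gamma> = mfps_coeff (if i = j then 1 else 0) \<gamma>"
    by (auto simp: coeff_deriv coeff_var mfps_coeff_1)
qed

definition euler :: "'n \<Rightarrow> ('a::comm_ring_1, 'n::finite) mfps \<Rightarrow> ('a, 'n) mfps" where
  "euler i f = Abs_mfps (\<lambda>\<alpha>. of_nat (\<alpha> $ i) * mfps_coeff f \<alpha>)"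

lemma coeff_euler: "mfps_coeff (euler i f) \<alpha> = of_nat (\<alpha> $ i) * mfps_coeff f \<alpha>"
  by (simp add: euler_def)

lemma euler_eq: "euler i f = mfps_var i * mfps_deriv i f"
proof (rule mfps_eqI)
  fix \<gamma> :: "nat ^ 'b"
  show "mfps_coeff (euler i f) \<gamma> = mfps_coeff (mfps_var i * mfps_deriv i f) \<gamma>"
  proof (cases "\<gamma> $ i = 0")
    case True
    then show ?thesis by (simp add: coeff_var_mult_0 coeff_euler)
  next
    case False
    then obtain \<beta> where "\<gamma> = \<beta> + axis i 1" by (rule exponent_split)
    then show ?thesis by (simp add: coeff_euler coeff_deriv)
  qed
qed

lemma euler_mult: "euler i (f * g) = euler i f * g + f * euler i g"
proof (rule mfps_eqI)
  fix \<gamma> :: "nat ^ 'b"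
  show "mfps_coeff (euler i (f * g)) \<gamma> = mfps_coeff (euler i f * g + f * euler i g) \<gamma>"
    unfolding coeff_euler mfps_coeff_add mfps_coeff_mult case_prod_unfold
      sum_distrib_left sum.distrib [symmetric]
    by (rule sum.cong) (auto simp: splits_def algebra_simps)
qed

text \<open>
  The Euler operator multiplies coefficients by exponents, so its product rule is evident;
  cancelling the variable gives the product rule for the partial derivative.
\<close>

lemma deriv_mult:
  fixes f g :: "('a::idom, 'n::finite) mfps"
  shows "mfps_deriv i (f * g) = mfps_deriv i f * g + f * mfps_deriv i g"
proof -
  have "mfps_var i * mfps_deriv i (f * g) = mfps_var i * (mfps_deriv i f * g + f * mfps_deriv i g)"
    using euler_mult [of i f g] by (simp add: euler_eq algebra_simps)
  then show ?thesis by simp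
qed

lemma deriv_0 [simp]: "mfps_deriv i 0 = 0"
  by (rule mfps_eqI) (simp add: coeff_deriv)

lemma deriv_1 [simp]: "mfps_deriv i (1 :: ('a::idom, 'n::finite) mfps) = 0"
  by (rule mfps_eqI) (simp add: coeff_deriv mfps_coeff_1 flip: mdeg_eq_0_iff)

lemma deriv_sum: "mfps_deriv i (\<Sum>x\<in>S. f x) = (\<Sum>x\<in>S. mfps_deriv i (f x))"
  for f :: "'b \<Rightarrow> ('a::comm_ring_1, 'n::finite) mfps"
  by (induction S rule: infinite_finite_induct) (auto simp: deriv_add)

lemma deriv_const_mult: "mfps_deriv i (mfps_const c * f) = mfps_const c * mfps_deriv i f"
  for f :: "('a::comm_ring_1, 'n::finite) mfps"
  by (rule mfps_eqI) (simp add: coeff_deriv mult.left_commute)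

lemma chain_rule_vpow:
  fixes H :: "('a::idom, 'm::finite) mfps ^ 'n::finite"
  assumes H: "\<And>i. order_at_least 1 (H $ i)"
  shows "mfps_deriv j (vpow H \<alpha>) =
    (\<Sum>i\<in>UNIV. mfps_compose (mfps_deriv i (vpow vars \<alpha>)) H * mfps_deriv j (H $ i))"
  (is "_ = ?R \<alpha>")
proof (induction \<alpha> rule: exponent_induct)
  case zero
  show ?case by simp
next
  case (step \<alpha> k)
  have one: "mfps_compose 1 H = 1" using compose_vpow_vars [OF H, of 0] by simp
  have "?R (\<alpha> + axis k 1) = (\<Sum>i\<in>UNIV. mfps_compose (mfps_deriv i (vpow vars \<alpha>)) H * mfps_deriv j (H $ i) * H $ k
     + (if i = k then vpow H \<alpha> * mfps_deriv j (H $ i) else 0))"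
    by (rule sum.cong)
      (auto simp: vpow_add deriv_mult deriv_var compose_add compose_mult [OF H] compose_var [OF H]
        compose_vpow_vars [OF H] one algebra_simps)
  also have "\<dots> = ?R \<alpha> * H $ k + vpow H \<alpha> * mfps_deriv j (H $ k)"
    by (simp add: sum.distrib sum_distrib_right)
  also have "\<dots> = mfps_deriv j (vpow H (\<alpha> + axis k 1))"
    by (simp add: vpow_add deriv_mult step)
  finally show ?case ..
qed

text \<open>
  Both sides of the chain rule have coefficients that depend on finitely many coefficients of
  the outer series, so it suffices to treat polynomials, and by linearity monomials.
\<close>

lemma chain_rule:
  fixes f :: "('a::idom, 'n::finite) mfps" and H :: "('a, 'm::finite) mfps ^ 'n"
  assumes H: "\<And>i. order_at_least 1 (H $ i)"
  shows "mfps_deriv j (mfps_compose f H) =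
    (\<Sum>i\<in>UNIV. mfps_compose (mfps_deriv i f) H * mfps_deriv j (H $ i))"
proof (rule mfps_eqI)
  fix \<gamma> :: "nat ^ 'm"
  define N where "N = mdeg \<gamma> + 1"
  define g where "g = (\<Sum>\<alpha> | mdeg \<alpha> \<le> N. mfps_const (mfps_coeff f \<alpha>) * (vpow vars \<alpha> :: ('a, 'n) mfps))"
  have g: "mfps_coeff g \<alpha> = mfps_coeff f \<alpha>" if "mdeg \<alpha> \<le> N" for \<alpha>
    using that by (simp add: g_def coeff_vpow_vars if_distrib sum.delta' cong: if_cong)
  have cmp: "mfps_coeff (mfps_compose g H) \<beta> = mfps_coeff (mfps_compose f H) \<beta>" if "mdeg \<beta> \<le> N" for \<beta>
    unfolding coeff_compose [OF H that] by (rule sum.cong) (auto simp: g)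
  have cmp': "mfps_coeff (mfps_compose (mfps_deriv i g) H) \<beta> = mfps_coeff (mfps_compose (mfps_deriv i f) H) \<beta>"
    if "mdeg \<beta> \<le> mdeg \<gamma>" for \<beta> i
    unfolding coeff_compose [OF H that] by (rule sum.cong) (auto simp: g coeff_deriv N_def)
  have poly: "mfps_deriv j (mfps_compose g H) =
    (\<Sum>i\<in>UNIV. mfps_compose (mfps_deriv i g) H * mfps_deriv j (H $ i))"
    unfolding g_def compose_sum compose_const_mult compose_vpow_vars [OF H] deriv_sum deriv_const_mult
      chain_rule_vpow [OF H] sum_distrib_left sum_distrib_right
    by (subst sum.swap) (simp add: mult.assoc)
  have "mfps_coeff (mfps_deriv j (mfps_compose f H)) \<gamma> = mfps_coeff (mfps_deriv j (mfps_compose g H)) \<gamma>"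
    by (simp add: coeff_deriv cmp N_def)
  also have "\<dots> = (\<Sum>i\<in>UNIV. mfps_coeff (mfps_compose (mfps_deriv i g) H * mfps_deriv j (H $ i)) \<gamma>)"
    by (simp add: poly)
  also have "\<dots> = (\<Sum>i\<in>UNIV. mfps_coeff (mfps_compose (mfps_deriv i f) H * mfps_deriv j (H $ i)) \<gamma>)"
    by (intro sum.cong refl coeff_mult_cong) (auto simp: cmp')
  finally show "mfps_coeff (mfps_deriv j (mfps_compose f H)) \<gamma> =
    mfps_coeff (\<Sum>i\<in>UNIV. mfps_compose (mfps_deriv i f) H * mfps_deriv j (H $ i)) \<gamma>" by simp
qed

section \<open>Existence of a formal normalization\<close>

definition weight :: "complex ^ 'n \<Rightarrow> nat ^ 'n::finite \<Rightarrow> complex" where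
  "weight lam \<alpha> = (\<Sum>i\<in>UNIV. of_nat (\<alpha> $ i) * lam $ i)"

lemma weight_add: "weight lam (\<alpha> + \<beta>) = weight lam \<alpha> + weight lam \<beta>"
  by (simp add: weight_def algebra_simps sum.distrib)

lemma weight_axis [simp]: "weight lam (axis i 1) = lam $ i"
proof -
  have "weight lam (axis i 1) = (\<Sum>j\<in>UNIV. if j = i then lam $ i else 0)"
    unfolding weight_def by (rule sum.cong) (auto simp: axis_def)
  then show ?thesis by simp
qed

text \<open>The derivative $Df\,G$ along a vector field, which vanishes for first integrals.\<close>

definition lie :: "('a::comm_ring_1, 'n::finite) mfps ^ 'n \<Rightarrow> ('a, 'n) mfps \<Rightarrow> ('a, 'n) mfps" where
  "lie G f = (\<Sum>j\<in>UNIV. mfps_deriv j f * G $ j)"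

lemma lie_add_field: "lie (F + G) f = lie F f + lie G f"
  by (simp add: lie_def algebra_simps sum.distrib)

lemma lie_add: "lie G (f + g) = lie G f + lie G g"
  by (simp add: lie_def deriv_add algebra_simps sum.distrib)

lemma lie_var: "lie G (mfps_var i) = G $ i"
proof -
  have "lie G (mfps_var i) = (\<Sum>j\<in>UNIV. if i = j then G $ j else 0)"
    unfolding lie_def by (rule sum.cong) (auto simp: deriv_var)
  then show ?thesis by simp
qed

lemma order_lie:
  assumes "\<And>j. order_at_least a (G $ j)" "order_at_least (Suc b) f"
  shows "order_at_least (b + a) (lie G f)"
  unfolding lie_def by (intro order_sum order_mult order_deriv assms)

definition diagonal_field :: "complex ^ 'n \<Rightarrow> 'n::finite fvec" where
  "diagonal_field lam = (\<chi> i. mfps_const (lam $ i) * mfps_var i)"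

lemma coeff_lie_diagonal: "mfps_coeff (lie (diagonal_field lam) f) \<alpha> = weight lam \<alpha> * mfps_coeff f \<alpha>"
proof -
  have "lie (diagonal_field lam) f = (\<Sum>j\<in>UNIV. mfps_const (lam $ j) * euler j f)"
    by (simp add: lie_def diagonal_field_def euler_eq ac_simps)
  then show ?thesis
    by (simp only: coeff_sum coeff_const_mult coeff_euler weight_def sum_distrib_right)
      (simp add: ac_simps)
qed

lemma coeff_lie_linear:
  "mfps_coeff (lie (linear_field N) f) \<alpha> =
    (\<Sum>j\<in>UNIV. \<Sum>k\<in>UNIV. N $ j $ k * mfps_coeff (mfps_var k * mfps_deriv j f) \<alpha>)"
proof -
  have "lie (linear_field N) f =
      (\<Sum>j\<in>UNIV. \<Sum>k\<in>UNIV. mfps_const (N $ j $ k) * (mfps_var k * mfps_deriv j f))"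
    by (simp add: lie_def linear_field_def sum_distrib_left ac_simps)
  then show ?thesis by simp
qed

lemma order_linear_field: "order_at_least 1 (linear_field N $ i)"
  by (auto simp: linear_field_def intro!: order_sum order_const_mult order_var)

lemma linear_field_add: "linear_field (A + B) = linear_field A + linear_field B"
  by (simp add: vec_eq_iff linear_field_def mfps_eq_iff distrib_right sum.distrib)

text \<open>
  The equations for the coefficients of \<open>h\<close> and \<open>g\<close> are triangular with respect to the
  following order: lower degree comes first, and within one degree the off-diagonal entries
  of the linear part only refer to coefficients for which the second number is smaller.
\<close>

definition depends :: "('n \<Rightarrow> nat) \<Rightarrow> (('n::finite \<times> (nat ^ 'n)) \<times> ('n \<times> (nat ^ 'n))) set" where
  "depends p = inv_image (less_than <*lex*> less_than)
     (\<lambda>(i, \<alpha>). (mdeg \<alpha>, (\<Sum>j\<in>UNIV. (sum p UNIV - p j) * \<alpha> $ j) + p i))"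

lemma wf_depends: "wf (depends p)"
  by (auto simp: depends_def)

lemma depends_lower: "mdeg \<beta> < mdeg \<alpha> \<Longrightarrow> ((j, \<beta>), (i, \<alpha>)) \<in> depends p"
  by (simp add: depends_def)

lemma depends_component: "p j < p i \<Longrightarrow> ((j, \<alpha>), (i, \<alpha>)) \<in> depends p"
  by (simp add: depends_def)

lemma depends_shift:
  assumes "p k < p j"
  shows "((i, \<beta> + axis j 1), (i, \<beta> + axis k 1)) \<in> depends p"
proof -
  have e: "(\<Sum>m\<in>UNIV. (sum p UNIV - p m) * (\<beta> + axis l 1) $ m) =
      (\<Sum>m\<in>UNIV. (sum p UNIV - p m) * \<beta> $ m) + (sum p UNIV - p l)" for l
  proof -
    have "(\<Sum>m\<in>UNIV. (sum p UNIV - p m) * axis l 1 $ m) = (\<Sum>m\<in>UNIV. if m = l then sum p UNIV - p l else 0)"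
      by (rule sum.cong) (auto simp: axis_def)
    then show ?thesis by (simp add: distrib_left sum.distrib)
  qed
  have "p j \<le> sum p UNIV" by (rule member_le_sum) auto
  with assms show ?thesis by (simp add: depends_def e del: vector_add_component)
qed

definition nonresonant_part :: "complex ^ 'n \<Rightarrow> ('n \<times> (nat ^ 'n) \<Rightarrow> complex) \<Rightarrow> 'n::finite fvec" where
  "nonresonant_part lam c = (\<chi> i. Abs_mfps (\<lambda>\<alpha>. if 2 \<le> mdeg \<alpha> \<and> weight lam \<alpha> \<noteq> lam $ i then c (i, \<alpha>) else 0))"

definition resonant_part :: "complex ^ 'n \<Rightarrow> ('n \<times> (nat ^ 'n) \<Rightarrow> complex) \<Rightarrow> 'n::finite fvec" where
  "resonant_part lam c = (\<chi> i. Abs_mfps (\<lambda>\<alpha>. if 2 \<le> mdeg \<alpha> \<and> weight lam \<alpha> = lam $ i then c (i, \<alpha>) else 0))"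

lemma coeff_nonresonant_part:
  "mfps_coeff (nonresonant_part lam c $ i) \<alpha> = (if 2 \<le> mdeg \<alpha> \<and> weight lam \<alpha> \<noteq> lam $ i then c (i, \<alpha>) else 0)"
  by (simp add: nonresonant_part_def)

lemma coeff_resonant_part:
  "mfps_coeff (resonant_part lam c $ i) \<alpha> = (if 2 \<le> mdeg \<alpha> \<and> weight lam \<alpha> = lam $ i then c (i, \<alpha>) else 0)"
  by (simp add: resonant_part_def)

lemma order_nonresonant_part: "order_at_least 2 (nonresonant_part lam c $ i)"
  by (auto simp: order_at_least_def coeff_nonresonant_part)

lemma order_resonant_part: "order_at_least 2 (resonant_part lam c $ i)"
  by (auto simp: order_at_least_def coeff_resonant_part)

text \<open>
  Writing the field as $\lambda\odot x + Nx + X$, the transformation as $y + h$ and the transformed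
  field as $\lambda\odot y + Ny + g$, this is the right-hand side of the homological equation
  $(\langle\alpha,\lambda\rangle-\lambda_i)\,h_{i,\alpha} + g_{i,\alpha} = R_{i,\alpha}$.
\<close>

definition homological_rhs :: "complex ^ 'n ^ 'n \<Rightarrow> 'n::finite fvec \<Rightarrow> 'n fvec \<Rightarrow> 'n fvec \<Rightarrow> 'n \<Rightarrow> (complex, 'n) mfps" where
  "homological_rhs N X h g i = mfps_compose (X $ i) (vars + h)
     + (\<Sum>j\<in>UNIV. mfps_const (N $ i $ j) * h $ j) - lie (linear_field N + g) (h $ i)"

text \<open>
  Each of the four contributions is triangular for its own reason: $X(y+h)$ only involves lower
  degrees as \<open>X\<close> has no linear terms, $Nh$ passes to a lower component, $Dh\,Ny$ moves one unit of an
  exponent to a higher component, and in $Dh\,g$ both factors have terms of degree two at least.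
\<close>

lemma homological_rhs_local:
  fixes X :: "'n::finite fvec" and p :: "'n \<Rightarrow> nat"
  assumes N: "\<And>i j. N $ i $ j \<noteq> 0 \<Longrightarrow> p j < p i"
    and X: "\<And>i. order_at_least 2 (X $ i)" and deg: "2 \<le> mdeg \<alpha>"
    and cc: "\<And>z. (z, (i, \<alpha>)) \<in> depends p \<Longrightarrow> c z = c' z"
  shows "mfps_coeff (homological_rhs N X (nonresonant_part lam c) (resonant_part lam c) i) \<alpha> =
    mfps_coeff (homological_rhs N X (nonresonant_part lam c') (resonant_part lam c') i) \<alpha>"
proof -
  let ?h = "nonresonant_part lam c" and ?h' = "nonresonant_part lam c'"
  let ?g = "resonant_part lam c" and ?g' = "resonant_part lam c'"
  have hz: "mfps_coeff (?h $ j) \<beta> = mfps_coeff (?h' $ j) \<beta>" if "((j, \<beta>), (i, \<alpha>)) \<in> depends p" for j \<beta>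
    using cc [OF that] by (simp add: coeff_nonresonant_part)
  have hl: "mfps_coeff (?h $ j) \<beta> = mfps_coeff (?h' $ j) \<beta>" if "mdeg \<beta> < mdeg \<alpha>" for j \<beta>
    using that by (intro hz depends_lower)
  have gl: "mfps_coeff (?g $ j) \<beta> = mfps_coeff (?g' $ j) \<beta>" if "mdeg \<beta> < mdeg \<alpha>" for j \<beta>
    using cc [OF depends_lower [OF that, of j i p]] by (simp add: coeff_resonant_part)
  have "mfps_coeff (mfps_compose (X $ i) (vars + ?h)) \<alpha> = mfps_coeff (mfps_compose (X $ i) (vars + ?h')) \<alpha>"
  proof (rule coeff_compose_cong)
    show "order_at_least 1 ((vars + ?h) $ j)" "order_at_least 1 ((vars + ?h') $ j)" for j
      by (rule order_near_vars; simp add: order_nonresonant_part)+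
    show "order_at_least (mdeg \<alpha>) ((vars + ?h) $ j - (vars + ?h') $ j)" for j
      by (simp add: order_at_least_def hl)
  qed (rule X)
  moreover have "(\<Sum>j\<in>UNIV. N $ i $ j * mfps_coeff (?h $ j) \<alpha>) = (\<Sum>j\<in>UNIV. N $ i $ j * mfps_coeff (?h' $ j) \<alpha>)"
    using hz [OF depends_component] N by (intro sum.cong refl) (metis mult_zero_left)
  moreover have "mfps_coeff (lie (linear_field N) (?h $ i)) \<alpha> = mfps_coeff (lie (linear_field N) (?h' $ i)) \<alpha>"
    unfolding coeff_lie_linear
  proof (intro sum.cong refl)
    fix j k
    show "N $ j $ k * mfps_coeff (mfps_var k * mfps_deriv j (?h $ i)) \<alpha> =
      N $ j $ k * mfps_coeff (mfps_var k * mfps_deriv j (?h' $ i)) \<alpha>"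
    proof (cases "N $ j $ k = 0 \<or> \<alpha> $ k = 0")
      case True
      then show ?thesis by (auto simp: coeff_var_mult_0)
    next
      case False
      then obtain \<beta> where b: "\<alpha> = \<beta> + axis k 1" using exponent_split by blast
      from False have "((i, \<beta> + axis j 1), (i, \<alpha>)) \<in> depends p"
        unfolding b by (intro depends_shift N) auto
      from hz [OF this] b show ?thesis by (simp add: coeff_deriv)
    qed
  qed
  moreover have "mfps_coeff (lie ?g (?h $ i)) \<alpha> = mfps_coeff (lie ?g' (?h' $ i)) \<alpha>"
    unfolding lie_def coeff_sum
  proof (intro sum.cong refl coeff_mult_cong)
    fix j \<beta> \<gamma> assume bg: "\<beta> + \<gamma> = \<alpha>"
    then have d: "mdeg \<beta> + mdeg \<gamma> = mdeg \<alpha>" by auto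
    show "mfps_coeff (mfps_deriv j (?h $ i)) \<beta> * mfps_coeff (?g $ j) \<gamma> =
      mfps_coeff (mfps_deriv j (?h' $ i)) \<beta> * mfps_coeff (?g' $ j) \<gamma>"
    proof (cases "mdeg \<gamma> < 2 \<or> mdeg \<beta> < 1")
      case True
      then have "mdeg \<gamma> < 2 \<or> \<not> 2 \<le> mdeg (\<beta> + axis j 1)" by auto
      then show ?thesis by (auto simp: coeff_deriv coeff_nonresonant_part coeff_resonant_part)
    next
      case False
      with d have "mdeg (\<beta> + axis j 1) < mdeg \<alpha>" "mdeg \<gamma> < mdeg \<alpha>"
        by (simp_all only: mdeg_add mdeg_axis) arith+
      then show ?thesis by (simp add: coeff_deriv hl gl)
    qed
  qed
  ultimately show ?thesis by (simp add: homological_rhs_def lie_add_field)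
qed

lemma homological_equation:
  fixes X :: "'n::finite fvec" and p :: "'n \<Rightarrow> nat"
  assumes N: "\<And>i j. N $ i $ j \<noteq> 0 \<Longrightarrow> p j < p i" and X: "\<And>i. order_at_least 2 (X $ i)"
  obtains h g :: "'n fvec" where
    "\<And>i. order_at_least 2 (h $ i)" "\<And>i. order_at_least 2 (g $ i)"
    "\<And>i \<alpha>. mfps_coeff (h $ i) \<alpha> \<noteq> 0 \<Longrightarrow> weight lam \<alpha> \<noteq> lam $ i"
    "\<And>i \<alpha>. mfps_coeff (g $ i) \<alpha> \<noteq> 0 \<Longrightarrow> weight lam \<alpha> = lam $ i"
    "\<And>i \<alpha>. (weight lam \<alpha> - lam $ i) * mfps_coeff (h $ i) \<alpha> + mfps_coeff (g $ i) \<alpha> =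
       mfps_coeff (homological_rhs N X h g i) \<alpha>"
proof -
  define T where "T c = (\<lambda>(i, \<alpha>). if mdeg \<alpha> < 2 then 0 else
      mfps_coeff (homological_rhs N X (nonresonant_part lam c) (resonant_part lam c) i) \<alpha> /
      (if weight lam \<alpha> = lam $ i then 1 else weight lam \<alpha> - lam $ i))" for c
  \<comment> \<open>One unknown per exponent: resonant entries of \<open>c\<close> form \<open>g\<close>, the others \<open>h\<close>.\<close>
  have "adm_wf (depends p) T"
    unfolding adm_wf_def
  proof (intro allI impI)
    fix c c' :: "'n \<times> (nat ^ 'n) \<Rightarrow> complex" and z :: "'n \<times> (nat ^ 'n)"
    assume cc: "\<forall>y. (y, z) \<in> depends p \<longrightarrow> c y = c' y"
    obtain i \<alpha> where z: "z = (i, \<alpha>)" by (cases z)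
    have "mfps_coeff (homological_rhs N X (nonresonant_part lam c) (resonant_part lam c) i) \<alpha> =
        mfps_coeff (homological_rhs N X (nonresonant_part lam c') (resonant_part lam c') i) \<alpha>"
      if "2 \<le> mdeg \<alpha>"
      by (rule homological_rhs_local [of N p X, OF N X that]) (use cc z in auto)
    then show "T c z = T c' z" by (simp add: T_def z not_less)
  qed
  from wfrec_fixpoint [OF wf_depends this]
  obtain c where c: "c z = T c z" for z by metis
  let ?h = "nonresonant_part lam c" and ?g = "resonant_part lam c"
  have low: "order_at_least 2 (homological_rhs N X ?h ?g i)" for i
  proof -
    have g: "order_at_least 1 (?g $ j)" for j
      by (rule order_mono [OF order_resonant_part]) simp
    have Ng: "order_at_least 1 ((linear_field N + ?g) $ j)" for j
      using order_add [OF order_linear_field g] by simp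
    have h2: "order_at_least (Suc 1) (?h $ j)" for j
      unfolding Suc_1 by (rule order_nonresonant_part)
    have "order_at_least 2 (lie (linear_field N + ?g) (?h $ i))"
      using order_lie [OF Ng h2] unfolding one_add_one .
    moreover have H: "order_at_least 1 ((vars + ?h) $ j)" for j
      by (rule order_near_vars) (simp add: order_nonresonant_part)
    moreover have "order_at_least 2 (\<Sum>j\<in>UNIV. mfps_const (N $ i $ j) * ?h $ j)"
      by (intro order_sum order_const_mult order_nonresonant_part)
    ultimately show ?thesis
      unfolding homological_rhs_def by (intro order_diff order_add order_compose X)
  qed
  show ?thesis
  proof (rule that [of ?h ?g])
    fix i \<alpha>
    show "(weight lam \<alpha> - lam $ i) * mfps_coeff (?h $ i) \<alpha> + mfps_coeff (?g $ i) \<alpha> =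
       mfps_coeff (homological_rhs N X ?h ?g i) \<alpha>"
    proof (cases "mdeg \<alpha> < 2")
      case True
      then show ?thesis using low [of i] by (auto simp: order_at_least_def coeff_nonresonant_part coeff_resonant_part)
    next
      case False
      then show ?thesis
        by (simp add: coeff_nonresonant_part coeff_resonant_part c [of "(i, \<alpha>)"] T_def)
    qed
  qed (auto simp: order_nonresonant_part order_resonant_part coeff_nonresonant_part coeff_resonant_part split: if_splits)
qed

lemma linear_field_diagonal:
  "linear_field (\<chi> i j. if i = j then lam $ i else 0) = diagonal_field lam"
  by (simp add: vec_eq_iff linear_field_def diagonal_field_def mfps_eq_iff if_distrib if_distribR
      coeff_const_mult sum.delta' cong: if_cong)

text \<open>
  The homological equation expresses that $y + h$ conjugates
  $\lambda\odot x + Nx + X$ to $\lambda\odot y + Ny + g$.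
\<close>

lemma conjugation_of_homological_equation:
  fixes X :: "'n::finite fvec"
  assumes h: "\<And>i. order_at_least 2 (h $ i)"
    and eq: "\<And>i \<alpha>. (weight lam \<alpha> - lam $ i) * mfps_coeff (h $ i) \<alpha> + mfps_coeff (g $ i) \<alpha> =
       mfps_coeff (homological_rhs N X h g i) \<alpha>"
  shows "lie (diagonal_field lam + linear_field N + g) ((vars + h) $ i) =
    mfps_compose ((diagonal_field lam + linear_field N + X) $ i) (vars + h)"
proof (rule mfps_eqI)
  fix \<alpha>
  have H: "order_at_least 1 ((vars + h) $ j)" for j
    by (rule order_near_vars) (simp add: h)
  have D: "mfps_compose (diagonal_field lam $ i) (vars + h) = mfps_const (lam $ i) * (mfps_var i + h $ i)"
    by (simp add: diagonal_field_def compose_const_mult compose_var [OF H])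
  have L: "mfps_compose (linear_field N $ i) (vars + h) =
      linear_field N $ i + (\<Sum>j\<in>UNIV. mfps_const (N $ i $ j) * h $ j)"
    by (simp add: linear_field_def compose_sum compose_const_mult compose_var [OF H]
        distrib_left sum.distrib)
  have "mfps_coeff (lie (diagonal_field lam + linear_field N + g) ((vars + h) $ i)) \<alpha> =
      mfps_coeff (diagonal_field lam $ i) \<alpha> + mfps_coeff (linear_field N $ i) \<alpha> + mfps_coeff (g $ i) \<alpha> +
      weight lam \<alpha> * mfps_coeff (h $ i) \<alpha> + mfps_coeff (lie (linear_field N + g) (h $ i)) \<alpha>"
    by (simp add: lie_add lie_var lie_add_field coeff_lie_diagonal)
  also have "\<dots> = mfps_coeff (diagonal_field lam $ i) \<alpha> + mfps_coeff (linear_field N $ i) \<alpha>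
      + mfps_coeff (lie (linear_field N + g) (h $ i)) \<alpha> + lam $ i * mfps_coeff (h $ i) \<alpha>
      + ((weight lam \<alpha> - lam $ i) * mfps_coeff (h $ i) \<alpha> + mfps_coeff (g $ i) \<alpha>)"
    by (simp add: algebra_simps)
  also have "\<dots> = mfps_coeff (mfps_compose ((diagonal_field lam + linear_field N + X) $ i) (vars + h)) \<alpha>"
    unfolding eq by (simp add: homological_rhs_def compose_add D L distrib_left) (simp add: diagonal_field_def)
  finally show "mfps_coeff (lie (diagonal_field lam + linear_field N + g) ((vars + h) $ i)) \<alpha> =
    mfps_coeff (mfps_compose ((diagonal_field lam + linear_field N + X) $ i) (vars + h)) \<alpha>" .
qed

section \<open>First integrals of a normal form\<close>

lemma lie_compose:
  fixes F G H :: "('a::idom, 'n::finite) mfps ^ 'n"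
  assumes H: "\<And>i. order_at_least 1 (H $ i)"
    and conj: "\<And>i. lie G (H $ i) = mfps_compose (F $ i) H"
  shows "lie G (mfps_compose \<psi> H) = mfps_compose (lie F \<psi>) H"
proof -
  have "lie G (mfps_compose \<psi> H) =
      (\<Sum>j\<in>UNIV. \<Sum>i\<in>UNIV. mfps_compose (mfps_deriv i \<psi>) H * (mfps_deriv j (H $ i) * G $ j))"
    unfolding lie_def chain_rule [OF H] sum_distrib_right by (simp only: mult.assoc)
  also have "\<dots> = (\<Sum>i\<in>UNIV. mfps_compose (mfps_deriv i \<psi>) H * lie G (H $ i))"
    by (subst sum.swap) (simp add: lie_def sum_distrib_left)
  also have "\<dots> = mfps_compose (lie F \<psi>) H"
    unfolding conj by (simp add: lie_def compose_sum compose_mult [OF H])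
  finally show ?thesis .
qed

text \<open>
  A field in normal form preserves weights: differentiating along it multiplies a monomial by
  Laurent monomials of weight zero.
\<close>

lemma coeff_lie_resonant_eq_0:
  assumes g: "\<And>j \<gamma>. mfps_coeff (g $ j) \<gamma> \<noteq> 0 \<Longrightarrow> weight lam \<gamma> = lam $ j"
    and f: "\<And>\<beta>. weight lam \<beta> = weight lam \<alpha> \<Longrightarrow> mfps_coeff f \<beta> = 0"
  shows "mfps_coeff (lie g f) \<alpha> = 0"
  unfolding lie_def coeff_sum
proof (intro sum.neutral ballI coeff_mult_eq_0)
  fix j \<beta> \<gamma> assume "\<beta> + \<gamma> = \<alpha>"
  then have "mfps_coeff (g $ j) \<gamma> \<noteq> 0 \<Longrightarrow> weight lam (\<beta> + axis j 1) = weight lam \<alpha>"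
    using g [of j \<gamma>] by (auto simp: weight_add)
  then show "mfps_coeff (mfps_deriv j f) \<beta> * mfps_coeff (g $ j) \<gamma> = 0"
    using f [of "\<beta> + axis j 1"] by (cases "mfps_coeff (g $ j) \<gamma> = 0") (auto simp: coeff_deriv)
qed

text \<open>
  Since weights are preserved, the component of a first integral of any given weight is a first
  integral.  On a component of nonzero weight the derivation is multiplication by the weight plus
  a part that is triangular with respect to \<open>depends\<close>, hence invertible.
\<close>

lemma first_integral_resonant:
  fixes g :: "'n::finite fvec" and p :: "'n \<Rightarrow> nat"
  assumes N: "\<And>i j. N $ i $ j \<noteq> 0 \<Longrightarrow> p j < p i" "\<And>i j. N $ i $ j \<noteq> 0 \<Longrightarrow> lam $ j = lam $ i"
    and g2: "\<And>i. order_at_least 2 (g $ i)"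
    and g: "\<And>j \<gamma>. mfps_coeff (g $ j) \<gamma> \<noteq> 0 \<Longrightarrow> weight lam \<gamma> = lam $ j"
    and int: "lie (diagonal_field lam + linear_field N + g) \<phi> = 0"
    and "weight lam \<alpha> \<noteq> 0"
  shows "mfps_coeff \<phi> \<alpha> = 0"
proof -
  \<comment> \<open>Fixing the component turns \<open>depends\<close> into a well-founded order on exponents.\<close>
  fix i :: 'n
  have "weight lam (snd z) \<noteq> 0 \<longrightarrow> mfps_coeff \<phi> (snd z) = 0" if "fst z = i" for z
    using that
  proof (induction z rule: wf_induct_rule [OF wf_depends [of p]])
    case (1 z)
    then obtain \<alpha> where z: "z = (i, \<alpha>)" by (cases z) auto
    show ?case
    proof
      assume "weight lam (snd z) \<noteq> 0"
      then have w: "weight lam \<alpha> \<noteq> 0" by (simp add: z)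
      have IH: "mfps_coeff \<phi> \<beta> = 0" if "((i, \<beta>), (i, \<alpha>)) \<in> depends p" "weight lam \<beta> = weight lam \<alpha>" for \<beta>
        using 1(1) [of "(i, \<beta>)"] that w by (simp add: z)
      have "mfps_coeff (lie (linear_field N) \<phi>) \<alpha> = 0"
        unfolding coeff_lie_linear
      proof (intro sum.neutral ballI)
        fix j k
        show "N $ j $ k * mfps_coeff (mfps_var k * mfps_deriv j \<phi>) \<alpha> = 0"
        proof (cases "N $ j $ k = 0 \<or> \<alpha> $ k = 0")
          case True
          then show ?thesis by (auto simp: coeff_var_mult_0)
        next
          case False
          then obtain \<beta> where b: "\<alpha> = \<beta> + axis k 1" using exponent_split by blast
          from False have "((i, \<beta> + axis j 1), (i, \<alpha>)) \<in> depends p"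
            unfolding b by (intro depends_shift N) auto
          moreover have "weight lam (\<beta> + axis j 1) = weight lam \<alpha>"
            using False N(2) [of j k] by (simp add: b weight_add)
          ultimately have "mfps_coeff \<phi> (\<beta> + axis j 1) = 0" by (rule IH)
          with b show ?thesis by (simp add: coeff_deriv)
        qed
      qed
      moreover have "mfps_coeff (lie g \<phi>) \<alpha> = 0"
        unfolding lie_def coeff_sum
      proof (intro sum.neutral ballI coeff_mult_eq_0)
        fix j \<beta> \<gamma> assume bg: "\<beta> + \<gamma> = \<alpha>"
        show "mfps_coeff (mfps_deriv j \<phi>) \<beta> * mfps_coeff (g $ j) \<gamma> = 0"
        proof (cases "mfps_coeff (g $ j) \<gamma> = 0")
          case False
          then have "2 \<le> mdeg \<gamma>" using g2 [of j] by (auto simp: order_at_least_def not_less [symmetric])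
          with bg have "mdeg (\<beta> + axis j 1) < mdeg \<alpha>" by auto
          moreover have "weight lam (\<beta> + axis j 1) = weight lam \<alpha>"
            using g [OF False] bg by (auto simp: weight_add)
          ultimately have "mfps_coeff \<phi> (\<beta> + axis j 1) = 0" by (intro IH depends_lower)
          then show ?thesis by (simp add: coeff_deriv)
        qed simp
      qed
      moreover have "mfps_coeff (lie (diagonal_field lam + linear_field N + g) \<phi>) \<alpha> = 0"
        by (simp add: int)
      ultimately have "weight lam \<alpha> * mfps_coeff \<phi> \<alpha> = 0"
        by (simp add: lie_add_field coeff_lie_diagonal)
      with w show "mfps_coeff \<phi> (snd z) = 0" by (simp add: z)
    qed
  qed
  from this [of "(i, \<alpha>)"] \<open>weight lam \<alpha> \<noteq> 0\<close> show ?thesis by simp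
qed

section \<open>Linear algebra over power series\<close>

text \<open>Gaussian elimination with cross-multiplication, so that no denominators arise.\<close>

lemma more_vectors_than_coordinates:
  fixes r :: "'k \<Rightarrow> 't \<Rightarrow> 'a::idom"
  assumes "finite T" "finite M" "card T < card M"
  shows "\<exists>c. (\<exists>k\<in>M. c k \<noteq> 0) \<and> (\<forall>t\<in>T. (\<Sum>k\<in>M. c k * r k t) = 0)"
  using assms
proof (induction T arbitrary: M r rule: finite_induct)
  case empty
  then have "M \<noteq> {}" by auto
  then show ?case by (intro exI [of _ "\<lambda>_. 1"]) auto
next
  case (insert t T)
  show ?case
  proof (cases "\<forall>k\<in>M. r k t = 0")
    case True
    have "card T < card M" using insert.prems insert.hyps by simp
    from insert.IH [OF insert.prems(1) this, of r] True show ?thesis by auto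
  next
    case False
    then obtain k0 where k0: "k0 \<in> M" "r k0 t \<noteq> 0" by blast
    let ?M = "M - {k0}"
    have "card T < card ?M" using insert.prems insert.hyps k0 by simp
    from insert.IH [OF _ this, of "\<lambda>k s. r k0 t * r k s - r k t * r k0 s"] insert.prems(1)
    obtain c where c: "\<exists>k\<in>?M. c k \<noteq> 0"
      "\<forall>s\<in>T. (\<Sum>k\<in>?M. c k * (r k0 t * r k s - r k t * r k0 s)) = 0" by auto
    define d where "d k = (if k = k0 then - (\<Sum>k\<in>?M. c k * r k t) else c k * r k0 t)" for k
    have sum: "(\<Sum>k\<in>M. d k * r k s) = (\<Sum>k\<in>?M. c k * (r k0 t * r k s - r k t * r k0 s))" for s
    proof -
      have "(\<Sum>k\<in>M. d k * r k s) = d k0 * r k0 s + (\<Sum>k\<in>?M. d k * r k s)"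
        using k0 insert.prems(1) by (simp add: sum.remove)
      also have "(\<Sum>k\<in>?M. d k * r k s) = (\<Sum>k\<in>?M. c k * r k0 t * r k s)"
        by (rule sum.cong) (auto simp: d_def)
      finally show ?thesis
        by (simp add: d_def right_diff_distrib sum_subtractf sum_distrib_right mult.assoc)
    qed
    have "\<exists>k\<in>M. d k \<noteq> 0" using c(1) k0(2) by (auto simp: d_def)
    moreover have "(\<Sum>k\<in>M. d k * r k s) = 0" if "s \<in> insert t T" for s
      using that c(2) unfolding sum by auto
    ultimately show ?thesis by blast
  qed
qed

lemma sum_Fract: "(\<Sum>x\<in>S. Fract (f x) 1) = Fract (\<Sum>x\<in>S. f x) 1"
  by (induction S rule: infinite_finite_induct) (auto simp: Zero_fract_def)

lemma common_denominator:
  fixes X :: "'a::idom fract set"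
  assumes "finite X"
  shows "\<exists>d. d \<noteq> 0 \<and> (\<forall>x\<in>X. \<exists>a. x * Fract d 1 = Fract a 1)"
  using assms
proof (induction X rule: finite_induct)
  case empty
  show ?case by (intro exI [of _ 1]) simp
next
  case (insert x X)
  then obtain d where d: "d \<noteq> 0" "\<And>y. y \<in> X \<Longrightarrow> \<exists>a. y * Fract d 1 = Fract a 1" by blast
  obtain a b where x: "x = Fract a b" "b \<noteq> 0" by (cases x)
  have "x * Fract (b * d) 1 = Fract (a * d) 1" using x by (simp add: eq_fract)
  moreover have "\<exists>a'. y * Fract (b * d) 1 = Fract a' 1" if "y \<in> X" for y
  proof -
    from d(2) [OF that] obtain a' where "y * Fract d 1 = Fract a' 1" ..
    moreover have "y * Fract (b * d) 1 = y * Fract d 1 * Fract b 1"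
      by (simp add: mult.assoc mult.commute [of b])
    ultimately have "y * Fract (b * d) 1 = Fract (a' * b) 1" by simp
    then show ?thesis ..
  qed
  ultimately show ?case using x d(1) by (intro exI [of _ "b * d"]) auto
qed

text \<open>
  Full rank over the fraction field provides a right inverse, and clearing its denominators makes
  it an identity between power series, into which other series can be substituted.
\<close>

lemma full_rank_right_inverse:
  fixes J :: "'a::idom ^ 'n::finite ^ 'm::finite"
  assumes "rank (map_matrix (\<lambda>f. Fract f 1) J) = CARD('m)"
  obtains B :: "'n \<Rightarrow> 'm \<Rightarrow> 'a" and d where "d \<noteq> 0"
    "\<And>k k'. (\<Sum>j\<in>UNIV. J $ k $ j * B j k') = (if k = k' then d else 0)"
proof -
  let ?A = "map_matrix (\<lambda>f. Fract f 1) J"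
  have indep: "\<forall>c. (\<Sum>i\<in>UNIV. c i *s row i ?A) = 0 \<longrightarrow> (\<forall>i. c i = 0)"
  proof (intro allI impI, rule ccontr)
    \<comment> \<open>A relation would make the row \<open>k\<close> superfluous and the rank smaller than the number of rows.\<close>
    fix c k assume z: "(\<Sum>i\<in>UNIV. c i *s row i ?A) = 0" and ck: "c k \<noteq> 0"
    let ?W = "(\<lambda>i. row i ?A) ` (UNIV - {k})"
    have "c k *s row k ?A = - (\<Sum>i\<in>UNIV - {k}. c i *s row i ?A)"
      using z by (simp add: sum.remove [of UNIV k] eq_neg_iff_add_eq_0)
    then have "inverse (c k) *s (c k *s row k ?A) = inverse (c k) *s (- (\<Sum>i\<in>UNIV - {k}. c i *s row i ?A))"
      by simp
    then have "row k ?A = inverse (c k) *s (- (\<Sum>i\<in>UNIV - {k}. c i *s row i ?A))"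
      using ck by (simp add: vector_smult_assoc)
    moreover have "inverse (c k) *s (- (\<Sum>i\<in>UNIV - {k}. c i *s row i ?A)) \<in> vec.span ?W"
      by (intro vec.span_scale vec.span_neg vec.span_sum vec.span_base imageI)
    ultimately have "row k ?A \<in> vec.span ?W" by simp
    then have "rows ?A \<subseteq> vec.span ?W"
      by (auto simp: rows_def) (metis DiffI UNIV_I image_eqI singletonD vec.span_base)
    then have "vec.dim (rows ?A) \<le> card ?W" by (rule vec.dim_le_card) simp
    also have "\<dots> \<le> card (UNIV - {k} :: 'm set)" by (rule card_image_le) simp
    also have "\<dots> < CARD('m)" by (rule psubset_card_mono) auto
    finally show False using assms by (simp add: row_rank_def_gen)
  qed
  then have "\<exists>B :: 'a fract ^ 'm ^ 'n. ?A ** B = mat 1"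
    by (simp only: matrix_right_invertible_independent_rows)
  then obtain B :: "'a fract ^ 'm ^ 'n" where B: "?A ** B = mat 1" ..
  have "\<exists>d. d \<noteq> 0 \<and> (\<forall>x\<in>range (\<lambda>p. B $ fst p $ snd p). \<exists>a. x * Fract d 1 = Fract a 1)"
    by (rule common_denominator) simp
  then obtain d where d: "d \<noteq> 0" "\<And>j k. \<exists>a. B $ j $ k * Fract d 1 = Fract a 1"
    by (auto simp del: mult_fract)
  from d(2) obtain b where b: "B $ j $ k * Fract d 1 = Fract (b j k) 1" for j k by metis
  show ?thesis
  proof (rule that [OF d(1)])
    fix k k'
    have "(?A ** B) $ k $ k' * Fract d 1 = (\<Sum>j\<in>UNIV. Fract (J $ k $ j) 1 * (B $ j $ k' * Fract d 1))"
      by (simp add: matrix_matrix_mult_def sum_distrib_right mult.assoc)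
    also have "\<dots> = Fract (\<Sum>j\<in>UNIV. J $ k $ j * b j k') 1"
      unfolding b by (simp add: sum_Fract)
    finally have "Fract (\<Sum>j\<in>UNIV. J $ k $ j * b j k') 1 = (if k = k' then Fract d 1 else 0)"
      unfolding B by (simp add: mat_def split: if_splits)
    then show "(\<Sum>j\<in>UNIV. J $ k $ j * b j k') = (if k = k' then d else 0)"
      by (auto simp: Zero_fract_def eq_fract split: if_splits)
  qed
qed

text \<open>
  The matrix $DH$ is the identity plus terms of positive order, so a row vector that it annihilates
  equals minus its image under those terms, and its order can be raised indefinitely.
\<close>

lemma jacobian_left_cancel:
  fixes H :: "('a::comm_ring_1, 'n::finite) mfps ^ 'n"
  assumes H: "\<And>i. order_at_least 2 (H $ i - mfps_var i)"
    and e: "\<And>j. (\<Sum>i\<in>UNIV. e i * mfps_deriv j (H $ i)) = 0"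
  shows "e i = 0"
proof -
  let ?h = "\<lambda>i. H $ i - mfps_var i"
  have step: "e j = - (\<Sum>i\<in>UNIV. e i * mfps_deriv j (?h i))" for j
  proof -
    have d: "mfps_deriv j (H $ i) = mfps_deriv j (mfps_var i) + mfps_deriv j (?h i)" for i
      using deriv_add [of j "mfps_var i" "?h i"] by simp
    have "(\<Sum>i\<in>UNIV. e i * mfps_deriv j (H $ i)) = (\<Sum>i\<in>UNIV. (if i = j then e i else 0) + e i * mfps_deriv j (?h i))"
      by (intro sum.cong refl) (simp only: d distrib_left, simp add: deriv_var)
    then have "0 = e j + (\<Sum>i\<in>UNIV. e i * mfps_deriv j (?h i))"
      by (simp add: e sum.distrib)
    then show ?thesis unfolding eq_neg_iff_add_eq_0 by (rule sym)
  qed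
  have "order_at_least k (e j)" for k j
  proof (induction k arbitrary: j)
    case (Suc k)
    have "order_at_least (Suc 1) (?h i)" for i unfolding Suc_1 by (rule H)
    then have "order_at_least (k + 1) (\<Sum>i\<in>UNIV. e i * mfps_deriv j (?h i))"
      by (intro order_sum order_mult Suc order_deriv)
    then show ?case by (subst step) (auto simp: order_at_least_def)
  qed simp
  then show ?thesis by (rule order_all_imp_0)
qed

text \<open>
  Independence survives the substitution: the right inverse of the Jacobian matrix, with
  denominators cleared, is substituted along, and the denominator stays nonzero.
\<close>

lemma independent_compose:
  fixes \<psi> :: "(complex, 'n::finite) mfps ^ 'm::finite" and H :: "'n fvec"
  assumes ind: "rank (map_matrix (\<lambda>f. Fract f 1) (jacobian \<psi>)) = CARD('m)"
    and H: "\<And>i. order_at_least 2 (H $ i - mfps_var i)"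
    and c: "\<And>j. (\<Sum>k\<in>UNIV. c k * mfps_deriv j (mfps_compose (\<psi> $ k) H)) = 0"
  shows "c k = 0"
proof -
  have H1: "order_at_least 1 (H $ i)" for i by (rule order_near_vars [OF H])
  obtain B d where d: "d \<noteq> 0"
    and B: "\<And>k k'. (\<Sum>j\<in>UNIV. jacobian \<psi> $ k $ j * B j k') = (if k = k' then d else 0)"
    using full_rank_right_inverse [OF ind] by metis
  define e where "e i = (\<Sum>k\<in>UNIV. c k * mfps_compose (mfps_deriv i (\<psi> $ k)) H)" for i
  have "(\<Sum>i\<in>UNIV. e i * mfps_deriv j (H $ i)) = 0" for j
  proof -
    have "(\<Sum>i\<in>UNIV. e i * mfps_deriv j (H $ i)) =
        (\<Sum>k\<in>UNIV. c k * mfps_deriv j (mfps_compose (\<psi> $ k) H))"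
      unfolding e_def chain_rule [OF H1] sum_distrib_right sum_distrib_left
      by (subst sum.swap) (simp only: mult.assoc)
    with c show ?thesis by simp
  qed
  from jacobian_left_cancel [OF H this] have e0: "e i = 0" for i by simp
  have "0 = (\<Sum>i\<in>UNIV. e i * mfps_compose (B i k) H)" by (simp add: e0)
  also have "\<dots> = (\<Sum>k'\<in>UNIV. c k' * (\<Sum>i\<in>UNIV. mfps_compose (mfps_deriv i (\<psi> $ k')) H * mfps_compose (B i k) H))"
    unfolding e_def sum_distrib_right sum_distrib_left by (subst sum.swap) (simp only: mult.assoc)
  also have "\<dots> = (\<Sum>k'\<in>UNIV. c k' * mfps_compose (if k' = k then d else 0) H)"
    unfolding B [symmetric] by (simp add: compose_sum compose_mult [OF H1] jacobian_def)
  also have "\<dots> = c k * mfps_compose d H"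
    by (simp add: if_distrib if_distribR cong: if_cong)
  finally show ?thesis using compose_injective [OF H d] by simp
qed

text \<open>
  Here \<open>card S - 1\<close> independent covectors supported on \<open>S\<close> annihilate at most a line of vectors.
  If two annihilated vectors had a nonzero minor in the coordinates \<open>i\<close>, \<open>j\<close>, a combination of
  the covectors vanishing in all other coordinates would vanish altogether by Cramer's rule.
\<close>

lemma annihilated_vectors_proportional:
  fixes r :: "'m::finite \<Rightarrow> 'n::finite \<Rightarrow> 'a::idom"
  assumes card: "card S \<le> Suc CARD('m)" and supp: "\<And>k t. t \<notin> S \<Longrightarrow> r k t = 0"
    and ind: "\<And>c k. (\<And>t. (\<Sum>k\<in>UNIV. c k * r k t) = 0) \<Longrightarrow> c k = 0"
    and v: "\<And>k. (\<Sum>t\<in>UNIV. r k t * v t) = 0" and w: "\<And>k. (\<Sum>t\<in>UNIV. r k t * w t) = 0"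
    and ij: "i \<in> S" "j \<in> S"
  shows "v i * w j = v j * w i"
proof (rule ccontr)
  assume ne: "v i * w j \<noteq> v j * w i"
  then have "i \<noteq> j" by (metis mult.commute)
  let ?T = "S - {i, j}"
  have "card S \<ge> 2" using ij \<open>i \<noteq> j\<close> by (metis card_2_iff card_mono empty_subsetI finite_code insert_subset)
  then have "card ?T < CARD('m)" using card ij \<open>i \<noteq> j\<close> by (simp add: card_Diff_subset)
  from more_vectors_than_coordinates [of ?T "UNIV :: 'm set" r, OF _ _ this]
  obtain c where c: "\<exists>k. c k \<noteq> 0" "\<And>t. t \<in> ?T \<Longrightarrow> (\<Sum>k\<in>UNIV. c k * r k t) = 0"
    by auto
  define q where "q t = (\<Sum>k\<in>UNIV. c k * r k t)" for t
  have q0: "q t = 0" if "t \<noteq> i" "t \<noteq> j" for t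
    using c(2) [of t] supp [of t] that by (cases "t \<in> S") (auto simp: q_def)
  have ann: "q i * u i + q j * u j = 0" if u: "\<And>k. (\<Sum>t\<in>UNIV. r k t * u t) = 0" for u
  proof -
    have "(\<Sum>t\<in>UNIV. q t * u t) = (\<Sum>k\<in>UNIV. c k * (\<Sum>t\<in>UNIV. r k t * u t))"
      unfolding q_def sum_distrib_right sum_distrib_left by (subst sum.swap) (simp only: mult.assoc)
    then have "0 = (\<Sum>t\<in>UNIV. q t * u t)" by (simp add: u)
    also have "\<dots> = (\<Sum>t\<in>{i, j}. q t * u t)"
      by (rule sum.mono_neutral_right) (auto simp: q0)
    finally show ?thesis using \<open>i \<noteq> j\<close> by simp
  qed
  have "q i * (v i * w j - v j * w i) = (q i * v i + q j * v j) * w j - (q i * w i + q j * w j) * v j"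
    "q j * (v i * w j - v j * w i) = (q i * w i + q j * w j) * v i - (q i * v i + q j * v j) * w i"
    by (simp_all add: algebra_simps)
  then have "q i * (v i * w j - v j * w i) = 0" "q j * (v i * w j - v j * w i) = 0"
    unfolding ann [OF v] ann [OF w] by simp_all
  then have "q i = 0" "q j = 0" using ne by simp_all
  with q0 have "q t = 0" for t by metis
  then have "c k = 0" for k using ind [of c] by (simp add: q_def)
  with c(1) show False by simp
qed

section \<open>Commensurable eigenvalues\<close>

text \<open>
  Such a functional turns linear relations with natural coefficients between eigenvalues into the
  same relations between rational numbers.
\<close>

lemma rational_functional:
  fixes z :: complex
  assumes "z \<noteq> 0"
  obtains f :: "complex \<Rightarrow> rat" where "f z = 1" "\<And>x y. f (x + y) = f x + f y"
    "\<And>n x. f (of_nat n * x) = of_nat n * f x"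
proof -
  interpret vector_space_pair "\<lambda>(q::rat) (x::complex). of_rat q * x" "(*) :: rat \<Rightarrow> rat \<Rightarrow> rat"
    by unfold_locales (simp_all add: algebra_simps of_rat_add of_rat_mult)
  have "vs1.independent {z}"
    using assms by (simp add: vs1.dependent_single)
  from linear_independent_extend [OF this, of "\<lambda>_. 1"]
  obtain f where f: "Vector_Spaces.linear (\<lambda>q x. of_rat q * x) (*) f" "f z = 1"
    by auto
  interpret f: Vector_Spaces.linear "\<lambda>(q::rat) (x::complex). of_rat q * x" "(*) :: rat \<Rightarrow> rat \<Rightarrow> rat" f
    by (rule f(1))
  show ?thesis
  proof (rule that [of f])
    fix n x y
    show "f (x + y) = f x + f y" by (rule f.add)
    show "f (of_nat n * x) = of_nat n * f x" using f.scale [of "of_nat n" x] by simp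
  qed (rule f(2))
qed

lemma integer_multiples:
  fixes q :: "'i \<Rightarrow> rat"
  assumes "finite S"
  shows "\<exists>D::int. D \<noteq> 0 \<and> (\<forall>i\<in>S. \<exists>k::int. of_int D * q i = of_int k)"
  using assms
proof (induction S rule: finite_induct)
  case empty
  show ?case by (intro exI [of _ 1]) simp
next
  case (insert i S)
  then obtain D where D: "D \<noteq> 0" "\<And>j. j \<in> S \<Longrightarrow> \<exists>k::int. of_int D * q j = of_int k" by blast
  obtain a b where q: "q i = Rat.Fract a b" "b > 0" by (cases "q i")
  then have "of_int b * q i = of_int a" by (simp add: Fract_of_int_quotient)
  then have "of_int (b * D) * q i = of_int (D * a)" by (simp add: mult_ac)
  then have "\<exists>k::int. of_int (b * D) * q i = of_int k" ..
  moreover have "\<exists>k::int. of_int (b * D) * q j = of_int k" if j: "j \<in> S" for j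
  proof -
    from D(2) [OF j] obtain k :: int where "of_int D * q j = of_int k" ..
    then have "of_int (b * D) * q j = of_int (b * k)" by (simp add: mult.assoc)
    then show ?thesis ..
  qed
  ultimately show ?case using D(1) q(2) by (intro exI [of _ "b * D"]) (auto simp del: of_int_mult)
qed

section \<open>The normal form on the central eigenspace\<close>

lemma weight_0_support:
  assumes re: "\<And>i. i \<in> S \<Longrightarrow> Re (lam $ i) = 0" "\<And>i. i \<notin> S \<Longrightarrow> Re (lam $ i) > 0"
    and w: "Re (weight lam \<alpha>) = 0" and j: "j \<notin> S"
  shows "\<alpha> $ j = 0"
proof -
  have nn: "0 \<le> real (\<alpha> $ i) * Re (lam $ i)" for i
    using re [of i] by (cases "i \<in> S") (auto intro: less_imp_le)
  have "(\<Sum>i\<in>UNIV. real (\<alpha> $ i) * Re (lam $ i)) = 0"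
    using w by (simp add: weight_def)
  then have "real (\<alpha> $ j) * Re (lam $ j) = 0"
    using nn by (subst (asm) sum_nonneg_eq_0_iff) auto
  with re(2) [OF j] show ?thesis by simp
qed

text \<open>
  The differentials only involve the variables in \<open>S\<close> and leave room for one annihilated
  direction, which contains $\lambda\odot y$ because all monomials have weight zero.
\<close>

lemma central_direction:
  fixes \<phi> :: "'m::finite \<Rightarrow> (complex, 'n::finite) mfps"
  assumes re: "\<And>i. i \<in> S \<Longrightarrow> Re (lam $ i) = 0" "\<And>i. i \<notin> S \<Longrightarrow> Re (lam $ i) > 0"
    and card: "card S \<le> Suc CARD('m)"
    and res: "\<And>k \<alpha>. weight lam \<alpha> \<noteq> 0 \<Longrightarrow> mfps_coeff (\<phi> k) \<alpha> = 0"
    and ind: "\<And>c k. (\<And>j. (\<Sum>k\<in>UNIV. c k * mfps_deriv j (\<phi> k)) = 0) \<Longrightarrow> c k = 0"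
    and G: "\<And>k. lie G (\<phi> k) = 0"
    and ij: "i \<in> S" "j \<in> S"
  shows "diagonal_field lam $ i * G $ j = diagonal_field lam $ j * G $ i"
proof (rule annihilated_vectors_proportional [of S "\<lambda>k j. mfps_deriv j (\<phi> k)"])
  show "mfps_deriv t (\<phi> k) = 0" if "t \<notin> S" for k t
  proof (rule mfps_eqI)
    fix \<alpha>
    have "weight lam (\<alpha> + axis t 1) \<noteq> 0"
    proof
      assume "weight lam (\<alpha> + axis t 1) = 0"
      then have "(\<alpha> + axis t 1) $ t = 0"
        using weight_0_support [of S lam "\<alpha> + axis t 1" t] re that by auto
      then show False by (simp add: axis_def)
    qed
    then show "mfps_coeff (mfps_deriv t (\<phi> k)) \<alpha> = mfps_coeff 0 \<alpha>"
      by (simp add: coeff_deriv res)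
  qed
  show "(\<Sum>t\<in>UNIV. mfps_deriv t (\<phi> k) * diagonal_field lam $ t) = 0" for k
    unfolding lie_def [symmetric]
    by (rule mfps_eqI) (use res in \<open>auto simp: coeff_lie_diagonal\<close>)
  show "(\<Sum>t\<in>UNIV. mfps_deriv t (\<phi> k) * G $ t) = 0" for k
    using G by (simp add: lie_def)
qed (use assms in auto)

text \<open>
  Let \<open>f\<close> be linear over the rationals with $f(\lambda_{j_0}) = 1$.  The field $f(\lambda)\odot y$ annihilates
  every monomial of weight zero, so it is proportional to $\lambda\odot y$ on \<open>S\<close>.  Comparing
  components, $\lambda_i = f(\lambda_i)\,\lambda_{j_0}$.
\<close>

lemma central_eigenvalues_commensurable:
  fixes \<phi> :: "'m::finite \<Rightarrow> (complex, 'n::finite) mfps"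
  assumes re: "\<And>i. i \<in> S \<Longrightarrow> Re (lam $ i) = 0" "\<And>i. i \<notin> S \<Longrightarrow> Re (lam $ i) > 0"
    and card: "card S \<le> Suc CARD('m)"
    and res: "\<And>k \<alpha>. weight lam \<alpha> \<noteq> 0 \<Longrightarrow> mfps_coeff (\<phi> k) \<alpha> = 0"
    and ind: "\<And>c k. (\<And>j. (\<Sum>k\<in>UNIV. c k * mfps_deriv j (\<phi> k)) = 0) \<Longrightarrow> c k = 0"
    and j0: "j0 \<in> S" "lam $ j0 \<noteq> 0"
  shows "\<exists>(\<theta> :: complex) k :: 'n \<Rightarrow> int. \<theta> \<noteq> 0 \<and> (\<forall>i\<in>S. lam $ i = \<theta> * of_int (k i))"
proof -
  obtain f :: "complex \<Rightarrow> rat" where f: "f (lam $ j0) = 1" "\<And>x y. f (x + y) = f x + f y"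
    "\<And>n x. f (of_nat n * x) = of_nat n * f x"
    using rational_functional [OF j0(2)] by metis
  have f0: "f 0 = 0" using f(2) [of 0 0] by simp
  have fsum: "f (\<Sum>x\<in>X. g x) = (\<Sum>x\<in>X. f (g x))" for g :: "'n \<Rightarrow> complex" and X
    by (induction X rule: infinite_finite_induct) (auto simp: f0 f(2))
  define q :: "complex ^ 'n" where "q = (\<chi> i. of_rat (f (lam $ i)))"
  have wq: "weight q \<alpha> = of_rat (f (weight lam \<alpha>))" for \<alpha>
    by (simp add: weight_def q_def fsum f(3) of_rat_sum of_rat_mult)
  have lie: "lie (diagonal_field q) (\<phi> k) = 0" for k
  proof (rule mfps_eqI)
    show "mfps_coeff (lie (diagonal_field q) (\<phi> k)) \<alpha> = mfps_coeff 0 \<alpha>" for \<alpha>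
      using res [of \<alpha> k] by (cases "weight lam \<alpha> = 0") (simp_all add: coeff_lie_diagonal wq f0)
  qed
  have ratio: "lam $ i = of_rat (f (lam $ i)) * lam $ j0" if i: "i \<in> S" for i
  proof -
    have "diagonal_field lam $ i * diagonal_field q $ j0 = diagonal_field lam $ j0 * diagonal_field q $ i"
      by (rule central_direction [of S lam \<phi>]) (use re card res ind lie i j0 in auto)
    then have "mfps_const (lam $ i) * (mfps_const (q $ j0) * (mfps_var i * mfps_var j0)) =
       mfps_const (lam $ j0) * (mfps_const (q $ i) * (mfps_var i * mfps_var j0))"
      by (simp add: diagonal_field_def ac_simps)
    then have "mfps_coeff (mfps_const (lam $ i) * (mfps_const (q $ j0) * (mfps_var i * mfps_var j0))) (axis j0 1 + axis i 1) =
       mfps_coeff (mfps_const (lam $ j0) * (mfps_const (q $ i) * (mfps_var i * mfps_var j0))) (axis j0 1 + axis i 1)"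
      by (rule arg_cong)
    then have "lam $ i * q $ j0 = lam $ j0 * q $ i"
      unfolding coeff_const_mult coeff_var_mult_Suc by (simp add: coeff_var)
    then show ?thesis by (simp add: q_def f(1) mult.commute)
  qed
  obtain D :: int where D: "D \<noteq> 0" "\<forall>i\<in>S. \<exists>k::int. of_int D * f (lam $ i) = of_int k"
    using integer_multiples [of S "\<lambda>i. f (lam $ i)"] by auto
  then obtain k :: "'n \<Rightarrow> int" where k: "\<And>i. i \<in> S \<Longrightarrow> of_int D * f (lam $ i) = of_int (k i)"
    by metis
  show ?thesis
  proof (intro exI [of _ "lam $ j0 / of_int D"] exI [of _ k] conjI ballI)
    show "lam $ j0 / of_int D \<noteq> 0" using j0 D(1) by simp
    fix i assume i: "i \<in> S"
    have "(of_rat (of_int D * f (lam $ i)) :: complex) = of_rat (of_int (k i))" by (simp only: k [OF i])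
    then have "of_int D * (of_rat (f (lam $ i)) :: complex) = of_int (k i)" by (simp add: of_rat_mult)
    then show "lam $ i = lam $ j0 / of_int D * of_int (k i)"
      using D(1) by (subst ratio [OF i]) (simp add: field_simps)
  qed
qed

section \<open>Absence of small divisors\<close>

text \<open>
  Inverting the homological operator divides by $\langle\alpha,\lambda\rangle-\lambda_i$.  A vector field that
  is proportional to $\lambda\odot y$ in the coordinates of \<open>S\<close> multiplies coefficients by the sum over
  \<open>S\<close> below and by single exponents outside \<open>S\<close>; these factors have to be paid for by the divisor.
\<close>

definition divisors_dominate :: "'n set \<Rightarrow> complex ^ 'n::finite \<Rightarrow> real \<Rightarrow> bool" where
  "divisors_dominate S lam C \<longleftrightarrow> 0 < C \<and> (\<forall>i \<alpha>. weight lam \<alpha> \<noteq> lam $ i \<longrightarrow>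
     1 \<le> C * cmod (weight lam \<alpha> - lam $ i) \<and>
     (\<forall>j. j \<notin> S \<longrightarrow> real (\<alpha> $ j) \<le> C * cmod (weight lam \<alpha> - lam $ i)) \<and>
     cmod (\<Sum>j\<in>S. of_nat (\<alpha> $ j) * lam $ j) \<le> C * cmod (weight lam \<alpha> - lam $ i))"

text \<open>
  The real part of a divisor controls the exponents of the variables outside \<open>S\<close>, and what
  remains is an integer multiple of a single number.  Hence the divisors below any bound form a
  finite set, and the nonzero ones stay away from zero.
\<close>

lemma divisor_bound:
  fixes lam :: "complex ^ 'n::finite"
  assumes re: "\<And>i. i \<in> S \<Longrightarrow> Re (lam $ i) = 0" "\<And>i. i \<notin> S \<Longrightarrow> Re (lam $ i) > 0"
    and \<theta>: "\<theta> \<noteq> 0" and k: "\<And>i. i \<in> S \<Longrightarrow> lam $ i = \<theta> * of_int (k i)"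
  shows "\<exists>C. divisors_dominate S lam C"
proof -
  define M where "M = (\<Sum>j\<in>UNIV. cmod (lam $ j))"
  have lamM: "cmod (lam $ j) \<le> M" for j unfolding M_def by (rule member_le_sum) auto
  have M0: "0 \<le> M" by (simp add: M_def sum_nonneg)
  define m where "m = Min (insert 1 ((\<lambda>j. Re (lam $ j)) ` (- S)))"
  have m0: "m > 0" unfolding m_def using re by (subst Min_gr_iff) auto
  have mle: "m \<le> Re (lam $ j)" if "j \<notin> S" for j unfolding m_def using that by (intro Min_le) auto
  define K where "K \<alpha> = (\<Sum>j\<in>-S. real (\<alpha> $ j))" for \<alpha> :: "nat ^ 'n"
  define a where "a \<alpha> = (\<Sum>j\<in>S. of_nat (\<alpha> $ j) * lam $ j)" for \<alpha> :: "nat ^ 'n"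
  define s where "s \<alpha> = (\<Sum>j\<in>-S. of_nat (\<alpha> $ j) * lam $ j)" for \<alpha> :: "nat ^ 'n"
  define d where "d i \<alpha> = weight lam \<alpha> - lam $ i" for i \<alpha>
  have w: "weight lam \<alpha> = a \<alpha> + s \<alpha>" for \<alpha>
    unfolding weight_def a_def s_def
    by (subst sum.union_disjoint [symmetric]) (auto intro!: sum.cong)
  have K: "m * K \<alpha> \<le> cmod (d i \<alpha>) + M" for i \<alpha>
  proof -
    have "Re (a \<alpha>) = 0" by (simp add: a_def re)
    moreover have "m * K \<alpha> \<le> Re (s \<alpha>)"
      unfolding K_def s_def sum_distrib_left Re_sum
      by (intro sum_mono) (use mle in \<open>auto simp: mult.commute [of m] intro!: mult_left_mono\<close>)
    ultimately have "m * K \<alpha> \<le> Re (d i \<alpha>) + Re (lam $ i)" by (simp add: d_def w)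
    also have "\<dots> \<le> cmod (d i \<alpha>) + M"
      using complex_Re_le_cmod [of "d i \<alpha>"] complex_Re_le_cmod [of "lam $ i"] lamM [of i] by linarith
    finally show ?thesis .
  qed
  have K': "K \<alpha> \<le> (cmod (d i \<alpha>) + M) / m" for i \<alpha>
    using K [of \<alpha> i] m0 by (simp add: field_simps)
  have \<alpha>K: "real (\<alpha> $ j) \<le> K \<alpha>" if "j \<notin> S" for \<alpha> j
    unfolding K_def by (rule member_le_sum) (use that in auto)
  have sK: "cmod (s \<alpha>) \<le> K \<alpha> * M" for \<alpha>
    unfolding s_def K_def sum_distrib_right
    by (rule order.trans [OF norm_sum]) (auto simp: norm_mult intro!: sum_mono mult_left_mono lamM)
  have aK: "cmod (a \<alpha>) \<le> cmod (d i \<alpha>) + K \<alpha> * M + M" for i \<alpha>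
  proof -
    have "a \<alpha> = d i \<alpha> - s \<alpha> + lam $ i" by (simp add: d_def w)
    then have "cmod (a \<alpha>) \<le> cmod (d i \<alpha>) + cmod (s \<alpha>) + cmod (lam $ i)"
      by (metis norm_triangle_ineq norm_triangle_ineq4 add_right_mono order.trans)
    with sK [of \<alpha>] lamM [of i] show ?thesis by linarith
  qed
  \<comment> \<open>The divisors of modulus below one; only finitely many values occur.\<close>
  define E where "E = {z. \<exists>i \<alpha>. z = d i \<alpha> \<and> cmod z < 1}"
  have "finite E"
  proof -
    define b where "b = nat \<lfloor>(1 + M) / m\<rfloor>"
    define L where "L = \<lceil>(1 + (1 + M) / m * M + M) / cmod \<theta>\<rceil>"
    let ?X = "{-L..L} \<times> {\<beta> :: nat ^ 'n. \<forall>j. \<beta> $ j \<le> b} \<times> (UNIV :: 'n set)"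
    have "E \<subseteq> (\<lambda>(n, \<beta>, i). \<theta> * of_int n + s \<beta> - lam $ i) ` ?X"
    proof
      fix z assume "z \<in> E"
      then obtain i \<alpha> where z: "z = d i \<alpha>" "cmod (d i \<alpha>) < 1" by (auto simp: E_def)
      define n where "n = (\<Sum>j\<in>S. int (\<alpha> $ j) * k j)"
      define \<beta> where "\<beta> = (\<chi> j. if j \<in> S then 0 else \<alpha> $ j)"
      have an: "a \<alpha> = \<theta> * of_int n"
        unfolding a_def n_def of_int_sum sum_distrib_left
        by (intro sum.cong refl) (simp add: k)
      have s\<beta>: "s \<beta> = s \<alpha>" unfolding s_def \<beta>_def by (intro sum.cong) auto
      have KM: "K \<alpha> \<le> (1 + M) / m"
        using K' [of \<alpha> i] z(2) m0 by (smt (verit) divide_right_mono)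
      have "\<beta> $ j \<le> b" for j
      proof (cases "j \<in> S")
        case False
        with \<alpha>K [OF False, of \<alpha>] KM show ?thesis by (simp add: \<beta>_def b_def le_nat_floor)
      qed (simp add: \<beta>_def)
      moreover have "\<bar>n\<bar> \<le> L"
      proof -
        have "cmod (a \<alpha>) \<le> 1 + (1 + M) / m * M + M"
          using aK [of \<alpha> i] z(2) mult_right_mono [OF KM M0] by linarith
        then have "cmod \<theta> * \<bar>real_of_int n\<bar> \<le> 1 + (1 + M) / m * M + M"
          by (simp add: an norm_mult)
        then have "\<bar>real_of_int n\<bar> \<le> (1 + (1 + M) / m * M + M) / cmod \<theta>"
          using \<theta> by (simp add: pos_le_divide_eq mult.commute)
        then show ?thesis unfolding L_def by linarith
      qed
      then have "n \<in> {-L..L}" by auto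
      ultimately have "(n, \<beta>, i) \<in> ?X" by auto
      moreover have "z = (\<lambda>(n, \<beta>, i). \<theta> * of_int n + s \<beta> - lam $ i) (n, \<beta>, i)"
        by (simp add: z d_def w an s\<beta>)
      ultimately show "z \<in> (\<lambda>(n, \<beta>, i). \<theta> * of_int n + s \<beta> - lam $ i) ` ?X" by (rule rev_image_eqI)
    qed
    then show ?thesis
      by (rule finite_subset) (intro finite_imageI finite_cartesian_product finite_bounded_vec, auto)
  qed
  define \<epsilon> where "\<epsilon> = Min (insert 1 (cmod ` (E - {0})))"
  have e0: "\<epsilon> > 0" unfolding \<epsilon>_def using \<open>finite E\<close> by (subst Min_gr_iff) auto
  have e1: "\<epsilon> \<le> 1" unfolding \<epsilon>_def using \<open>finite E\<close> by (intro Min_le) auto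
  have de: "\<epsilon> \<le> cmod (d i \<alpha>)" if "weight lam \<alpha> \<noteq> lam $ i" for i \<alpha>
  proof (cases "cmod (d i \<alpha>) < 1")
    case True
    with that have "d i \<alpha> \<in> E - {0}" by (auto simp: E_def d_def)
    then show ?thesis unfolding \<epsilon>_def using \<open>finite E\<close> by (intro Min_le) auto
  qed (use e1 in auto)
  define B where "B = (1 + M / \<epsilon>) / m"
  define C where "C = 1 / \<epsilon> + B + (1 + B * M + M / \<epsilon>)"
  have B0: "0 \<le> B" using M0 e0 m0 by (simp add: B_def)
  have Me: "0 \<le> M / \<epsilon>" "0 \<le> B * M" using M0 e0 B0 by simp_all
  have C: "1 / \<epsilon> \<le> C" "B \<le> C" "1 + B * M + M / \<epsilon> \<le> C" "0 < C"
  proof -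
    have "0 < 1 / \<epsilon>" using e0 by simp
    then show "1 / \<epsilon> \<le> C" "B \<le> C" "1 + B * M + M / \<epsilon> \<le> C" "0 < C"
      unfolding C_def using B0 Me by linarith+
  qed
  show ?thesis
    unfolding divisors_dominate_def
  proof (intro exI conjI allI impI)
    show "0 < C" by (rule C(4))
    fix i \<alpha> assume ne: "weight lam \<alpha> \<noteq> lam $ i"
    let ?D = "cmod (d i \<alpha>)"
    have D: "1 \<le> 1 / \<epsilon> * ?D" using de [OF ne] e0 by (simp add: field_simps)
    have MD: "M \<le> M / \<epsilon> * ?D" using mult_left_mono [OF D M0] by simp
    have KB: "K \<alpha> \<le> B * ?D"
    proof -
      have "K \<alpha> \<le> (?D + M / \<epsilon> * ?D) / m"
        using K' [of \<alpha> i] MD m0 by (smt (verit) divide_right_mono)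
      also have "\<dots> = B * ?D" by (simp add: B_def algebra_simps add_divide_distrib)
      finally show ?thesis .
    qed
    have mono: "x * ?D \<le> C * ?D" if "x \<le> C" for x using that by (intro mult_right_mono) auto
    show "1 \<le> C * cmod (weight lam \<alpha> - lam $ i)"
      using D mono [OF C(1)] by (simp add: d_def)
    show "real (\<alpha> $ j) \<le> C * cmod (weight lam \<alpha> - lam $ i)" if "j \<notin> S" for j
      using \<alpha>K [OF that, of \<alpha>] KB mono [OF C(2)] by (simp add: d_def)
    have "cmod (a \<alpha>) \<le> ?D + B * ?D * M + M / \<epsilon> * ?D"
      using aK [of \<alpha> i] MD mult_right_mono [OF KB M0] by linarith
    also have "\<dots> = (1 + B * M + M / \<epsilon>) * ?D" by (simp add: algebra_simps)
    also have "\<dots> \<le> C * ?D" by (rule mono [OF C(3)])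
    finally show "cmod (\<Sum>j\<in>S. of_nat (\<alpha> $ j) * lam $ j) \<le> C * cmod (weight lam \<alpha> - lam $ i)"
      by (simp add: a_def d_def)
  qed
qed

section \<open>Weighted norms of truncated series\<close>

definition rpow :: "('n \<Rightarrow> real) \<Rightarrow> nat ^ 'n::finite \<Rightarrow> real" where
  "rpow R \<alpha> = (\<Prod>i\<in>UNIV. R i ^ (\<alpha> $ i))"

lemma rpow_0 [simp]: "rpow R 0 = 1"
  by (simp add: rpow_def)

lemma rpow_add: "rpow R (\<alpha> + \<beta>) = rpow R \<alpha> * rpow R \<beta>"
  by (simp add: rpow_def power_add prod.distrib)

lemma rpow_axis [simp]: "rpow R (axis i 1) = R i"
proof -
  have "rpow R (axis i 1) = (\<Prod>j\<in>UNIV. if j = i then R i else 1)"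
    unfolding rpow_def by (rule prod.cong) (auto simp: axis_def)
  then show ?thesis by simp
qed

lemma rpow_nonneg: "(\<And>i. 0 \<le> R i) \<Longrightarrow> 0 \<le> rpow R \<alpha>"
  by (simp add: rpow_def prod_nonneg)

lemma rpow_mono: "(\<And>i. 0 \<le> R i) \<Longrightarrow> (\<And>i. R i \<le> R' i) \<Longrightarrow> rpow R \<alpha> \<le> rpow R' \<alpha>"
  unfolding rpow_def by (intro prod_mono conjI power_mono zero_le_power) auto

lemma rpow_scale: "rpow (\<lambda>i. t * R i) \<alpha> = t ^ mdeg \<alpha> * rpow R \<alpha>"
  by (simp add: rpow_def power_mult_distrib prod.distrib mdeg_def power_sum)

text \<open>
  Truncation keeps the norm finite for formal series; all estimates are uniform in the degree of
  truncation.
\<close>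

definition pnorm :: "nat \<Rightarrow> ('n \<Rightarrow> real) \<Rightarrow> (complex, 'n::finite) mfps \<Rightarrow> real" where
  "pnorm N R f = (\<Sum>\<alpha> | mdeg \<alpha> \<le> N. cmod (mfps_coeff f \<alpha>) * rpow R \<alpha>)"

lemma pnorm_nonneg: "(\<And>i. 0 \<le> R i) \<Longrightarrow> 0 \<le> pnorm N R f"
  unfolding pnorm_def by (intro sum_nonneg mult_nonneg_nonneg rpow_nonneg) auto

lemma pnorm_mono_coeff:
  assumes "\<And>i. 0 \<le> R i" "\<And>\<alpha>. cmod (mfps_coeff f \<alpha>) \<le> c * cmod (mfps_coeff g \<alpha>)"
  shows "pnorm N R f \<le> c * pnorm N R g"
  unfolding pnorm_def sum_distrib_left mult.assoc [symmetric]
  by (intro sum_mono mult_right_mono assms rpow_nonneg)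

lemma pnorm_mono_radius:
  "(\<And>i. 0 \<le> R i) \<Longrightarrow> (\<And>i. R i \<le> R' i) \<Longrightarrow> pnorm N R f \<le> pnorm N R' f"
  unfolding pnorm_def by (intro sum_mono mult_left_mono rpow_mono) auto

lemma pnorm_add:
  assumes "\<And>i. 0 \<le> R i"
  shows "pnorm N R (f + g) \<le> pnorm N R f + pnorm N R g"
  unfolding pnorm_def sum.distrib [symmetric] distrib_right [symmetric]
  by (intro sum_mono mult_right_mono rpow_nonneg assms) (simp add: norm_triangle_ineq)

lemma pnorm_diff:
  assumes "\<And>i. 0 \<le> R i"
  shows "pnorm N R (f - g) \<le> pnorm N R f + pnorm N R g"
  unfolding pnorm_def sum.distrib [symmetric] distrib_right [symmetric]
  by (intro sum_mono mult_right_mono rpow_nonneg assms) (simp add: norm_triangle_ineq4)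

lemma pnorm_0 [simp]: "pnorm N R 0 = 0"
  by (simp add: pnorm_def)

lemma pnorm_sum:
  fixes f :: "'b \<Rightarrow> (complex, 'n::finite) mfps"
  assumes "\<And>i. 0 \<le> R i"
  shows "pnorm N R (\<Sum>x\<in>X. f x) \<le> (\<Sum>x\<in>X. pnorm N R (f x))"
proof (induction X rule: infinite_finite_induct)
  case (insert x X)
  then show ?case using pnorm_add [where R = R and N = N and f = "f x" and g = "\<Sum>x\<in>X. f x"] assms by simp
qed auto

lemma pnorm_const_mult: "pnorm N R (mfps_const c * f) = cmod c * pnorm N R f"
  by (simp add: pnorm_def norm_mult sum_distrib_left mult.assoc)

lemma pnorm_mult_gen:
  fixes f g :: "(complex, 'n::finite) mfps"
  assumes R: "\<And>i. 0 \<le> R i"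
    and deg: "\<And>\<alpha> \<beta>. mdeg (\<alpha> + \<beta>) \<le> M \<Longrightarrow> mfps_coeff f \<alpha> \<noteq> 0 \<Longrightarrow> mfps_coeff g \<beta> \<noteq> 0 \<Longrightarrow> mdeg \<alpha> \<le> N \<and> mdeg \<beta> \<le> N"
  shows "pnorm M R (f * g) \<le> pnorm N R f * pnorm N R g"
proof -
  let ?t = "\<lambda>p :: (nat ^ 'n) \<times> (nat ^ 'n). cmod (mfps_coeff f (fst p)) * rpow R (fst p) * (cmod (mfps_coeff g (snd p)) * rpow R (snd p))"
  let ?U = "\<Union>\<gamma>\<in>{\<gamma>. mdeg \<gamma> \<le> M}. splits \<gamma>"
  let ?D = "{\<alpha> :: nat ^ 'n. mdeg \<alpha> \<le> N}"
  have t0: "0 \<le> ?t p" for p by (intro mult_nonneg_nonneg rpow_nonneg R) auto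
  have "pnorm M R (f * g) \<le> (\<Sum>\<gamma> | mdeg \<gamma> \<le> M. \<Sum>p\<in>splits \<gamma>. ?t p)"
    unfolding pnorm_def
  proof (rule sum_mono)
    fix \<gamma> :: "nat ^ 'n"
    have "cmod (mfps_coeff (f * g) \<gamma>) \<le> (\<Sum>p\<in>splits \<gamma>. cmod (mfps_coeff f (fst p)) * cmod (mfps_coeff g (snd p)))"
      unfolding mfps_coeff_mult case_prod_unfold
      by (rule order.trans [OF norm_sum]) (simp add: norm_mult)
    then have "cmod (mfps_coeff (f * g) \<gamma>) * rpow R \<gamma> \<le>
        (\<Sum>p\<in>splits \<gamma>. cmod (mfps_coeff f (fst p)) * cmod (mfps_coeff g (snd p))) * rpow R \<gamma>"
      by (intro mult_right_mono rpow_nonneg R)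
    also have "\<dots> = (\<Sum>p\<in>splits \<gamma>. ?t p)"
      unfolding sum_distrib_right by (intro sum.cong refl) (auto simp: splits_def rpow_add)
    finally show "cmod (mfps_coeff (f * g) \<gamma>) * rpow R \<gamma> \<le> (\<Sum>p\<in>splits \<gamma>. ?t p)" .
  qed
  also have "\<dots> = (\<Sum>p\<in>?U. ?t p)"
    by (rule sum.UNION_disjoint [symmetric]) (simp_all, auto simp: splits_def)
  also have "\<dots> = (\<Sum>p\<in>?U \<inter> ?D \<times> ?D. ?t p)"
  proof (rule sum.mono_neutral_right)
    show "\<forall>p\<in>?U - ?U \<inter> ?D \<times> ?D. ?t p = 0"
    proof
      fix p assume p: "p \<in> ?U - ?U \<inter> ?D \<times> ?D"
      then have "mdeg (fst p + snd p) \<le> M" "\<not> (mdeg (fst p) \<le> N \<and> mdeg (snd p) \<le> N)"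
        by (auto simp: splits_def)
      with deg [of "fst p" "snd p"] show "?t p = 0" by auto
    qed
  qed auto
  also have "\<dots> \<le> (\<Sum>p\<in>?D \<times> ?D. ?t p)"
    by (rule sum_mono2) (use t0 in auto)
  also have "\<dots> = pnorm N R f * pnorm N R g"
    by (simp add: pnorm_def sum_product sum.cartesian_product case_prod_unfold)
  finally show ?thesis .
qed

lemma pnorm_mult: "(\<And>i. 0 \<le> R i) \<Longrightarrow> pnorm N R (f * g) \<le> pnorm N R f * pnorm N R g"
  by (rule pnorm_mult_gen) auto

text \<open>
  Gaining one degree: if neither factor has a constant term, coefficients of degree \<open>N + 1\<close> of
  the product only involve coefficients of the factors up to degree \<open>N\<close>.
\<close>

lemma pnorm_mult_Suc:
  assumes "\<And>i. 0 \<le> R i" "order_at_least 1 f" "order_at_least 1 g"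
  shows "pnorm (N + 1) R (f * g) \<le> pnorm N R f * pnorm N R g"
proof (rule pnorm_mult_gen [OF assms(1)])
  fix \<alpha> \<beta> assume "mdeg (\<alpha> + \<beta>) \<le> N + 1" "mfps_coeff f \<alpha> \<noteq> 0" "mfps_coeff g \<beta> \<noteq> 0"
  moreover from this have "\<not> mdeg \<alpha> < 1" "\<not> mdeg \<beta> < 1"
    using assms(2,3) by (auto simp: order_at_least_def)
  ultimately show "mdeg \<alpha> \<le> N \<and> mdeg \<beta> \<le> N" by (simp only: mdeg_add) arith
qed

lemma pnorm_var_mult:
  assumes "\<And>i. 0 \<le> R i"
  shows "R i * pnorm N R f \<le> pnorm (N + 1) R (mfps_var i * f)"
proof -
  have "R i * pnorm N R f = (\<Sum>\<alpha> | mdeg \<alpha> \<le> N. cmod (mfps_coeff (mfps_var i * f) (\<alpha> + axis i 1)) * rpow R (\<alpha> + axis i 1))"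
    unfolding coeff_var_mult_Suc by (simp add: pnorm_def sum_distrib_left rpow_add mult_ac)
  also have "\<dots> = (\<Sum>\<gamma>\<in>(\<lambda>\<alpha>. \<alpha> + axis i 1) ` {\<alpha>. mdeg \<alpha> \<le> N}. cmod (mfps_coeff (mfps_var i * f) \<gamma>) * rpow R \<gamma>)"
    by (rule sum.reindex [symmetric, unfolded o_def]) (auto simp: inj_on_def)
  also have "\<dots> \<le> pnorm (N + 1) R (mfps_var i * f)"
    unfolding pnorm_def by (rule sum_mono2) (auto intro!: mult_nonneg_nonneg rpow_nonneg assms)
  finally show ?thesis .
qed

lemma pnorm_one: "pnorm N R 1 = 1"
proof -
  have "pnorm N R 1 = (\<Sum>\<alpha>\<in>{0}. cmod (mfps_coeff 1 \<alpha>) * rpow R \<alpha>)"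
    unfolding pnorm_def by (rule sum.mono_neutral_right) (auto simp: mfps_coeff_1)
  then show ?thesis by (simp add: mfps_coeff_1)
qed

lemma pnorm_var: "(\<And>i. 0 \<le> R i) \<Longrightarrow> pnorm N R (mfps_var i) \<le> R i"
proof -
  assume R: "\<And>i. 0 \<le> R i"
  have "pnorm N R (mfps_var i) = (\<Sum>\<alpha>\<in>{\<alpha>. mdeg \<alpha> \<le> N} \<inter> {axis i 1}. cmod (mfps_coeff (mfps_var i) \<alpha>) * rpow R \<alpha>)"
    unfolding pnorm_def by (rule sum.mono_neutral_right) (auto simp: coeff_var)
  also have "\<dots> \<le> (\<Sum>\<alpha>\<in>{axis i 1}. cmod (mfps_coeff (mfps_var i) \<alpha>) * rpow R \<alpha>)"
    by (rule sum_mono2) (auto intro!: mult_nonneg_nonneg rpow_nonneg R)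
  finally show ?thesis by (simp add: coeff_var)
qed

lemma pnorm_vpow:
  assumes "\<And>i. 0 \<le> R i"
  shows "pnorm N R (vpow H \<alpha>) \<le> rpow (\<lambda>i. pnorm N R (H $ i)) \<alpha>"
proof (induction \<alpha> rule: exponent_induct)
  case (step \<alpha> i)
  have "pnorm N R (vpow H \<alpha> * H $ i) \<le> pnorm N R (vpow H \<alpha>) * pnorm N R (H $ i)"
    by (rule pnorm_mult) (rule assms)
  also have "\<dots> \<le> rpow (\<lambda>i. pnorm N R (H $ i)) \<alpha> * pnorm N R (H $ i)"
    by (intro mult_right_mono step pnorm_nonneg assms)
  finally show ?case by (simp add: vpow_add rpow_add)
qed (simp add: pnorm_one)

lemma pnorm_compose:
  fixes f :: "(complex, 'n::finite) mfps" and H :: "(complex, 'm::finite) mfps ^ 'n"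
  assumes R: "\<And>i. 0 \<le> R i" and H: "\<And>i. order_at_least 1 (H $ i)"
  shows "pnorm N R (mfps_compose f H) \<le> pnorm N (\<lambda>i. pnorm N R (H $ i)) f"
proof -
  have "pnorm N R (mfps_compose f H) =
      pnorm N R (\<Sum>\<alpha> | mdeg \<alpha> \<le> N. mfps_const (mfps_coeff f \<alpha>) * vpow H \<alpha>)"
    unfolding pnorm_def by (intro sum.cong refl) (simp add: coeff_compose [OF H])
  also have "\<dots> \<le> (\<Sum>\<alpha> | mdeg \<alpha> \<le> N. cmod (mfps_coeff f \<alpha>) * pnorm N R (vpow H \<alpha>))"
    using pnorm_sum [OF R] unfolding pnorm_const_mult [symmetric] .
  also have "\<dots> \<le> pnorm N (\<lambda>i. pnorm N R (H $ i)) f"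
    unfolding pnorm_def [of N "\<lambda>i. pnorm N R (H $ i)" f]
    by (intro sum_mono mult_left_mono pnorm_vpow R) auto
  finally show ?thesis .
qed

text \<open>Shrinking the radii by a factor \<open>t\<close> gains one power of \<open>t\<close> per degree.\<close>

lemma pnorm_order_2:
  assumes R: "\<And>i. 0 \<le> R i" "\<And>i. R i \<le> t * \<eta>" and t: "0 \<le> t" "t \<le> 1" and \<eta>: "0 \<le> \<eta>" and f: "order_at_least 2 f"
  shows "pnorm N R f \<le> t\<^sup>2 * pnorm N (\<lambda>_. \<eta>) f"
  unfolding pnorm_def sum_distrib_left
proof (rule sum_mono)
  fix \<alpha> :: "nat ^ 'a"
  show "cmod (mfps_coeff f \<alpha>) * rpow R \<alpha> \<le> t\<^sup>2 * (cmod (mfps_coeff f \<alpha>) * rpow (\<lambda>_. \<eta>) \<alpha>)"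
  proof (cases "mdeg \<alpha> < 2")
    case True
    then show ?thesis using f by (simp add: order_at_least_def)
  next
    case False
    have "rpow R \<alpha> \<le> t ^ mdeg \<alpha> * rpow (\<lambda>_. \<eta>) \<alpha>"
      unfolding rpow_scale [symmetric] by (rule rpow_mono [OF R])
    also have "\<dots> \<le> t\<^sup>2 * rpow (\<lambda>_. \<eta>) \<alpha>"
      using False t by (intro mult_right_mono power_decreasing rpow_nonneg \<eta>) auto
    finally show ?thesis by (simp add: mult_left_mono mult.left_commute)
  qed
qed

section \<open>Convergence and bounded norms\<close>

lemma convergent_of_pnorm_bounded:
  fixes f :: "(complex, 'n::finite) mfps"
  assumes R: "\<And>i. 0 < R i" and B: "\<And>N. pnorm N R f \<le> B"
  shows "convergent_mfps f"
proof -
  define r where "r = Min (range R)"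
  have r: "0 < r" "\<And>i. r \<le> R i" using R by (auto simp: r_def)
  have "mfps_term f x summable_on UNIV" if x: "x \<in> ball 0 r" for x
  proof (rule abs_summable_summable, rule nonneg_bdd_above_summable_on)
    show "bdd_above (sum (\<lambda>\<alpha>. norm (mfps_term f x \<alpha>)) ` {F. F \<subseteq> UNIV \<and> finite F})"
    proof (rule bdd_aboveI2)
      fix F :: "(nat ^ 'n) set" assume "F \<in> {F. F \<subseteq> UNIV \<and> finite F}"
      then have F: "finite F" by simp
      define N where "N = Max (insert 0 (mdeg ` F))"
      have N: "F \<subseteq> {\<alpha>. mdeg \<alpha> \<le> N}" using F by (auto simp: N_def intro!: Max_ge)
      have "cmod (x $ i) \<le> R i" for i
      proof -
        have "cmod (x $ i) \<le> norm x" by (rule Finite_Cartesian_Product.norm_nth_le)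
        with x r(2) [of i] show ?thesis by simp
      qed
      then have "norm (mfps_term f x \<alpha>) \<le> cmod (mfps_coeff f \<alpha>) * rpow R \<alpha>" for \<alpha>
        using rpow_mono [of "\<lambda>i. cmod (x $ i)" R \<alpha>]
        by (simp add: mfps_term_def norm_mult prod_norm [symmetric] norm_power rpow_def mult_left_mono)
      then have "(\<Sum>\<alpha>\<in>F. norm (mfps_term f x \<alpha>)) \<le> (\<Sum>\<alpha>\<in>F. cmod (mfps_coeff f \<alpha>) * rpow R \<alpha>)"
        by (intro sum_mono)
      also have "\<dots> \<le> pnorm N R f"
        unfolding pnorm_def
        by (rule sum_mono2 [OF _ N]) (auto intro!: mult_nonneg_nonneg rpow_nonneg less_imp_le [OF R])
      also have "\<dots> \<le> B" by (rule B)
      finally show "(\<Sum>\<alpha>\<in>F. norm (mfps_term f x \<alpha>)) \<le> B" .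
    qed
  qed auto
  then show ?thesis
    unfolding convergent_mfps_def eventually_nhds
    using r(1) by (intro exI [of _ "ball 0 r"]) auto
qed

lemma pnorm_bounded_of_power_series:
  fixes P :: "(complex, 'n::finite) mfps ^ 'm::finite"
  assumes "has_power_series_at_0 F P"
  obtains \<eta> K where "0 < \<eta>" "0 \<le> K" "\<And>i N. pnorm N (\<lambda>_. \<eta>) (P $ i) \<le> K"
proof -
  obtain e where e: "0 < e" "\<And>x i. dist x 0 < e \<Longrightarrow> (mfps_term (P $ i) x has_sum F x $ i) UNIV"
    using assms unfolding has_power_series_at_0_def eventually_nhds_metric by metis
  define \<eta> where "\<eta> = e / (2 * real CARD('n))"
  define x :: "complex ^ 'n" where "x = (\<chi> i. of_real \<eta>)"
  have n: "real CARD('n) > 0" by simp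
  have \<eta>: "\<eta> > 0" using e(1) by (simp add: \<eta>_def)
  have "norm x \<le> (\<Sum>i\<in>UNIV. norm (x $ i))" unfolding norm_vec_def by (rule L2_set_le_sum) simp
  also have "\<dots> = real CARD('n) * \<eta>" using \<eta> by (simp add: x_def)
  also have "\<dots> < e" using n e(1) by (simp add: \<eta>_def)
  finally have "dist x 0 < e" by simp
  from e(2) [OF this] have "mfps_term (P $ i) x summable_on UNIV" for i by (rule has_sum_imp_summable)
  then have s: "(\<lambda>\<alpha>. norm (mfps_term (P $ i) x \<alpha>)) summable_on UNIV" for i
    by (simp add: summable_on_iff_abs_summable_on_complex)
  define k where "k i = (\<Sum>\<^sub>\<infinity>\<alpha>. norm (mfps_term (P $ i) x \<alpha>))" for i
  have k0: "0 \<le> k i" for i unfolding k_def by (rule infsum_nonneg) auto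
  show ?thesis
  proof (rule that [of \<eta> "\<Sum>i\<in>UNIV. k i"])
    fix i N
    have "norm (mfps_term (P $ i) x \<alpha>) = cmod (mfps_coeff (P $ i) \<alpha>) * rpow (\<lambda>_. \<eta>) \<alpha>" for \<alpha>
      using \<eta> by (simp add: mfps_term_def norm_mult prod_norm [symmetric] norm_power rpow_def x_def)
    then have "pnorm N (\<lambda>_. \<eta>) (P $ i) = (\<Sum>\<alpha> | mdeg \<alpha> \<le> N. norm (mfps_term (P $ i) x \<alpha>))"
      by (simp add: pnorm_def)
    also have "\<dots> \<le> k i" unfolding k_def by (rule finite_sum_le_infsum [OF s]) auto
    also have "\<dots> \<le> (\<Sum>i\<in>UNIV. k i)" by (rule member_le_sum) (auto simp: k0)
    finally show "pnorm N (\<lambda>_. \<eta>) (P $ i) \<le> (\<Sum>i\<in>UNIV. k i)" .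
  qed (auto simp: \<eta> k0 sum_nonneg)
qed

section \<open>The majorant estimate\<close>

text \<open>
  The facts about a formal transformation $y + h$ to a normal form $\lambda\odot y + Ny + g$ from which
  its convergence follows.  The assumption \<open>central\<close> says that the normal form is proportional to
  $\lambda\odot y$ in the coordinates of \<open>S\<close>.
\<close>

locale formal_conjugation =
  fixes lam :: "complex ^ 'n::finite" and N :: "complex ^ 'n ^ 'n" and X h g :: "'n fvec"
    and S :: "'n set" and j0 :: 'n and C :: real
  assumes N_res: "\<And>i j. N $ i $ j \<noteq> 0 \<Longrightarrow> lam $ j = lam $ i"
    and X2: "\<And>i. order_at_least 2 (X $ i)"
    and h2: "\<And>i. order_at_least 2 (h $ i)" and g2: "\<And>i. order_at_least 2 (g $ i)"
    and h_nonres: "\<And>i \<alpha>. mfps_coeff (h $ i) \<alpha> \<noteq> 0 \<Longrightarrow> weight lam \<alpha> \<noteq> lam $ i"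
    and g_res: "\<And>i \<alpha>. mfps_coeff (g $ i) \<alpha> \<noteq> 0 \<Longrightarrow> weight lam \<alpha> = lam $ i"
    and eq: "\<And>i \<alpha>. (weight lam \<alpha> - lam $ i) * mfps_coeff (h $ i) \<alpha> + mfps_coeff (g $ i) \<alpha> =
       mfps_coeff (homological_rhs N X h g i) \<alpha>"
    and j0: "j0 \<in> S" "lam $ j0 \<noteq> 0"
    and central: "\<And>i j. i \<in> S \<Longrightarrow> j \<in> S \<Longrightarrow>
       diagonal_field lam $ i * (linear_field N + g) $ j = diagonal_field lam $ j * (linear_field N + g) $ i"
    and dominate: "divisors_dominate S lam C"
begin

lemma C:
  shows "0 < C"
    "\<And>i \<alpha>. weight lam \<alpha> \<noteq> lam $ i \<Longrightarrow> 1 \<le> C * cmod (weight lam \<alpha> - lam $ i)"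
    "\<And>i \<alpha> j. weight lam \<alpha> \<noteq> lam $ i \<Longrightarrow> j \<notin> S \<Longrightarrow> real (\<alpha> $ j) \<le> C * cmod (weight lam \<alpha> - lam $ i)"
    "\<And>i \<alpha>. weight lam \<alpha> \<noteq> lam $ i \<Longrightarrow>
      cmod (\<Sum>j\<in>S. of_nat (\<alpha> $ j) * lam $ j) \<le> C * cmod (weight lam \<alpha> - lam $ i)"
  using dominate by (auto simp: divisors_dominate_def)

text \<open>
  Multiplying the coefficients of \<open>h\<close> by their divisors gives the quantity that the homological
  equation controls; the coefficients of \<open>h\<close> and of its relevant derivatives are bounded by it.
\<close>

definition scaled :: "'n \<Rightarrow> (complex, 'n) mfps" where
  "scaled i = Abs_mfps (\<lambda>\<alpha>. (weight lam \<alpha> - lam $ i) * mfps_coeff (h $ i) \<alpha>)"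

definition perturbation :: "'n fvec" where
  "perturbation = linear_field N + g"

text \<open>
  Dividing by the radii makes the size of \<open>h\<close> dimensionless: it compares each component of the
  transformation with that of the identity.
\<close>

definition radial_size :: "nat \<Rightarrow> ('n \<Rightarrow> real) \<Rightarrow> real" where
  "radial_size M R = (\<Sum>i\<in>UNIV. pnorm M R (scaled i) / R i)"

definition off_diagonal :: real where
  "off_diagonal = (\<Sum>i\<in>UNIV. \<Sum>j\<in>UNIV. cmod (N $ i $ j))"

definition lie_factor :: real where
  "lie_factor = (1 / cmod (lam $ j0) + real CARD('n)) * C"

lemma coeff_scaled: "mfps_coeff (scaled i) \<alpha> = (weight lam \<alpha> - lam $ i) * mfps_coeff (h $ i) \<alpha>"
  by (simp add: scaled_def)

lemma lie_factor_nonneg: "0 \<le> lie_factor"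
  using C(1) by (simp add: lie_factor_def)

lemma off_diagonal_nonneg: "0 \<le> off_diagonal"
  by (simp add: off_diagonal_def sum_nonneg)

lemma row_le_off_diagonal: "(\<Sum>j\<in>UNIV. cmod (N $ i $ j)) \<le> off_diagonal"
  unfolding off_diagonal_def by (rule member_le_sum [of i UNIV "\<lambda>i. \<Sum>j\<in>UNIV. cmod (N $ i $ j)"]) (auto intro: sum_nonneg)

lemma column_le_off_diagonal: "(\<Sum>i\<in>UNIV. cmod (N $ i $ j)) \<le> off_diagonal"
  unfolding off_diagonal_def by (intro sum_mono member_le_sum) auto

lemma perturbation_res: "mfps_coeff (perturbation $ j) \<gamma> \<noteq> 0 \<Longrightarrow> weight lam \<gamma> = lam $ j"
proof -
  assume nz: "mfps_coeff (perturbation $ j) \<gamma> \<noteq> 0"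
  show "weight lam \<gamma> = lam $ j"
  proof (cases "mfps_coeff (g $ j) \<gamma> = 0")
    case True
    with nz have "(\<Sum>k\<in>UNIV. N $ j $ k * mfps_coeff (mfps_var k) \<gamma>) \<noteq> 0"
      by (simp add: perturbation_def linear_field_def)
    then obtain k where "N $ j $ k * mfps_coeff (mfps_var k) \<gamma> \<noteq> 0" by (meson sum.not_neutral_contains_not_neutral)
    then have "N $ j $ k \<noteq> 0" "\<gamma> = axis k 1" by (auto simp: coeff_var split: if_splits)
    with N_res [of j k] show ?thesis by simp
  qed (rule g_res)
qed

lemma order_perturbation: "order_at_least 1 (perturbation $ j)"
  unfolding perturbation_def vector_add_component
  by (intro order_add order_linear_field order_mono [OF g2]) simp

lemma order_h: "order_at_least 1 (h $ i)"
  by (rule order_mono [OF h2]) simp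

text \<open>
  At a resonant exponent the terms $Nh$ and $Dh\,(Ny+g)$ of the homological equation vanish, because
  a normal form preserves weights and \<open>h\<close> is nonresonant.  Only $X(y+h)$ contributes to \<open>g\<close>.
\<close>

lemma g_bound: "cmod (mfps_coeff (g $ i) \<alpha>) \<le> cmod (mfps_coeff (mfps_compose (X $ i) (vars + h)) \<alpha>)"
proof (cases "weight lam \<alpha> = lam $ i")
  case True
  have hz: "mfps_coeff (h $ i) \<beta> = 0" if "weight lam \<beta> = weight lam \<alpha>" for \<beta>
    using h_nonres [of i \<beta>] True that by metis
  have "N $ i $ j * mfps_coeff (h $ j) \<alpha> = 0" for j
    using h_nonres [of j \<alpha>] N_res [of i j] True by (cases "N $ i $ j = 0") auto
  then have "(\<Sum>j\<in>UNIV. N $ i $ j * mfps_coeff (h $ j) \<alpha>) = 0" by (simp only: sum.neutral_const)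
  moreover have "mfps_coeff (lie (linear_field N + g) (h $ i)) \<alpha> = 0"
    by (rule coeff_lie_resonant_eq_0 [of _ lam]) (use perturbation_res hz in \<open>auto simp: perturbation_def\<close>)
  ultimately show ?thesis using eq [of \<alpha> i] True by (simp add: homological_rhs_def)
next
  case False
  then have "mfps_coeff (g $ i) \<alpha> = 0" using g_res [of i \<alpha>] by auto
  then show ?thesis by simp
qed

lemma scaled_bound: "cmod (mfps_coeff (scaled i) \<alpha>) \<le> cmod (mfps_coeff (homological_rhs N X h g i) \<alpha>)"
proof (cases "weight lam \<alpha> = lam $ i")
  case False
  then have "mfps_coeff (g $ i) \<alpha> = 0" using g_res [of i \<alpha>] by auto
  then show ?thesis using eq [of \<alpha> i] by (simp add: coeff_scaled)
qed (simp add: coeff_scaled)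

lemma divided_bound:
  assumes "\<And>\<alpha>. weight lam \<alpha> \<noteq> lam $ i \<Longrightarrow> cmod (b \<alpha>) \<le> C * cmod (weight lam \<alpha> - lam $ i)"
  shows "cmod (b \<alpha> * mfps_coeff (h $ i) \<alpha>) \<le> C * cmod (mfps_coeff (scaled i) \<alpha>)"
proof (cases "mfps_coeff (h $ i) \<alpha> = 0")
  case False
  from mult_right_mono [OF assms [OF h_nonres [OF False]], of "cmod (mfps_coeff (h $ i) \<alpha>)"]
  show ?thesis by (simp add: coeff_scaled norm_mult mult.assoc)
qed (use C(1) in \<open>simp add: coeff_scaled\<close>)

context
  fixes R :: "'n \<Rightarrow> real" and M :: nat
  assumes R: "\<And>i. 0 < R i"
begin

lemma R0: "0 \<le> R i"
  using R [of i] by simp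

lemma pnorm_h: "pnorm M R (h $ i) \<le> C * pnorm M R (scaled i)"
proof (rule pnorm_mono_coeff [OF R0])
  show "cmod (mfps_coeff (h $ i) \<alpha>) \<le> C * cmod (mfps_coeff (scaled i) \<alpha>)" for \<alpha>
    using divided_bound [of i "\<lambda>_. 1" \<alpha>] C(2) by simp
qed

lemma pnorm_scaled_le: "pnorm M R (scaled i) \<le> radial_size M R * R i"
proof -
  have "pnorm M R (scaled i) / R i \<le> radial_size M R"
    unfolding radial_size_def
    by (rule member_le_sum) (auto intro!: divide_nonneg_nonneg pnorm_nonneg R0)
  then show ?thesis using R [of i] by (simp add: divide_le_eq)
qed

text \<open>
  The derivative of \<open>h\<close> along the perturbation costs no more than the divisors pay for.
  Outside \<open>S\<close> this is the bound on single exponents.  The components in \<open>S\<close> are proportional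
  to those of $\lambda\odot y$, so together they act through the operator
  $\sum_{j\in S}\lambda_j y_j\partial_j$, whose eigenvalues are bounded by the divisors as well.
\<close>

lemma pnorm_lie:
  assumes \<tau>: "\<And>j. pnorm M R (perturbation $ j) \<le> \<tau> * R j" "0 \<le> \<tau>"
  shows "pnorm M R (lie perturbation (h $ i)) \<le> lie_factor * \<tau> * pnorm M R (scaled i)"
proof -
  let ?p = "pnorm M R (scaled i)"
  have p0: "0 \<le> ?p" by (rule pnorm_nonneg) (rule R0)
  define Z where "Z = (\<Sum>j\<in>S. mfps_deriv j (h $ i) * perturbation $ j)"
  define W where "W = (\<Sum>j\<in>S. mfps_const (lam $ j) * euler j (h $ i))"
  have split: "lie perturbation (h $ i) = Z + (\<Sum>j\<in>-S. mfps_deriv j (h $ i) * perturbation $ j)"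
    unfolding lie_def Z_def by (subst sum.union_disjoint [symmetric]) (auto intro!: sum.cong)
  \<comment> \<open>Multiplying by the variable turns the derivative into the Euler operator, which keeps degrees.\<close>
  have out: "pnorm M R (mfps_deriv j (h $ i) * perturbation $ j) \<le> C * ?p * \<tau>" if "j \<notin> S" for j
  proof -
    have "R j * pnorm M R (mfps_deriv j (h $ i) * perturbation $ j) \<le>
        pnorm (M + 1) R (mfps_var j * (mfps_deriv j (h $ i) * perturbation $ j))"
      by (rule pnorm_var_mult) (rule R0)
    also have "\<dots> = pnorm (M + 1) R (euler j (h $ i) * perturbation $ j)"
      by (simp add: euler_eq mult.assoc)
    also have "\<dots> \<le> pnorm M R (euler j (h $ i)) * pnorm M R (perturbation $ j)"
    proof (rule pnorm_mult_Suc [OF R0 _ order_perturbation])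
      show "order_at_least 1 (euler j (h $ i))"
        using order_h [of i] by (simp add: order_at_least_def coeff_euler)
    qed
    also have "\<dots> \<le> (C * ?p) * (\<tau> * R j)"
    proof (intro mult_mono \<tau>(1) pnorm_nonneg R0)
      show "pnorm M R (euler j (h $ i)) \<le> C * ?p"
      proof (rule pnorm_mono_coeff [OF R0])
        show "cmod (mfps_coeff (euler j (h $ i)) \<alpha>) \<le> C * cmod (mfps_coeff (scaled i) \<alpha>)" for \<alpha>
          unfolding coeff_euler by (rule divided_bound) (use C(3) that in simp)
      qed
      show "0 \<le> C * ?p" using C(1) p0 by simp
    qed
    finally have "R j * pnorm M R (mfps_deriv j (h $ i) * perturbation $ j) \<le> R j * (C * ?p * \<tau>)"
      by (simp add: mult_ac)
    then show ?thesis using R [of j] by simp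
  qed
  \<comment> \<open>Proportionality in \<open>S\<close>, multiplied out so that no component need be divided by \<open>mfps_var j0\<close>.\<close>
  have "diagonal_field lam $ j0 * Z = perturbation $ j0 * W"
  proof -
    have "diagonal_field lam $ j0 * Z =
        (\<Sum>j\<in>S. mfps_deriv j (h $ i) * (diagonal_field lam $ j0 * perturbation $ j))"
      by (simp add: Z_def sum_distrib_left mult_ac)
    also have "\<dots> = (\<Sum>j\<in>S. mfps_deriv j (h $ i) * (diagonal_field lam $ j * perturbation $ j0))"
      using central [OF j0(1)] by (simp add: perturbation_def)
    also have "\<dots> = perturbation $ j0 * W"
      by (simp add: W_def diagonal_field_def euler_eq sum_distrib_left mult_ac)
    finally show ?thesis .
  qed
  then have ZW: "mfps_const (lam $ j0) * (mfps_var j0 * Z) = perturbation $ j0 * W"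
    by (simp add: diagonal_field_def mult.assoc)
  have "cmod (lam $ j0) * (R j0 * pnorm M R Z) \<le> cmod (lam $ j0) * pnorm (M + 1) R (mfps_var j0 * Z)"
    by (intro mult_left_mono pnorm_var_mult R0) simp
  also have "\<dots> = pnorm (M + 1) R (perturbation $ j0 * W)"
    by (simp only: ZW [symmetric] pnorm_const_mult)
  also have "\<dots> \<le> pnorm M R (perturbation $ j0) * pnorm M R W"
  proof (rule pnorm_mult_Suc [OF R0 order_perturbation])
    show "order_at_least 1 W"
      using order_h [of i] by (simp add: order_at_least_def coeff_euler W_def)
  qed
  also have "\<dots> \<le> (\<tau> * R j0) * (C * ?p)"
  proof (intro mult_mono \<tau>(1) pnorm_nonneg R0 mult_nonneg_nonneg \<tau>(2))
    show "pnorm M R W \<le> C * ?p"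
    proof (rule pnorm_mono_coeff [OF R0])
      fix \<alpha>
      have "mfps_coeff W \<alpha> = (\<Sum>j\<in>S. of_nat (\<alpha> $ j) * lam $ j) * mfps_coeff (h $ i) \<alpha>"
        unfolding sum_distrib_right by (simp add: W_def coeff_euler mult_ac)
      then show "cmod (mfps_coeff W \<alpha>) \<le> C * cmod (mfps_coeff (scaled i) \<alpha>)"
        using divided_bound [of i "\<lambda>\<alpha>. \<Sum>j\<in>S. of_nat (\<alpha> $ j) * lam $ j" \<alpha>] C(4) by simp
    qed
  qed
  finally have "R j0 * (cmod (lam $ j0) * pnorm M R Z) \<le> R j0 * (C * ?p * \<tau>)" by (simp add: mult_ac)
  then have "cmod (lam $ j0) * pnorm M R Z \<le> C * ?p * \<tau>" using R [of j0] by simp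
  then have Z: "pnorm M R Z \<le> 1 / cmod (lam $ j0) * (C * ?p * \<tau>)"
    using j0(2) by (simp add: field_simps)
  have "pnorm M R (lie perturbation (h $ i)) \<le>
      pnorm M R Z + pnorm M R (\<Sum>j\<in>-S. mfps_deriv j (h $ i) * perturbation $ j)"
    unfolding split by (rule pnorm_add) (rule R0)
  also have "pnorm M R (\<Sum>j\<in>-S. mfps_deriv j (h $ i) * perturbation $ j) \<le>
      (\<Sum>j\<in>-S. pnorm M R (mfps_deriv j (h $ i) * perturbation $ j))"
    by (rule pnorm_sum) (rule R0)
  also have "\<dots> \<le> (\<Sum>j\<in>-S. C * ?p * \<tau>)" by (rule sum_mono) (use out in auto)
  also have "\<dots> \<le> (\<Sum>j\<in>(UNIV :: 'n set). C * ?p * \<tau>)"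
    by (rule sum_mono2) (use C(1) p0 \<tau>(2) in auto)
  also have "\<dots> = real CARD('n) * (C * ?p * \<tau>)" by simp
  finally have "pnorm M R (lie perturbation (h $ i)) \<le>
      1 / cmod (lam $ j0) * (C * ?p * \<tau>) + real CARD('n) * (C * ?p * \<tau>)"
    using Z by linarith
  then show ?thesis by (simp add: lie_factor_def algebra_simps)
qed

text \<open>
  Here $\delta$ measures the ratio of radii across entries of \<open>N\<close>, hence the effective size of the
  nilpotent part, and \<open>x\<close> the nonlinear part $X(y+h)$.
\<close>

lemma radial_size_estimate:
  assumes \<delta>: "\<And>i j. N $ i $ j \<noteq> 0 \<Longrightarrow> R j \<le> \<delta> * R i" "0 \<le> \<delta>"
    and x: "\<And>i. pnorm M R (mfps_compose (X $ i) (vars + h)) \<le> x * R i" "0 \<le> x"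
  shows "radial_size M R \<le> real CARD('n) * x + (\<delta> * off_diagonal * C + lie_factor * (\<delta> * off_diagonal + x)) * radial_size M R"
proof -
  let ?p = "\<lambda>i. pnorm M R (scaled i)"
  have p0: "0 \<le> ?p i" for i by (rule pnorm_nonneg) (rule R0)
  have NR: "cmod (N $ i $ j) * R j \<le> cmod (N $ i $ j) * (\<delta> * R i)" for i j
    using \<delta>(1) [of i j] by (cases "N $ i $ j = 0") (auto intro: mult_left_mono)
  have \<tau>: "pnorm M R (perturbation $ j) \<le> (\<delta> * off_diagonal + x) * R j" for j
  proof -
    have "pnorm M R (perturbation $ j) \<le> pnorm M R (linear_field N $ j) + pnorm M R (g $ j)"
      unfolding perturbation_def vector_add_component by (rule pnorm_add) (rule R0)
    moreover have "pnorm M R (g $ j) \<le> 1 * pnorm M R (mfps_compose (X $ j) (vars + h))"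
      by (rule pnorm_mono_coeff [OF R0]) (simp add: g_bound)
    moreover have "pnorm M R (linear_field N $ j) \<le> \<delta> * off_diagonal * R j"
    proof -
      have "pnorm M R (linear_field N $ j) \<le> (\<Sum>k\<in>UNIV. cmod (N $ j $ k) * pnorm M R (mfps_var k))"
        unfolding linear_field_def pnorm_const_mult [symmetric] vec_lambda_beta
        by (rule pnorm_sum) (rule R0)
      also have "\<dots> \<le> (\<Sum>k\<in>UNIV. cmod (N $ j $ k) * R k)"
        by (intro sum_mono mult_left_mono pnorm_var R0) simp
      also have "\<dots> \<le> (\<Sum>k\<in>UNIV. cmod (N $ j $ k) * (\<delta> * R j))" by (intro sum_mono NR)
      also have "\<dots> = (\<Sum>k\<in>UNIV. cmod (N $ j $ k)) * (\<delta> * R j)" by (simp add: sum_distrib_right)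
      also have "\<dots> \<le> off_diagonal * (\<delta> * R j)"
        using \<delta>(2) R0 by (intro mult_right_mono row_le_off_diagonal) auto
      finally show ?thesis by (simp add: mult_ac)
    qed
    ultimately show ?thesis using x(1) [of j] by (simp add: distrib_right)
  qed
  have \<tau>0: "0 \<le> \<delta> * off_diagonal + x" using \<delta>(2) x(2) off_diagonal_nonneg by simp
  have comp: "?p i / R i \<le> x + \<delta> * C * (\<Sum>j\<in>UNIV. cmod (N $ i $ j) * (?p j / R j)) + lie_factor * (\<delta> * off_diagonal + x) * (?p i / R i)" for i
  proof -
    have "?p i \<le> 1 * pnorm M R (homological_rhs N X h g i)"
      by (rule pnorm_mono_coeff [OF R0]) (simp add: scaled_bound)
    also have "1 * pnorm M R (homological_rhs N X h g i) \<le>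
        pnorm M R (mfps_compose (X $ i) (vars + h) + (\<Sum>j\<in>UNIV. mfps_const (N $ i $ j) * h $ j))
        + pnorm M R (lie perturbation (h $ i))"
      unfolding homological_rhs_def perturbation_def mult_1 by (rule pnorm_diff) (rule R0)
    also have "pnorm M R (lie perturbation (h $ i)) \<le> lie_factor * (\<delta> * off_diagonal + x) * ?p i"
      by (rule pnorm_lie [OF \<tau> \<tau>0])
    also have "pnorm M R (mfps_compose (X $ i) (vars + h) + (\<Sum>j\<in>UNIV. mfps_const (N $ i $ j) * h $ j)) \<le>
        pnorm M R (mfps_compose (X $ i) (vars + h)) + pnorm M R (\<Sum>j\<in>UNIV. mfps_const (N $ i $ j) * h $ j)"
      by (rule pnorm_add) (rule R0)
    also have "pnorm M R (\<Sum>j\<in>UNIV. mfps_const (N $ i $ j) * h $ j) \<le>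
        (\<Sum>j\<in>UNIV. cmod (N $ i $ j) * pnorm M R (h $ j))"
      unfolding pnorm_const_mult [symmetric] by (rule pnorm_sum) (rule R0)
    also have "\<dots> \<le> (\<Sum>j\<in>UNIV. cmod (N $ i $ j) * (\<delta> * R i) * (C * (?p j / R j)))"
    proof (rule sum_mono)
      fix j
      have "cmod (N $ i $ j) * pnorm M R (h $ j) \<le> cmod (N $ i $ j) * (C * ?p j)"
        by (intro mult_left_mono pnorm_h) simp
      also have "\<dots> = (cmod (N $ i $ j) * R j) * (C * (?p j / R j))" using R [of j] by simp
      also have "\<dots> \<le> (cmod (N $ i $ j) * (\<delta> * R i)) * (C * (?p j / R j))"
        using C(1) p0 R0 by (intro mult_right_mono NR) auto
      finally show "cmod (N $ i $ j) * pnorm M R (h $ j) \<le> cmod (N $ i $ j) * (\<delta> * R i) * (C * (?p j / R j))" .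
    qed
    also have "\<dots> = \<delta> * C * (\<Sum>j\<in>UNIV. cmod (N $ i $ j) * (?p j / R j)) * R i"
      by (simp add: sum_distrib_left sum_distrib_right mult_ac)
    finally have "?p i \<le> x * R i + \<delta> * C * (\<Sum>j\<in>UNIV. cmod (N $ i $ j) * (?p j / R j)) * R i + lie_factor * (\<delta> * off_diagonal + x) * ?p i"
      using x(1) [of i] by simp
    then have "?p i / R i \<le> (x * R i + \<delta> * C * (\<Sum>j\<in>UNIV. cmod (N $ i $ j) * (?p j / R j)) * R i + lie_factor * (\<delta> * off_diagonal + x) * ?p i) / R i"
      using R0 by (rule divide_right_mono)
    then show ?thesis using R [of i] by (simp add: add_divide_distrib)
  qed
  have "radial_size M R \<le> (\<Sum>i\<in>UNIV. x + \<delta> * C * (\<Sum>j\<in>UNIV. cmod (N $ i $ j) * (?p j / R j)) + lie_factor * (\<delta> * off_diagonal + x) * (?p i / R i))"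
    unfolding radial_size_def by (intro sum_mono comp)
  also have "\<dots> = real CARD('n) * x + \<delta> * C * (\<Sum>i\<in>UNIV. \<Sum>j\<in>UNIV. cmod (N $ i $ j) * (?p j / R j)) + lie_factor * (\<delta> * off_diagonal + x) * radial_size M R"
    unfolding radial_size_def sum.distrib by (simp add: sum_distrib_left)
  also have "(\<Sum>i\<in>UNIV. \<Sum>j\<in>UNIV. cmod (N $ i $ j) * (?p j / R j)) = (\<Sum>j\<in>UNIV. (\<Sum>i\<in>UNIV. cmod (N $ i $ j)) * (?p j / R j))"
    unfolding sum_distrib_right by (rule sum.swap)
  also have "\<delta> * C * (\<Sum>j\<in>UNIV. (\<Sum>i\<in>UNIV. cmod (N $ i $ j)) * (?p j / R j)) \<le> \<delta> * C * (\<Sum>j\<in>UNIV. off_diagonal * (?p j / R j))"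
    using \<delta>(2) C(1) p0 R0
    by (intro mult_left_mono sum_mono mult_right_mono column_le_off_diagonal) auto
  also have "\<delta> * C * (\<Sum>j\<in>UNIV. off_diagonal * (?p j / R j)) = \<delta> * off_diagonal * C * radial_size M R"
    by (simp add: radial_size_def sum_distrib_left mult_ac)
  finally show ?thesis by (simp add: algebra_simps)
qed

end

text \<open>
  As a function of a common factor of the radii the size of \<open>h\<close> is a polynomial without constant
  term.  The estimate forbids it to take the value \<open>1\<close>, so it stays below by continuity.
\<close>

lemma radial_size_le_1:
  assumes \<rho>: "\<And>i. 1 \<le> \<rho> i" "\<And>i j. N $ i $ j \<noteq> 0 \<Longrightarrow> \<rho> j \<le> \<delta> * \<rho> i" and \<delta>0: "0 \<le> \<delta>"
    and \<delta>: "\<delta> * off_diagonal * C + lie_factor * \<delta> * off_diagonal \<le> 1 / 4"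
    and \<eta>: "0 < \<eta>" and K: "0 \<le> K" "\<And>i M. pnorm M (\<lambda>_. \<eta>) (X $ i) \<le> K"
  obtains r where "0 < r" "\<And>M. radial_size M (\<lambda>i. r * \<rho> i) \<le> 1"
proof -
  define \<rho>m where "\<rho>m = Max (range \<rho>)"
  have \<rho>m: "\<rho> i \<le> \<rho>m" for i by (simp add: \<rho>m_def)
  have \<rho>m1: "1 \<le> \<rho>m" using \<rho>(1) \<rho>m by (rule order.trans)
  \<comment> \<open>If the size is at most \<open>1\<close>, the components of $y+h$ at radii \<open>r * \<rho> i\<close> are at most \<open>r * a * \<eta>\<close>.\<close>
  define a where "a = (1 + C) * \<rho>m / \<eta>"
  have a: "0 < a" using C(1) \<rho>m1 \<eta> by (simp add: a_def)
  define b where "b = a\<^sup>2 * K * (real CARD('n) + lie_factor)"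
  have b: "0 \<le> b" using K lie_factor_nonneg by (simp add: b_def)
  define r0 where "r0 = min (1 / a) (1 / (4 * (b + 1)))"
  have r0: "0 < r0" using a b by (simp add: r0_def)
  have small: "radial_size M (\<lambda>i. r * \<rho> i) < 1" if r: "0 < r" "r \<le> r0" and le: "radial_size M (\<lambda>i. r * \<rho> i) \<le> 1" for r M
  proof -
    let ?R = "\<lambda>i. r * \<rho> i"
    have Rp: "0 < ?R i" for i using r(1) \<rho>(1) [of i] by simp
    have R0: "0 \<le> ?R i" for i using Rp [of i] by simp
    have ra: "r * a \<le> 1" and rb: "r * b \<le> 1 / 4"
    proof -
      have "r \<le> 1 / a" "r \<le> 1 / (4 * (b + 1))" using r(2) by (simp_all add: r0_def)
      then show "r * a \<le> 1" using a by (simp add: field_simps)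
      have "r * (4 * (b + 1)) \<le> 1" using \<open>r \<le> 1 / (4 * (b + 1))\<close> b by (simp add: pos_le_divide_eq)
      then show "r * b \<le> 1 / 4" using r(1) by (simp add: algebra_simps)
    qed
    have Hn: "pnorm M ?R ((vars + h) $ j) \<le> (1 + C) * ?R j" for j
    proof -
      have "pnorm M ?R ((vars + h) $ j) \<le> pnorm M ?R (mfps_var j) + pnorm M ?R (h $ j)"
        using pnorm_add [of ?R M "mfps_var j" "h $ j"] R0 by simp
      also have "pnorm M ?R (mfps_var j) \<le> ?R j" by (rule pnorm_var) (rule R0)
      also have "pnorm M ?R (h $ j) \<le> C * pnorm M ?R (scaled j)" by (rule pnorm_h) (rule Rp)
      also have "pnorm M ?R (scaled j) \<le> radial_size M ?R * ?R j" by (rule pnorm_scaled_le) (rule Rp)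
      also have "\<dots> \<le> 1 * ?R j"
        using mult_right_mono [OF le R0 [of j]] by linarith
      finally show ?thesis using C(1) by (simp add: algebra_simps)
    qed
    define x where "x = r * (a\<^sup>2 * K)"
    have x0: "0 \<le> x" using r(1) K by (simp add: x_def)
    have "pnorm M ?R (mfps_compose (X $ i) (vars + h)) \<le> x * ?R i" for i
    proof -
      have "pnorm M ?R (mfps_compose (X $ i) (vars + h)) \<le> pnorm M (\<lambda>j. pnorm M ?R ((vars + h) $ j)) (X $ i)"
        by (rule pnorm_compose [OF R0]) (rule order_near_vars, simp add: h2)
      also have "\<dots> \<le> pnorm M (\<lambda>j. (1 + C) * ?R j) (X $ i)"
        by (rule pnorm_mono_radius [OF pnorm_nonneg [OF R0] Hn])
      also have "\<dots> \<le> (r * a)\<^sup>2 * pnorm M (\<lambda>_. \<eta>) (X $ i)"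
      proof (rule pnorm_order_2 [OF _ _ _ ra _ X2])
        show "0 \<le> (1 + C) * ?R j" for j using C(1) R0 [of j] by (intro mult_nonneg_nonneg [of "1 + C"]) auto
        have "(1 + C) * ?R j \<le> (1 + C) * (r * \<rho>m)" for j
          using C(1) r(1) \<rho>m by (intro mult_left_mono) auto
        then show "(1 + C) * ?R j \<le> r * a * \<eta>" for j
          using \<eta> by (simp add: a_def mult_ac)
      qed (use r(1) a \<eta> in auto)
      also have "\<dots> \<le> (r * a)\<^sup>2 * K" by (intro mult_left_mono K(2)) simp
      also have "\<dots> = x * r" by (simp add: x_def power2_eq_square mult_ac)
      also have "\<dots> \<le> x * ?R i"
        using \<rho>(1) [of i] r(1) x0 by (intro mult_left_mono) auto
      finally show ?thesis .
    qed
    then have "radial_size M ?R \<le> real CARD('n) * x + (\<delta> * off_diagonal * C + lie_factor * (\<delta> * off_diagonal + x)) * radial_size M ?R"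
      using \<rho>(2) r(1) x0 \<delta>0
      by (intro radial_size_estimate [OF Rp]) (auto simp: mult.left_commute [of _ r])
    also have "\<dots> \<le> real CARD('n) * x + (\<delta> * off_diagonal * C + lie_factor * (\<delta> * off_diagonal + x)) * 1"
      using \<delta>0 off_diagonal_nonneg C(1) lie_factor_nonneg x0 le
      by (intro add_left_mono mult_left_mono add_nonneg_nonneg mult_nonneg_nonneg) auto
    also have "\<dots> = (\<delta> * off_diagonal * C + lie_factor * \<delta> * off_diagonal) + r * b"
      by (simp add: x_def b_def algebra_simps)
    also have "\<dots> \<le> 1 / 4 + 1 / 4" using \<delta> rb by (rule add_mono)
    finally show ?thesis by simp
  qed
  \<comment> \<open>The same quantity with the division by \<open>r\<close> carried out, so that it makes sense at \<open>r = 0\<close>.\<close>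
  define f where "f M r = (\<Sum>i\<in>UNIV. \<Sum>\<alpha> | mdeg \<alpha> \<le> M.
    cmod (mfps_coeff (scaled i) \<alpha>) * rpow \<rho> \<alpha> / \<rho> i * r ^ (mdeg \<alpha> - 1))" for M r
  have scaled0: "mfps_coeff (scaled i) \<alpha> = 0" if "mdeg \<alpha> < 2" for i \<alpha>
    using h2 [of i] that by (simp add: coeff_scaled order_at_least_def)
  have f: "f M r = radial_size M (\<lambda>i. r * \<rho> i)" if "0 < r" for M r
    unfolding f_def radial_size_def pnorm_def sum_divide_distrib
  proof (intro sum.cong refl)
    fix i and \<alpha> :: "nat ^ 'n"
    show "cmod (mfps_coeff (scaled i) \<alpha>) * rpow \<rho> \<alpha> / \<rho> i * r ^ (mdeg \<alpha> - 1) =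
      cmod (mfps_coeff (scaled i) \<alpha>) * rpow (\<lambda>i. r * \<rho> i) \<alpha> / (r * \<rho> i)"
    proof (cases "mdeg \<alpha> < 2")
      case False
      then have "r ^ mdeg \<alpha> = r * r ^ (mdeg \<alpha> - 1)" by (metis less_imp_Suc_add not_less_iff_gr_or_eq power_Suc diff_Suc_1 One_nat_def less_2_cases_iff)
      with \<open>0 < r\<close> show ?thesis by (simp add: rpow_scale)
    qed (simp add: scaled0)
  qed
  have f0: "f M 0 = 0" for M
    unfolding f_def
  proof (intro sum.neutral ballI)
    fix i and \<alpha> :: "nat ^ 'n"
    show "cmod (mfps_coeff (scaled i) \<alpha>) * rpow \<rho> \<alpha> / \<rho> i * 0 ^ (mdeg \<alpha> - 1) = 0"
      by (cases "mdeg \<alpha> < 2") (auto simp: scaled0)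
  qed
  have "f M r0 \<le> 1" for M
  proof (rule ccontr)
    assume "\<not> f M r0 \<le> 1"
    moreover have "continuous_on {0..r0} (f M)"
      unfolding f_def divide_inverse by (intro continuous_intros)
    ultimately have "\<exists>r. 0 \<le> r \<and> r \<le> r0 \<and> f M r = 1"
      using r0 by (intro IVT') (simp_all add: f0)
    then obtain r where r: "0 \<le> r" "r \<le> r0" "f M r = 1" by blast
    with f0 have "0 < r" by (metis order_le_less zero_neq_one)
    with small [of r M] f [of r M] r show False by simp
  qed
  with f [OF r0] that [OF r0] show ?thesis by simp
qed

text \<open>
  The radii grow geometrically along \<open>p\<close>.  As every nonzero entry of \<open>N\<close> leads to a strictly lower
  position, this makes the nilpotent part as small as desired.
\<close>

lemma convergent:
  fixes p :: "'n \<Rightarrow> nat"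
  assumes p: "\<And>i j. N $ i $ j \<noteq> 0 \<Longrightarrow> p j < p i"
    and \<eta>: "0 < \<eta>" and K: "0 \<le> K" "\<And>i M. pnorm M (\<lambda>_. \<eta>) (X $ i) \<le> K"
  shows "convergent_fvec (vars + h)"
proof -
  define B where "B = off_diagonal * C + lie_factor * off_diagonal"
  have B: "0 \<le> B" using off_diagonal_nonneg C(1) lie_factor_nonneg by (simp add: B_def)
  define \<delta> where "\<delta> = 1 / (4 * (B + 1))"
  have \<delta>: "0 < \<delta>" "\<delta> \<le> 1" "\<delta> * B \<le> 1 / 4" using B by (auto simp: \<delta>_def field_simps)
  define \<rho> where "\<rho> i = (1 / \<delta>) ^ p i" for i
  have \<rho>1: "1 \<le> \<rho> i" for i unfolding \<rho>_def using \<delta> by (intro one_le_power) simp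
  have "\<rho> j \<le> \<delta> * \<rho> i" if "N $ i $ j \<noteq> 0" for i j
  proof -
    have "(1 / \<delta>) ^ Suc (p j) \<le> (1 / \<delta>) ^ p i"
      using p [OF that] \<delta> by (intro power_increasing) auto
    then show ?thesis using \<delta>(1) by (simp add: \<rho>_def field_simps)
  qed
  moreover have "\<delta> * off_diagonal * C + lie_factor * \<delta> * off_diagonal \<le> 1 / 4"
    using \<delta>(3) by (simp add: B_def algebra_simps)
  ultimately obtain r where r: "0 < r" "\<And>M. radial_size M (\<lambda>i. r * \<rho> i) \<le> 1"
    using radial_size_le_1 [of \<rho> \<delta> \<eta> K] \<rho>1 \<delta>(1) \<eta> K by (metis less_imp_le)
  let ?R = "\<lambda>i. r * \<rho> i"
  have R: "0 < ?R i" for i using r(1) \<rho>1 [of i] by simp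
  show ?thesis
    unfolding convergent_fvec_def
  proof (intro allI convergent_of_pnorm_bounded [OF R])
    fix i M
    have "pnorm M ?R ((vars + h) $ i) \<le> pnorm M ?R (mfps_var i) + pnorm M ?R (h $ i)"
      using pnorm_add [of ?R M "mfps_var i" "h $ i"] R [THEN less_imp_le] by simp
    also have "pnorm M ?R (mfps_var i) \<le> ?R i" by (rule pnorm_var) (rule R [THEN less_imp_le])
    also have "pnorm M ?R (h $ i) \<le> C * pnorm M ?R (scaled i)" by (rule pnorm_h) (rule R)
    also have "pnorm M ?R (scaled i) \<le> radial_size M ?R * ?R i" by (rule pnorm_scaled_le) (rule R)
    also have "\<dots> \<le> 1 * ?R i"
      using mult_right_mono [OF r(2) R [THEN less_imp_le], of M i] by linarith
    finally show "pnorm M ?R ((vars + h) $ i) \<le> ?R i + C * (1 * ?R i)" using C(1) by simp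
  qed
qed

end

section \<open>Convergent normalization\<close>

lemma poincare_dulac_of_weights:
  assumes "\<And>i \<alpha>. mfps_coeff (G $ i) \<alpha> \<noteq> 0 \<Longrightarrow> weight lam \<alpha> = lam $ i"
  shows "poincare_dulac lam G"
  unfolding poincare_dulac_def
proof (intro ballI impI)
  fix Q assume Q: "pairing Q lam \<noteq> 0"
  have "vf_coeff G Q $ i = 0" for i
  proof (cases "Q \<in> exponents_at i")
    case True
    let ?\<alpha> = "\<chi> j. nat (Q $ j + axis i 1 $ j)"
    have "0 \<le> Q $ j + axis i 1 $ j" for j
      using True by (cases "j = i") (auto simp: exponents_at_def axis_def)
    then have "weight lam ?\<alpha> = (\<Sum>j\<in>UNIV. of_int (Q $ j) * lam $ j + (if j = i then lam $ j else 0))"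
      unfolding weight_def by (intro sum.cong refl) (auto simp: axis_def algebra_simps)
    also have "\<dots> = pairing Q lam + lam $ i" by (simp add: pairing_def sum.distrib)
    finally have "weight lam ?\<alpha> \<noteq> lam $ i" using Q by simp
    then show ?thesis using assms [of i ?\<alpha>] True by (auto simp: vf_coeff_def)
  qed (simp add: vf_coeff_def)
  then show "vf_coeff G Q = 0" by (simp add: vec_eq_iff)
qed

text \<open>The positions enumerate the indices by the numbers from one to the dimension.\<close>

lemma card_position_le:
  assumes "l \<le> CARD('n::{finite, linorder})"
  shows "card {i :: 'n. position i \<le> l} = l"
proof -
  have mono: "position i < position j" if "i < j" for i j :: 'n
  proof -
    have "{k. k \<le> i} \<subseteq> {k. k \<le> j}" "j \<in> {k. k \<le> j}" "j \<notin> {k. k \<le> i}" using that by auto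
    then have "{k. k \<le> i} \<subset> {k. k \<le> j}" by blast
    then show ?thesis unfolding position_def by (intro psubset_card_mono) auto
  qed
  then have inj: "inj (position :: 'n \<Rightarrow> nat)"
    by (auto simp: inj_on_def) (metis less_irrefl linorder_neqE)
  have "position ` (UNIV :: 'n set) \<subseteq> {1..CARD('n)}"
    unfolding position_def by (auto simp: Suc_le_eq card_gt_0_iff One_nat_def intro!: card_mono)
  then have img: "position ` (UNIV :: 'n set) = {1..CARD('n)}"
    by (intro card_subset_eq) (simp_all add: card_image [OF inj])
  have "position ` {i :: 'n. position i \<le> l} = {1..l}"
  proof (intro equalityI subsetI)
    fix k assume k: "k \<in> {1..l}"
    with assms have "k \<in> position ` (UNIV :: 'n set)" by (simp add: img)
    with k show "k \<in> position ` {i :: 'n. position i \<le> l}" by auto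
  qed (use img in auto)
  then have "card (position ` {i :: 'n. position i \<le> l}) = l" by simp
  then show ?thesis using card_image [OF inj_on_subset [OF inj subset_UNIV]] by metis
qed

theorem proposition76:
  fixes F :: "complex ^ 'n::{finite, linorder} \<Rightarrow> complex ^ 'n::{finite, linorder}"
    and P X :: "'n fvec"
    and A :: "complex ^ 'n::{finite, linorder} ^ 'n::{finite, linorder}"
    and lam \<sigma> :: "complex ^ 'n::{finite, linorder}"
    and \<mu> \<nu> :: "real ^ 'n::{finite, linorder}"
    and l :: nat
    and \<psi> :: "(complex, 'n) mfps ^ 'm::finite"
  assumes analytic: "has_power_series_at_0 F P"
    and decomposition: "P = linear_field A + X"
    and higher_order: "\<And>i. order_at_least 2 (X $ i)"
    and jordan: "A = jordan_matrix lam \<sigma>" "jordan_data lam \<sigma>"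
    and eigenvalues: "\<And>i. lam $ i = Complex (\<mu> $ i) (\<nu> $ i)"
    and l: "2 \<le> l" "l \<le> CARD('n)"
    and zero_part: "\<And>i. position i \<le> l \<Longrightarrow> \<mu> $ i = 0"
    and positive_part: "\<And>i. l < position i \<Longrightarrow> 0 < \<mu> $ i"
    and monotone_part: "\<And>i j. l < position i \<Longrightarrow> i \<le> j \<Longrightarrow> \<mu> $ i \<le> \<mu> $ j"
    and nonzero: "\<exists>i. position i \<le> l \<and> lam $ i \<noteq> 0"
    and card_integrals: "CARD('m) = l - 1"
    and integrals: "\<And>k. first_integral P (\<psi> $ k)"
    and independent: "independent_mfps \<psi>"
  shows "\<exists>H. normalizing lam P H \<and> convergent_fvec H"
proof -
  define S where "S = {i :: 'n. position i \<le> l}"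
  have card: "card S \<le> Suc CARD('m)"
    using card_position_le [OF l(2)] card_integrals by (simp add: S_def)
  have re: "Re (lam $ i) = 0" if "i \<in> S" for i
    using that zero_part by (simp add: S_def eigenvalues)
  have re': "Re (lam $ i) > 0" if "i \<notin> S" for i
    using that positive_part by (simp add: S_def eigenvalues)
  obtain j0 where j0: "j0 \<in> S" "lam $ j0 \<noteq> 0" using nonzero by (auto simp: S_def)
  define N where "N = (\<chi> i j. if i = j then 0 else A $ i $ j)"
  have Nnz: "position i = position j + 1 \<and> \<sigma> $ i \<noteq> 0" if "N $ i $ j \<noteq> 0" for i j
    using that by (auto simp: N_def jordan(1) jordan_matrix_def split: if_splits)
  have N: "position j < position i" if "N $ i $ j \<noteq> 0" for i j
    using Nnz [OF that] by simp
  have N_lam: "lam $ j = lam $ i" if "N $ i $ j \<noteq> 0" for i j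
  proof (rule ccontr)
    assume "lam $ j \<noteq> lam $ i"
    then have "lam $ i \<noteq> lam $ j" by simp
    with Nnz [OF that] jordan(2) show False unfolding jordan_data_def by blast
  qed
  have "A = (\<chi> i j. if i = j then lam $ i else 0) + N"
    by (auto simp: vec_eq_iff N_def jordan(1) jordan_matrix_def)
  then have P: "P = diagonal_field lam + linear_field N + X"
    unfolding decomposition by (simp only: linear_field_add linear_field_diagonal)

  obtain h g :: "'n fvec" where h2: "\<And>i. order_at_least 2 (h $ i)" and g2: "\<And>i. order_at_least 2 (g $ i)"
    and h_nonres: "\<And>i \<alpha>. mfps_coeff (h $ i) \<alpha> \<noteq> 0 \<Longrightarrow> weight lam \<alpha> \<noteq> lam $ i"
    and g_res: "\<And>i \<alpha>. mfps_coeff (g $ i) \<alpha> \<noteq> 0 \<Longrightarrow> weight lam \<alpha> = lam $ i"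
    and eq: "\<And>i \<alpha>. (weight lam \<alpha> - lam $ i) * mfps_coeff (h $ i) \<alpha> + mfps_coeff (g $ i) \<alpha> =
       mfps_coeff (homological_rhs N X h g i) \<alpha>"
    using homological_equation [of N position X lam, OF N higher_order] by metis
  define H where "H = vars + h"
  define G where "G = diagonal_field lam + linear_field N + g"
  have H2: "order_at_least 2 (H $ i - mfps_var i)" for i by (simp add: H_def h2)
  have H1: "order_at_least 1 (H $ i)" for i by (rule order_near_vars [OF H2])
  have conj: "lie G (H $ i) = mfps_compose (P $ i) H" for i
    unfolding G_def H_def P by (rule conjugation_of_homological_equation [OF h2 eq])

  define \<phi> where "\<phi> k = mfps_compose (\<psi> $ k) H" for k
  have int: "lie G (\<phi> k) = 0" for k
    using integrals [of k] unfolding \<phi>_def lie_compose [OF H1 conj]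
    by (simp add: first_integral_def lie_def)
  have res: "mfps_coeff (\<phi> k) \<alpha> = 0" if "weight lam \<alpha> \<noteq> 0" for k \<alpha>
    by (rule first_integral_resonant [of N position lam g, OF N N_lam g2 g_res _ that])
      (use int in \<open>simp_all add: G_def\<close>)
  have rank: "rank (map_matrix (\<lambda>f. Fract f 1) (jacobian \<psi>)) = CARD('m)"
    using independent l card_integrals by (simp add: independent_mfps_def)
  have ind: "c k = 0" if "\<And>j. (\<Sum>k\<in>UNIV. c k * mfps_deriv j (\<phi> k)) = 0" for c k
    by (rule independent_compose [OF rank H2]) (use that in \<open>simp add: \<phi>_def\<close>)
  have central: "diagonal_field lam $ i * (linear_field N + g) $ j = diagonal_field lam $ j * (linear_field N + g) $ i"
    if "i \<in> S" "j \<in> S" for i j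
  proof -
    have "diagonal_field lam $ i * G $ j = diagonal_field lam $ j * G $ i"
      by (rule central_direction [of S lam \<phi> G]) (fact re re' card res ind int that)+
    then show ?thesis by (simp add: G_def algebra_simps)
  qed
  have "\<exists>(\<theta> :: complex) k :: 'n \<Rightarrow> int. \<theta> \<noteq> 0 \<and> (\<forall>i\<in>S. lam $ i = \<theta> * of_int (k i))"
    by (rule central_eigenvalues_commensurable [of S lam \<phi> j0]) (fact re re' card res ind j0)+
  then obtain \<theta> :: complex and k :: "'n \<Rightarrow> int"
    where \<theta>: "\<theta> \<noteq> 0" "\<And>i. i \<in> S \<Longrightarrow> lam $ i = \<theta> * of_int (k i)" by blast
  have "\<exists>C. divisors_dominate S lam C"
    by (rule divisor_bound [of S lam \<theta> k]) (fact re re' \<theta>)+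
  then obtain C where C: "divisors_dominate S lam C" ..
  interpret formal_conjugation lam N X h g S j0 C
    by unfold_locales (fact N_lam higher_order h2 g2 h_nonres g_res eq j0 central C)+

  obtain \<eta> K where \<eta>: "0 < \<eta>" "0 \<le> K" "\<And>i M. pnorm M (\<lambda>_. \<eta>) (P $ i) \<le> K"
    using pnorm_bounded_of_power_series [OF analytic] by metis
  have "pnorm M (\<lambda>_. \<eta>) (X $ i) \<le> K" for i M
  proof -
    have "cmod (mfps_coeff (X $ i) \<alpha>) \<le> 1 * cmod (mfps_coeff (P $ i) \<alpha>)" for \<alpha>
    proof (cases "mdeg \<alpha> < 2")
      case True
      then show ?thesis using higher_order [of i] by (simp add: order_at_least_def)
    next
      case False
      then have "mfps_coeff (linear_field A $ i) \<alpha> = 0"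
        by (auto simp: linear_field_def coeff_var intro!: sum.neutral)
      then show ?thesis by (simp add: decomposition)
    qed
    then have "pnorm M (\<lambda>_. \<eta>) (X $ i) \<le> 1 * pnorm M (\<lambda>_. \<eta>) (P $ i)"
      using \<eta>(1) by (intro pnorm_mono_coeff) auto
    with \<eta>(3) [of M i] show ?thesis by simp
  qed
  then have "convergent_fvec H"
    unfolding H_def by (intro convergent [of position, OF N \<eta>(1,2)])
  moreover have "normalizing lam P H"
    unfolding normalizing_def
  proof (intro conjI exI)
    show "transformation H"
      unfolding transformation_def H_def vars_def using h2 by blast
    show "transforms_to P H G"
      unfolding transforms_to_def using conj
      by (simp add: vec_eq_iff matrix_vector_mult_def jacobian_def lie_def)
    show "poincare_dulac lam G"
    proof (rule poincare_dulac_of_weights)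
      fix i \<alpha> assume nz: "mfps_coeff (G $ i) \<alpha> \<noteq> 0"
      show "weight lam \<alpha> = lam $ i"
      proof (cases "mfps_coeff (perturbation $ i) \<alpha> = 0")
        case True
        with nz have "mfps_coeff (diagonal_field lam $ i) \<alpha> \<noteq> 0"
          by (simp add: G_def perturbation_def add.assoc)
        then have "\<alpha> = axis i 1" by (auto simp: diagonal_field_def coeff_var split: if_splits)
        then show ?thesis by simp
      qed (rule perturbation_res)
    qed
  qed
  ultimately show ?thesis by blast
qed

end
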